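(* Let $M$ and $N$ be smooth manifolds of dimensions $m$ and $d$ respectively. For each integer $k\ge 0$ and each $\alpha\in[0,1)$, the weak and strong $C^{k+\alpha}$-Whitney topologies (on the space of maps $M\to N$ of class $C^{k+\alpha}$) are Baire, i.e. the intersection of any countable family of open and dense subsets is dense. The weak and strong $C^{k+\mathrm{Lip}}$-Whitney topologies are also Baire for each integer $k\geq 0$.
   Context: Manifolds are second countable and Hausdorff. Semi-norms. Let $K\subset\mathbb{R}^m$ be compact and $f$ a $C^k$ mapping from a neighbourhood of $K$ to $\mathbb{R}^d$. Set $[f]_{C^k,K}=\max_{0<j\le k}\sup_{x\in K}|D^jf(x)|$ (equal to $0$ if $k=0$), where $|\cdot|$ is the operator norm on the space $L^j_{\mathrm{sym}}(\mathbb{R}^m,\mathbb{R}^d)$ of symmetric $j$-linear maps. For $\alpha\in(0,1)$ and a map $g$ from $K$ into a Banach space $(E,|\cdot|_E)$ let $[g]_{\alpha,K}=\sup_{x,y\in K,\,x\ne y}\frac{|g(x)-g(y)|_E}{d(x,y)^\alpha}$, and let $[g]_{\mathrm{Lip},K}$ be the same expression with exponent $1$. Define $[f]_{C^{k+\alpha},K}=[f]_{C^k,K}+[D^kf]_{\alpha,K}$ for $\alpha\in(0,1)$ (for $C^k$ maps $f$ on a neighbourhood of $K$ whose $k$th derivative is $\alpha$-Hölder on $K$) and $[f]_{C^{k+\mathrm{Lip}},K}=[f]_{C^k,K}+[D^kf]_{\mathrm{Lip},K}$. For $\alpha=0$ the $C^{k+\alpha}$-semi-norm is $[f]_{C^k,K}$.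 Topologies. Let $\mathcal{F}=\{[\,\cdot\,]_K\}_K$ be one of these families. Put $\|\cdot\|_K=\|\cdot\|_{C^0(K,\mathbb{R}^d)}+[\,\cdot\,]_K$ with $\|\cdot\|_{C^0}$ the sup-norm. $C^{\mathcal{F}}(M,N)$ is the set of $f\in C^0(M,N)$ which in local charts have (well-defined and) finite norm $\|\cdot\|_K$ on each compact subset $K$. For a chart $(U,\varphi)$ of $M$, a chart $(V,\psi)$ of $N$, a compact $K\subset U$, $\epsilon\in(0,+\infty]$ and $f\in C^{\mathcal{F}}(M,N)$ with $f(K)\subset V$, let $\mathcal{N}(f;(U,\varphi),(V,\psi),K,\epsilon)$ be the set of $g\in C^{\mathcal{F}}(M,N)$ with $g(K)\subset V$ and $\|\psi\circ f\circ\varphi^{-1}-\psi\circ g\circ\varphi^{-1}\|_{\varphi(K)}<\epsilon$. The weak $\mathcal{F}$-Whitney topology is the topology on $C^{\mathcal{F}}(M,N)$ generated by these sets (as a sub-base). For a locally finite collection of charts $\Phi=\{(U_t,\varphi_t)\}_{t\in T}$ on $M$, a collection of charts $\Psi=\{(V_t,\psi_t)\}_{t\in T}$ on $N$, compact sets $K_t\subset U_t$, $\epsilon_t\in(0,+\infty]$, and $f\in C^{\mathcal{F}}(M,N)$ with $f(K_t)\subset V_t$ for all $t$, let $\mathcal{N}_s(f;\Phi,\Psi,K,\epsilon)$ be the set of $g\in C^{\mathcal{F}}(M,N)$ such that for each $t\in T$, $g(K_t)\subset V_t$ and $\|\psi_t\circ f\circ\varphi_t^{-1}-\psi_t\circ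 g\circ\varphi_t^{-1}\|_{\varphi_t(K_t)}<\epsilon_t$. The strong $\mathcal{F}$-Whitney topology is the topology with these sets as a base. The weak and strong $C^{k+\alpha}$-Whitney (resp. $C^{k+\mathrm{Lip}}$-Whitney) topologies are the weak and strong $\mathcal{F}$-Whitney topologies for $\mathcal{F}$ the family of $C^{k+\alpha}$-semi-norms (resp. $C^{k+\mathrm{Lip}}$-semi-norms). *)

theory Defs
  imports "HOL-Analysis.Analysis"
begin

section \<open>Model spaces\<close>

text \<open>
  The class \<^class>\<open>euclidean_space\<close> excludes dimension zero because its basis must be nonempty.
  Dropping that requirement gives the finite-dimensional real inner product spaces, that is,
  all of \<open>\<real>\<^sup>n\<close> with \<open>n \<ge> 0\<close> up to linear isometry.
\<close>

class fin_dim_inner = real_inner +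
  assumes ex_orthonormal_basis:
    "\<exists>B. finite B \<and> (\<forall>u\<in>B. \<forall>v\<in>B. inner u v = (if u = v then 1 else 0)) \<and>
         (\<forall>x. (\<forall>u\<in>B. inner x u = 0) \<longleftrightarrow> x = 0)"

subclass (in euclidean_space) fin_dim_inner
  by standard
    (rule exI[of _ Basis], simp add: inner_Basis euclidean_all_zero_iff)


section \<open>Differentiability classes and higher derivatives\<close>

text \<open>
  Only meaningful for open \<open>S\<close>. In finite dimension, requiring each \<open>x \<mapsto> Df(x) v\<close> to be of class
  \<open>C\<^sup>n\<close> is the same as requiring the map \<open>Df\<close> into the space of linear maps to be of class \<open>C\<^sup>n\<close>.
\<close>

primrec Ck_on :: "nat \<Rightarrow> 'a::real_normed_vector set \<Rightarrow> ('a \<Rightarrow> 'b::real_normed_vector) \<Rightarrow> bool" where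
  "Ck_on 0 S f \<longleftrightarrow> continuous_on S f"
| "Ck_on (Suc n) S f \<longleftrightarrow>
     (\<forall>x\<in>S. f differentiable (at x)) \<and> (\<forall>v. Ck_on n S (\<lambda>x. frechet_derivative f (at x) v))"

definition smooth_on :: "'a::real_normed_vector set \<Rightarrow> ('a \<Rightarrow> 'b::real_normed_vector) \<Rightarrow> bool" where
  "smooth_on S f \<longleftrightarrow> (\<forall>n. Ck_on n S f)"

definition Ck_near :: "nat \<Rightarrow> ('a::real_normed_vector \<Rightarrow> 'b::real_normed_vector) \<Rightarrow> 'a set \<Rightarrow> bool" where
  "Ck_near k f K \<longleftrightarrow> (\<exists>W. open W \<and> K \<subseteq> W \<and> Ck_on k W f)"

text \<open>
  \<open>nth_deriv f x [v\<^sub>1, \<dots>, v\<^sub>j]\<close> is \<open>D\<^sup>jf(x)(v\<^sub>1, \<dots>, v\<^sub>j)\<close>: for \<open>f\<close> of class \<open>C\<^sup>j\<close> near \<open>x\<close>, the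
  \<open>j\<close>-linear form \<open>D\<^sup>jf(x)\<close> is computed by successive differentiation in the directions \<open>v\<^sub>1, \<dots>, v\<^sub>j\<close>.
  A \<open>j\<close>-linear map is represented by its values on lists of length \<open>j\<close>.
\<close>

primrec directional_deriv ::
    "('a::real_normed_vector \<Rightarrow> 'b::real_normed_vector) \<Rightarrow> 'a list \<Rightarrow> 'a \<Rightarrow> 'b" where
  "directional_deriv f [] = f"
| "directional_deriv f (v # vs) = directional_deriv (\<lambda>x. frechet_derivative f (at x) v) vs"

definition nth_deriv ::
    "('a::real_normed_vector \<Rightarrow> 'b::real_normed_vector) \<Rightarrow> 'a \<Rightarrow> 'a list \<Rightarrow> 'b" where
  "nth_deriv f x vs = directional_deriv f vs x"

definition op_norm :: "nat \<Rightarrow> ('a::real_normed_vector list \<Rightarrow> 'b::real_normed_vector) \<Rightarrow> ennreal" where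
  "op_norm j A = (SUP vs \<in> {vs. length vs = j \<and> (\<forall>v\<in>set vs. norm v \<le> 1)}. ennreal (norm (A vs)))"


section \<open>Semi-norms\<close>

text \<open>
  All semi-norms take values in \<open>[0, \<infinity>]\<close>; in \<^typ>\<open>ennreal\<close> the supremum of the empty set is \<open>0\<close>.
\<close>

definition Ck_seminorm ::
    "nat \<Rightarrow> ('a::real_normed_vector \<Rightarrow> 'b::real_normed_vector) \<Rightarrow> 'a set \<Rightarrow> ennreal" where
  "Ck_seminorm k f K = (SUP j \<in> {0<..k}. SUP x \<in> K. op_norm j (nth_deriv f x))"

definition deriv_hoelder_seminorm ::
    "nat \<Rightarrow> real \<Rightarrow> ('a::real_normed_vector \<Rightarrow> 'b::real_normed_vector) \<Rightarrow> 'a set \<Rightarrow> ennreal" where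
  "deriv_hoelder_seminorm k \<alpha> f K =
     (SUP x \<in> K. SUP y \<in> K - {x}.
        op_norm k (\<lambda>vs. nth_deriv f x vs - nth_deriv f y vs) / ennreal (dist x y powr \<alpha>))"

definition Ck_alpha_seminorm ::
    "nat \<Rightarrow> real \<Rightarrow> ('a::real_normed_vector \<Rightarrow> 'b::real_normed_vector) \<Rightarrow> 'a set \<Rightarrow> ennreal" where
  "Ck_alpha_seminorm k \<alpha> f K =
     (if \<alpha> = 0 then Ck_seminorm k f K else Ck_seminorm k f K + deriv_hoelder_seminorm k \<alpha> f K)"

definition Ck_Lip_seminorm ::
    "nat \<Rightarrow> ('a::real_normed_vector \<Rightarrow> 'b::real_normed_vector) \<Rightarrow> 'a set \<Rightarrow> ennreal" where
  "Ck_Lip_seminorm k f K = Ck_seminorm k f K + deriv_hoelder_seminorm k 1 f K"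

text \<open>
  A family of semi-norms is given by the order \<open>k\<close> of differentiability that it presupposes, together
  with \<open>(f, K) \<mapsto> [f]\<^sub>K\<close>, which is meaningful for maps of class \<open>C\<^sup>k\<close> near \<open>K\<close>.
\<close>

record ('m, 'd) seminorm_family =
  fam_order :: nat
  fam_seminorm :: "('m \<Rightarrow> 'd) \<Rightarrow> 'm set \<Rightarrow> ennreal"

definition Ck_alpha_family ::
    "nat \<Rightarrow> real \<Rightarrow> ('m::real_normed_vector, 'd::real_normed_vector) seminorm_family" where
  "Ck_alpha_family k \<alpha> = \<lparr>fam_order = k, fam_seminorm = Ck_alpha_seminorm k \<alpha>\<rparr>"

definition Ck_Lip_family ::
    "nat \<Rightarrow> ('m::real_normed_vector, 'd::real_normed_vector) seminorm_family" where
  "Ck_Lip_family k = \<lparr>fam_order = k, fam_seminorm = Ck_Lip_seminorm k\<rparr>"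

definition fam_norm ::
    "('m::real_normed_vector, 'd::real_normed_vector) seminorm_family \<Rightarrow> ('m \<Rightarrow> 'd) \<Rightarrow> 'm set \<Rightarrow> ennreal"
where
  "fam_norm F f K = (SUP x \<in> K. ennreal (norm (f x))) + fam_seminorm F f K"


section \<open>Smooth manifolds\<close>

text \<open>
  A chart is a pair \<open>(U, \<phi>)\<close>; the values of \<open>\<phi>\<close> outside \<open>U\<close> are irrelevant.
  The inverse of \<open>\<phi>\<close> on \<open>\<phi> ` U\<close> is \<^term>\<open>inv_into U \<phi>\<close>.
\<close>

type_synonym ('a, 'm) chart = "'a set \<times> ('a \<Rightarrow> 'm)"

record ('a, 'm) manifold =
  mtop :: "'a topology"
  charts :: "('a, 'm) chart set"

definition is_chart :: "'a topology \<Rightarrow> ('a, 'm::topological_space) chart \<Rightarrow> bool" where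
  "is_chart X c \<longleftrightarrow> (case c of (U, \<phi>) \<Rightarrow>
     openin X U \<and> open (\<phi> ` U) \<and>
     homeomorphic_map (subtopology X U) (top_of_set (\<phi> ` U)) \<phi>)"

definition smoothly_compatible ::
    "('a, 'm::real_normed_vector) chart \<Rightarrow> ('a, 'm) chart \<Rightarrow> bool" where
  "smoothly_compatible c c' \<longleftrightarrow> (case (c, c') of ((U, \<phi>), (V, \<psi>)) \<Rightarrow>
     smooth_on (\<phi> ` (U \<inter> V)) (\<psi> \<circ> inv_into U \<phi>) \<and>
     smooth_on (\<psi> ` (U \<inter> V)) (\<phi> \<circ> inv_into V \<psi>))"

text \<open>The set of charts is the maximal smooth atlas.\<close>

definition smooth_manifold :: "nat \<Rightarrow> ('a, 'm::fin_dim_inner) manifold \<Rightarrow> bool" where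
  "smooth_manifold m M \<longleftrightarrow>
     dim (UNIV :: 'm set) = m \<and>
     Hausdorff_space (mtop M) \<and> second_countable (mtop M) \<and>
     (\<forall>c\<in>charts M. is_chart (mtop M) c) \<and>
     (\<Union>c\<in>charts M. fst c) = topspace (mtop M) \<and>
     (\<forall>c\<in>charts M. \<forall>c'\<in>charts M. smoothly_compatible c c') \<and>
     (\<forall>c. is_chart (mtop M) c \<and> (\<forall>c'\<in>charts M. smoothly_compatible c c') \<longrightarrow> c \<in> charts M)"


section \<open>Whitney topologies\<close>

definition local_rep ::
    "('a, 'm) chart \<Rightarrow> ('b, 'd) chart \<Rightarrow> ('a \<Rightarrow> 'b) \<Rightarrow> 'm \<Rightarrow> 'd" where
  "local_rep c c' f = snd c' \<circ> f \<circ> inv_into (fst c) (snd c)"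

text \<open>
  Maps between the carriers are represented by extensional functions, so that equality of functions
  is equality on \<open>M\<close>.
\<close>

definition C_fam ::
    "('m::real_normed_vector, 'd::real_normed_vector) seminorm_family \<Rightarrow>
     ('a, 'm) manifold \<Rightarrow> ('b, 'd) manifold \<Rightarrow> ('a \<Rightarrow> 'b) set" where
  "C_fam F M N =
     {f \<in> extensional (topspace (mtop M)).
        continuous_map (mtop M) (mtop N) f \<and>
        (\<forall>c\<in>charts M. \<forall>c'\<in>charts N. \<forall>K.
           compactin (mtop M) K \<and> K \<subseteq> fst c \<and> f ` K \<subseteq> fst c' \<longrightarrow>
             Ck_near (fam_order F) (local_rep c c' f) (snd c ` K) \<and>
             fam_norm F (local_rep c c' f) (snd c ` K) < \<infinity>)}"

definition chart_close ::
    "('m::real_normed_vector, 'd::real_normed_vector) seminorm_family \<Rightarrow>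
     ('a, 'm) chart \<Rightarrow> ('b, 'd) chart \<Rightarrow> 'a set \<Rightarrow> ennreal \<Rightarrow> ('a \<Rightarrow> 'b) \<Rightarrow> ('a \<Rightarrow> 'b) \<Rightarrow> bool" where
  "chart_close F c c' K \<epsilon> f g \<longleftrightarrow>
     g ` K \<subseteq> fst c' \<and>
     fam_norm F (\<lambda>x. local_rep c c' f x - local_rep c c' g x) (snd c ` K) < \<epsilon>"

definition weak_nbhd where
  "weak_nbhd F M N f c c' K \<epsilon> = {g \<in> C_fam F M N. chart_close F c c' K \<epsilon> f g}"

definition weak_whitney ::
    "('m::real_normed_vector, 'd::real_normed_vector) seminorm_family \<Rightarrow>
     ('a, 'm) manifold \<Rightarrow> ('b, 'd) manifold \<Rightarrow> ('a \<Rightarrow> 'b) topology" where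
  "weak_whitney F M N = topology_generated_by
     {weak_nbhd F M N f c c' K \<epsilon> | f c c' K \<epsilon>.
        f \<in> C_fam F M N \<and> c \<in> charts M \<and> c' \<in> charts N \<and>
        compactin (mtop M) K \<and> K \<subseteq> fst c \<and> f ` K \<subseteq> fst c' \<and> 0 < \<epsilon>}"

definition locally_finite_family :: "'a topology \<Rightarrow> 't set \<Rightarrow> ('t \<Rightarrow> 'a set) \<Rightarrow> bool" where
  "locally_finite_family X T U \<longleftrightarrow>
     (\<forall>x\<in>topspace X. \<exists>W. openin X W \<and> x \<in> W \<and> finite {t\<in>T. U t \<inter> W \<noteq> {}})"

definition strong_nbhd where
  "strong_nbhd F M N f T \<Phi> \<Psi> K \<epsilon> =
     {g \<in> C_fam F M N. \<forall>t\<in>T. chart_close F (\<Phi> t) (\<Psi> t) (K t) (\<epsilon> t) f g}"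

text \<open>
  The index set \<open>T\<close> ranges over sets of natural numbers. This is no restriction: in a second
  countable space a locally finite family has only countably many nonempty members, and an index
  with an empty chart domain imposes no condition on \<open>g\<close>.

  The sets \<^const>\<open>strong_nbhd\<close> are a base: by the triangle inequality such a set contains, around each
  of its elements \<open>g\<close>, one centred at \<open>g\<close>, and two sets centred at the same \<open>g\<close> are intersected by
  taking the disjoint union of the index sets. So the topology generated by them is the one having
  them as a base.
\<close>

definition strong_whitney ::
    "('m::real_normed_vector, 'd::real_normed_vector) seminorm_family \<Rightarrow>
     ('a, 'm) manifold \<Rightarrow> ('b, 'd) manifold \<Rightarrow> ('a \<Rightarrow> 'b) topology" where
  "strong_whitney F M N = topology_generated_by
     {strong_nbhd F M N f T \<Phi> \<Psi> K \<epsilon> | f (T :: nat set) \<Phi> \<Psi> K \<epsilon>.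
        f \<in> C_fam F M N \<and>
        locally_finite_family (mtop M) T (\<lambda>t. fst (\<Phi> t)) \<and>
        (\<forall>t\<in>T. \<Phi> t \<in> charts M \<and> \<Psi> t \<in> charts N \<and>
           compactin (mtop M) (K t) \<and> K t \<subseteq> fst (\<Phi> t) \<and> f ` K t \<subseteq> fst (\<Psi> t) \<and> 0 < \<epsilon> t)}"


section \<open>Baire spaces\<close>

definition Baire_space :: "'a topology \<Rightarrow> bool" where
  "Baire_space X \<longleftrightarrow>
     (\<forall>\<G>. countable \<G> \<and> (\<forall>G\<in>\<G>. openin X G \<and> X closure_of G = topspace X) \<longrightarrow>
        X closure_of (topspace X \<inter> \<Inter>\<G>) = topspace X)"

end

theory Submission
  imports Defs
begin

text \<open>
  The proof is the Baire category argument for complete metric spaces, with compact sets in charts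
  in the role of closed balls. Write \<open>a\<close> for the Hoelder exponent; \<open>a = 1\<close> is the Lipschitz case, so
  \<open>0 \<le> a \<le> 1\<close> covers all cases of the theorem. A basic neighbourhood of \<open>f\<close> is given by a family of
  conditions \<open>(c, c', K, \<epsilon>)\<close>: read in the charts \<open>c\<close> and \<open>c'\<close>, the map is \<open>\<epsilon>\<close>-close to \<open>f\<close> on \<open>K\<close>. The
  families are finite for the weak topology and locally finite for the strong one. The argument uses
  only that admissible families contain the finite ones and are closed under unions and under changes
  of everything but the charts of \<open>M\<close>; the locale \<open>whitney_space\<close> records this, and both topologies
  are instances of it.

  Let \<open>G\<^sub>n\<close> be open and dense. Choose \<open>f\<^sub>n\<^sub>+\<^sub>1\<close> in \<open>G\<^sub>n\<close> and in the current neighbourhood of \<open>f\<^sub>n\<close>, and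
  shrink this neighbourhood. Conditions once imposed are kept, with radii at most \<open>2\<^sup>-\<^sup>n\<close> at stage \<open>n\<close>, so
  that \<open>f\<^sub>n\<close> is a Cauchy sequence for the \<open>C\<^sup>k\<^sup>+\<^sup>a\<close> norm on every compact set that ever occurs. The lemma
  \<open>refine_conds\<close> prepares the neighbourhoods so that the limit exists and has the right properties:

  \<^item> The radius at \<open>(c, c', K)\<close> is so small that a closed neighbourhood of the image of \<open>K\<close> stays inside
  the chart \<open>c'\<close>. Hence \<open>f\<^sub>n\<close> converges pointwise on \<open>K\<close>, in \<open>N\<close>, and the limit maps \<open>K\<close> into the domain
  of \<open>c'\<close>.

  \<^item> Uniform convergence of derivatives on \<open>K\<close> makes the limit differentiable only in the interior of
  \<open>K\<close>. So every condition on \<open>K\<close> is replaced by one on a compact set \<open>K'\<close> with \<open>K\<close> in its interior.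
  Since the norm is lower semicontinuous for pointwise convergence of all derivatives up to order \<open>k\<close>,
  the limit satisfies the original condition on \<open>K\<close>; it therefore lies in every \<open>G\<^sub>n\<close>. This is the
  content of \<open>Ckh_limit\<close>, and it holds although smooth maps need not be dense in the Hoelder norm.

  \<^item> At stage \<open>n\<close> finitely many conditions are added whose compact sets cover, with their interiors,
  the \<open>n\<close>-th member of a sequence of compact sets exhausting \<open>M\<close>. So near every point the limit is of
  class \<open>C\<^sup>k\<^sup>+\<^sup>a\<close> in some pair of charts.

  The function space demands regularity in all charts and a finite norm on all compact sets, convex
  or not. The lemma \<open>C_famI\<close> derives this from regularity near every point in one pair of charts. For
  this the class \<open>C\<^sup>k\<^sup>+\<^sup>a\<close> has to be local and stable under composition with smooth maps
  (\<open>Ckh_on_compose\<close>), and a locally Hoelder map has to be Hoelder on compact sets (\<open>compact_hoelder\<close>).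
\<close>

section \<open>Finite-dimensional inner product spaces\<close>

definition onb :: "'a::fin_dim_inner set" where
  "onb = (SOME B. finite B \<and> (\<forall>u\<in>B. \<forall>v\<in>B. inner u v = (if u = v then 1 else 0)) \<and>
         (\<forall>x. (\<forall>u\<in>B. inner x u = 0) \<longleftrightarrow> x = 0))"

lemma onb:
  shows finite_onb: "finite (onb :: 'a::fin_dim_inner set)"
    and inner_onb: "\<And>u v. u \<in> (onb :: 'a set) \<Longrightarrow> v \<in> onb \<Longrightarrow> u \<bullet> v = (if u = v then 1 else 0)"
    and onb_zero: "\<And>x::'a. (\<And>u. u \<in> onb \<Longrightarrow> x \<bullet> u = 0) \<Longrightarrow> x = 0"
  using someI_ex[OF ex_orthonormal_basis[where 'a='a]] unfolding onb_def[symmetric] by blast+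

lemma norm_onb: "u \<in> onb \<Longrightarrow> norm u = 1"
  by (simp add: norm_eq_sqrt_inner inner_onb)

lemma onb_expansion: "(\<Sum>u\<in>onb. (x \<bullet> u) *\<^sub>R u) = (x::'a::fin_dim_inner)"
proof -
  have "x - (\<Sum>u\<in>onb. (x \<bullet> u) *\<^sub>R u) = 0"
  proof (rule onb_zero)
    fix v :: 'a assume v: "v \<in> onb"
    have "(\<Sum>u\<in>onb. (x \<bullet> u) *\<^sub>R u) \<bullet> v = (\<Sum>u\<in>onb. if u = v then x \<bullet> v else 0)"
      unfolding inner_sum_left by (rule sum.cong) (auto simp: inner_onb v)
    then show "(x - (\<Sum>u\<in>onb. (x \<bullet> u) *\<^sub>R u)) \<bullet> v = 0"
      by (simp add: inner_diff_left v finite_onb)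
  qed
  then show ?thesis by simp
qed

lemma linear_onb_expansion:
  "linear f \<Longrightarrow> f x = (\<Sum>u\<in>onb. (x \<bullet> u) *\<^sub>R f (u::'a::fin_dim_inner))"
  by (subst (1) onb_expansion[symmetric]) (simp only: linear_sum linear_cmul)

text \<open>
  Adding one basis vector at a time, the box is the image of an interval times a smaller box under a
  continuous map. It is the source of all compactness in the model spaces.
\<close>

lemma compact_coordinate_box:
  fixes B :: "'a::real_inner set"
  assumes "finite B"
  shows "compact {\<Sum>u\<in>B. c u *\<^sub>R u | c. \<forall>u\<in>B. \<bar>c u\<bar> \<le> (r::real)}"
  using assms
proof induction
  case empty
  have "{\<Sum>u\<in>{}. c u *\<^sub>R u | c. \<forall>u\<in>{}. \<bar>c u\<bar> \<le> r} = {0::'a}" by auto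
  then show ?case by (simp only: compact_sing)
next
  case (insert b B)
  let ?S = "\<lambda>B. {\<Sum>u\<in>B. c u *\<^sub>R u | c. \<forall>u\<in>B. \<bar>c u\<bar> \<le> r} :: 'a set"
  have "compact ((\<lambda>(t, s). t *\<^sub>R b + s) ` ({-r..r} \<times> ?S B))"
    by (intro compact_continuous_image compact_Times insert compact_Icc)
       (auto simp: case_prod_beta intro!: continuous_intros)
  moreover have "(\<lambda>(t, s). t *\<^sub>R b + s) ` ({-r..r} \<times> ?S B) = ?S (insert b B)" (is "?L = ?R")
  proof
    show "?L \<subseteq> ?R"
    proof clarsimp
      fix t c assume *: "- r \<le> t" "t \<le> r" "\<forall>u\<in>B. \<bar>c u\<bar> \<le> r"
      have "t *\<^sub>R b + (\<Sum>u\<in>B. c u *\<^sub>R u) = (\<Sum>u\<in>insert b B. (c(b := t)) u *\<^sub>R u)"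
        using insert by (simp add: sum.insert) (rule sum.cong, auto)
      then show "\<exists>ca. t *\<^sub>R b + (\<Sum>u\<in>B. c u *\<^sub>R u) = (\<Sum>u\<in>insert b B. ca u *\<^sub>R u) \<and>
          \<bar>ca b\<bar> \<le> r \<and> (\<forall>u\<in>B. \<bar>ca u\<bar> \<le> r)"
        using * by (intro exI[of _ "c(b := t)"]) auto
    qed
    show "?R \<subseteq> ?L"
    proof clarify
      fix c assume *: "\<forall>u\<in>insert b B. \<bar>c u\<bar> \<le> r"
      show "(\<Sum>u\<in>insert b B. c u *\<^sub>R u) \<in> ?L"
        using * insert by (intro image_eqI[of _ _ "(c b, \<Sum>u\<in>B. c u *\<^sub>R u)"]) (auto simp: abs_le_iff)
    qed
  qed
  ultimately show ?case by simp
qed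

instance fin_dim_inner < heine_borel
proof
  fix f :: "nat \<Rightarrow> 'a"
  assume "bounded (range f)"
  then obtain r where r: "\<And>n. norm (f n) \<le> r" by (auto simp: bounded_iff)
  let ?S = "{\<Sum>u\<in>onb. c u *\<^sub>R u | c. \<forall>u\<in>onb. \<bar>c u\<bar> \<le> r} :: 'a set"
  have "compact ?S" by (rule compact_coordinate_box[OF finite_onb])
  moreover have "f n \<in> ?S" for n
  proof -
    have "\<bar>f n \<bullet> u\<bar> \<le> r" if "u \<in> onb" for u
      using Cauchy_Schwarz_ineq2[of "f n" u] r[of n] norm_onb[OF that] by simp
    then show ?thesis using onb_expansion[of "f n"]
      by (intro CollectI exI[of _ "\<lambda>u. f n \<bullet> u"]) auto
  qed
  ultimately show "\<exists>l r. strict_mono r \<and> (f \<circ> r) \<longlonglongrightarrow> l"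
    unfolding compact_eq_seq_compact_metric seq_compact_def by blast
qed

instance fin_dim_inner < banach ..

section \<open>Maps of class \<open>C\<close> with a Hoelder continuous last derivative\<close>

text \<open>
  The estimate is required for all pairs of points near \<open>x\<close>, not only for pairs with \<open>x\<close> as one
  member, so that it is a local form of the Hoelder condition on sets. For \<open>a = 0\<close> it says that \<open>f\<close> is
  bounded near \<open>x\<close>, which continuity implies (recall \<open>0 powr 0 = 0\<close>); thus \<open>a = 0\<close> is the case of
  continuous maps, and no case distinction on \<open>a\<close> is needed in what follows.
\<close>

definition hoelder_at :: "real \<Rightarrow> ('a::real_normed_vector \<Rightarrow> 'b::real_normed_vector) \<Rightarrow> 'a \<Rightarrow> bool" where
  "hoelder_at a f x \<longleftrightarrow> isCont f x \<and>
     (\<exists>C\<ge>0. \<forall>\<^sub>F (y, z) in nhds (x, x). norm (f y - f z) \<le> C * dist y z powr a)"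

lemma hoelder_atE:
  assumes "hoelder_at a f x"
  obtains C where "C \<ge> 0" "\<forall>\<^sub>F (y, z) in nhds (x, x). norm (f y - f z) \<le> C * dist y z powr a"
  using assms unfolding hoelder_at_def by blast

lemma hoelder_at_isCont: "hoelder_at a f x \<Longrightarrow> isCont f x"
  by (simp add: hoelder_at_def)

lemma eventually_nhds_pair:
  assumes "eventually P (nhds x)"
  shows "\<forall>\<^sub>F (y, z) in nhds (x, x). P y \<and> P z"
proof -
  have "\<forall>\<^sub>F p in nhds (x, x). P (fst p)"
    by (rule eventually_compose_filterlim[OF assms]) (use tendsto_fst[OF filterlim_ident[of "nhds (x, x)"]] in simp)
  moreover have "\<forall>\<^sub>F p in nhds (x, x). P (snd p)"
    by (rule eventually_compose_filterlim[OF assms]) (use tendsto_snd[OF filterlim_ident[of "nhds (x, x)"]] in simp)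
  ultimately show ?thesis by eventually_elim auto
qed

lemma eventually_nhds_in_ball: "r > 0 \<Longrightarrow> eventually (\<lambda>y. y \<in> ball (x::'a::metric_space) r) (nhds x)"
  by (rule eventually_nhds_in_open) auto

lemma isCont_eventually_norm_le:
  fixes f :: "'a::t2_space \<Rightarrow> 'b::real_normed_vector"
  assumes "isCont f x"
  shows "eventually (\<lambda>y. norm (f y) \<le> norm (f x) + 1) (nhds x)"
proof -
  have "((\<lambda>y. norm (f y)) \<longlongrightarrow> norm (f x)) (nhds x)"
    using assms by (intro tendsto_norm) (simp add: continuous_at tendsto_at_iff_tendsto_nhds)
  then have "eventually (\<lambda>y. norm (f y) < norm (f x) + 1) (nhds x)"
    by (rule order_tendstoD) simp
  then show ?thesis by eventually_elim simp
qed

lemma hoelder_at_const: "hoelder_at a (\<lambda>_. c) x"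
  unfolding hoelder_at_def by (intro conjI exI[of _ 0] always_eventually) auto

lemma hoelder_at_0: "isCont f x \<Longrightarrow> hoelder_at 0 f x"
proof -
  assume c: "isCont f x"
  let ?C = "2 * (norm (f x) + 1)"
  have "\<forall>\<^sub>F (y, z) in nhds (x, x). norm (f y - f z) \<le> ?C * dist y z powr 0"
    using eventually_nhds_pair[OF isCont_eventually_norm_le[OF c]]
  proof eventually_elim
    case (elim p)
    obtain y z where p: "p = (y, z)" by force
    show ?case
    proof (cases "y = z")
      case False
      then show ?thesis using elim norm_triangle_ineq4[of "f y" "f z"] by (simp add: p)
    qed (simp add: p)
  qed
  then show ?thesis using c unfolding hoelder_at_def by (intro conjI exI[of _ ?C]) auto
qed

text \<open>
  Close to \<open>x\<close> all distances are at most \<open>1\<close>, where powers decrease in the exponent.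
\<close>

lemma hoelder_at_mono:
  assumes "hoelder_at a f x" "b \<le> a"
  shows "hoelder_at b f x"
proof -
  obtain C where C: "C \<ge> 0" "\<forall>\<^sub>F (y, z) in nhds (x, x). norm (f y - f z) \<le> C * dist y z powr a"
    using assms(1) by (rule hoelder_atE)
  have half: "\<forall>\<^sub>F (y, z) in nhds (x, x). y \<in> ball x (1/2) \<and> z \<in> ball x (1/2)"
    by (intro eventually_nhds_pair eventually_nhds_in_ball) simp
  have "\<forall>\<^sub>F (y, z) in nhds (x, x). norm (f y - f z) \<le> C * dist y z powr b"
    using C(2) half
  proof eventually_elim
    case (elim p)
    obtain y z where p: "p = (y, z)" by force
    have "dist y z \<le> 1"
      using elim(2) dist_triangle_half_r[of x y 1 z] by (auto simp: p)
    then have "dist y z powr a \<le> dist y z powr b"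
      using assms(2) by (intro powr_mono') auto
    then show ?case using elim(1) C(1) by (auto simp: p intro: order_trans mult_left_mono)
  qed
  then show ?thesis using C(1) assms(1) unfolding hoelder_at_def by blast
qed

lemma hoelder_at_cong:
  assumes "hoelder_at a f x" "eventually (\<lambda>y. f y = g y) (nhds x)"
  shows "hoelder_at a g x"
proof -
  obtain C where C: "C \<ge> 0" "\<forall>\<^sub>F (y, z) in nhds (x, x). norm (f y - f z) \<le> C * dist y z powr a"
    using assms(1) by (rule hoelder_atE)
  have "\<forall>\<^sub>F (y, z) in nhds (x, x). norm (g y - g z) \<le> C * dist y z powr a"
    using C(2) eventually_nhds_pair[OF assms(2)] by eventually_elim auto
  moreover have "isCont g x" using isCont_cong[OF assms(2)] assms(1) by (simp add: hoelder_at_def)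
  ultimately show ?thesis using C(1) unfolding hoelder_at_def by blast
qed

lemma hoelder_at_add:
  assumes "hoelder_at a f x" "hoelder_at a g x"
  shows "hoelder_at a (\<lambda>x. f x + g x) x"
proof -
  obtain C where C: "C \<ge> 0" "\<forall>\<^sub>F (y, z) in nhds (x, x). norm (f y - f z) \<le> C * dist y z powr a"
    using assms(1) by (rule hoelder_atE)
  obtain D where D: "D \<ge> 0" "\<forall>\<^sub>F (y, z) in nhds (x, x). norm (g y - g z) \<le> D * dist y z powr a"
    using assms(2) by (rule hoelder_atE)
  have "\<forall>\<^sub>F (y, z) in nhds (x, x). norm (f y + g y - (f z + g z)) \<le> (C + D) * dist y z powr a"
    using C(2) D(2)
  proof eventually_elim
    case (elim p)
    obtain y z where p: "p = (y, z)" by force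
    have "norm (f y + g y - (f z + g z)) \<le> norm (f y - f z) + norm (g y - g z)"
      by (rule norm_diff_triangle_ineq)
    then show ?case using elim by (simp add: p distrib_right)
  qed
  then show ?thesis using C D assms unfolding hoelder_at_def
    by (intro conjI exI[of _ "C + D"]) auto
qed

lemma hoelder_at_sum:
  assumes "finite I" "\<And>i. i \<in> I \<Longrightarrow> hoelder_at a (f i) x"
  shows "hoelder_at a (\<lambda>x. \<Sum>i\<in>I. f i x) x"
  using assms by induction (auto intro: hoelder_at_const hoelder_at_add)

lemma hoelder_at_scaleR:
  fixes f :: "'a::real_normed_vector \<Rightarrow> real"
  assumes "hoelder_at a f x" "hoelder_at a g x"
  shows "hoelder_at a (\<lambda>x. f x *\<^sub>R g x) x"
proof -
  obtain C where C: "C \<ge> 0" "\<forall>\<^sub>F (y, z) in nhds (x, x). norm (f y - f z) \<le> C * dist y z powr a"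
    using assms(1) by (rule hoelder_atE)
  obtain D where D: "D \<ge> 0" "\<forall>\<^sub>F (y, z) in nhds (x, x). norm (g y - g z) \<le> D * dist y z powr a"
    using assms(2) by (rule hoelder_atE)
  define F where "F = norm (f x) + 1"
  define G where "G = norm (g x) + 1"
  have FG: "F \<ge> 0" "G \<ge> 0" by (auto simp: F_def G_def)
  have "\<forall>\<^sub>F (y, z) in nhds (x, x). norm (f y *\<^sub>R g y - f z *\<^sub>R g z) \<le> (F * D + C * G) * dist y z powr a"
    using C(2) D(2) eventually_nhds_pair[OF isCont_eventually_norm_le[OF hoelder_at_isCont[OF assms(1)]]]
      eventually_nhds_pair[OF isCont_eventually_norm_le[OF hoelder_at_isCont[OF assms(2)]]]
  proof eventually_elim
    case (elim p)
    obtain y z where p: "p = (y, z)" by force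
    have "norm (f y *\<^sub>R (g y - g z) + (f y - f z) *\<^sub>R g z)
        \<le> norm (f y) * norm (g y - g z) + norm (f y - f z) * norm (g z)"
      by (intro norm_triangle_le) (simp add: )
    also have "\<dots> \<le> F * (D * dist y z powr a) + (C * dist y z powr a) * G"
      using elim C(1) D(1) FG unfolding F_def[symmetric] G_def[symmetric] p
      by (intro add_mono mult_mono) auto
    also have "f y *\<^sub>R (g y - g z) + (f y - f z) *\<^sub>R g z = f y *\<^sub>R g y - f z *\<^sub>R g z"
      by (simp add: algebra_simps)
    finally show ?case by (simp add: p algebra_simps)
  qed
  moreover have "F * D + C * G \<ge> 0" using FG C D by simp
  moreover have "isCont (\<lambda>x. f x *\<^sub>R g x) x"
    using assms by (auto intro!: continuous_intros simp: hoelder_at_def)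
  ultimately show ?thesis unfolding hoelder_at_def by blast
qed

lemma hoelder_at_bounded_linear:
  assumes "bounded_linear L" "hoelder_at a f x"
  shows "hoelder_at a (\<lambda>x. L (f x)) x"
proof -
  interpret L: bounded_linear L by fact
  obtain C where C: "C \<ge> 0" "\<forall>\<^sub>F (y, z) in nhds (x, x). norm (f y - f z) \<le> C * dist y z powr a"
    using assms(2) by (rule hoelder_atE)
  obtain K where K: "K \<ge> 0" "\<And>x. norm (L x) \<le> norm x * K" using L.nonneg_bounded by blast
  have "\<forall>\<^sub>F (y, z) in nhds (x, x). norm (L (f y) - L (f z)) \<le> (C * K) * dist y z powr a"
    using C(2)
  proof eventually_elim
    case (elim p)
    obtain y z where p: "p = (y, z)" by force
    have "norm (L (f y) - L (f z)) \<le> norm (f y - f z) * K" using K(2) by (simp flip: L.diff)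
    also have "\<dots> \<le> (C * dist y z powr a) * K" using elim K by (intro mult_right_mono) (auto simp: p)
    finally show ?case by (simp add: p algebra_simps)
  qed
  moreover have "isCont (\<lambda>x. L (f x)) x"
    using assms by (auto intro!: L.isCont simp: hoelder_at_def)
  ultimately show ?thesis using C K unfolding hoelder_at_def by (intro conjI exI[of _ "C * K"]) auto
qed

text \<open>
  Exponents multiply. With one of the two maps Lipschitz, the exponent of the other survives.
\<close>

lemma hoelder_at_compose:
  assumes h: "hoelder_at a h (g x)" and g: "hoelder_at b g x" and a: "a \<ge> 0"
  shows "hoelder_at (a * b) (\<lambda>x. h (g x)) x"
proof -
  obtain C where C: "C \<ge> 0" "\<forall>\<^sub>F (y, z) in nhds (g x, g x). norm (h y - h z) \<le> C * dist y z powr a"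
    using h by (rule hoelder_atE)
  obtain D where D: "D \<ge> 0" "\<forall>\<^sub>F (y, z) in nhds (x, x). norm (g y - g z) \<le> D * dist y z powr b"
    using g by (rule hoelder_atE)
  have gx: "(g \<longlongrightarrow> g x) (nhds x)"
    using g by (simp add: hoelder_at_def continuous_at tendsto_at_iff_tendsto_nhds)
  have "((\<lambda>p. (g (fst p), g (snd p))) \<longlongrightarrow> (g x, g x)) (nhds (x, x))"
    by (intro tendsto_Pair filterlim_compose[OF gx])
       (use tendsto_fst[OF filterlim_ident[of "nhds (x, x)"]] tendsto_snd[OF filterlim_ident[of "nhds (x, x)"]] in simp_all)
  then have "\<forall>\<^sub>F p in nhds (x, x). norm (h (g (fst p)) - h (g (snd p))) \<le> C * dist (g (fst p)) (g (snd p)) powr a"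
    using eventually_compose_filterlim[OF C(2)] by fastforce
  then have "\<forall>\<^sub>F (y, z) in nhds (x, x). norm (h (g y) - h (g z)) \<le> (C * D powr a) * dist y z powr (a * b)"
    using D(2)
  proof eventually_elim
    case (elim p)
    obtain y z where p: "p = (y, z)" by force
    have "norm (h (g y) - h (g z)) \<le> C * dist (g y) (g z) powr a" using elim by (simp add: p)
    also have "\<dots> \<le> C * (D * dist y z powr b) powr a"
      using elim C(1) a by (intro mult_left_mono powr_mono2) (auto simp: p dist_norm)
    also have "\<dots> = (C * D powr a) * dist y z powr (a * b)"
      using D by (simp add: powr_mult powr_powr mult.commute[of a b])
    finally show ?case by (simp add: p)
  qed
  moreover have "isCont (\<lambda>x. h (g x)) x"
    using h g by (auto intro!: isCont_o2[of x g h] simp: hoelder_at_def)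
  ultimately show ?thesis using C unfolding hoelder_at_def by (intro conjI exI[of _ "C * D powr a"]) auto
qed

lemma frechet_derivative_eq: "(f has_derivative f') (at x) \<Longrightarrow> frechet_derivative f (at x) = f'"
  by (simp add: frechet_derivative_at[symmetric])

text \<open>
  The mean value inequality on a small ball: there the partial derivatives along an orthonormal basis,
  hence the operator norms of the derivative, are bounded.
\<close>

lemma hoelder_at_1_if_C1:
  fixes f :: "'a::fin_dim_inner \<Rightarrow> 'b::real_normed_vector"
  assumes S: "open S" "x \<in> S" and df: "\<And>y. y \<in> S \<Longrightarrow> f differentiable (at y)"
    and cont: "\<And>v. isCont (\<lambda>y. frechet_derivative f (at y) v) x"
  shows "hoelder_at 1 f x"
proof -
  define B where "B = (\<Sum>e\<in>(onb::'a set). norm (frechet_derivative f (at x) e) + 1)"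
  have "\<forall>\<^sub>F y in nhds x. y \<in> S \<and> (\<forall>e\<in>onb. norm (frechet_derivative f (at y) e) \<le> norm (frechet_derivative f (at x) e) + 1)"
    by (intro eventually_conj eventually_ball_finite finite_onb ballI isCont_eventually_norm_le cont
        eventually_nhds_in_open S)
  then obtain r where r: "r > 0" and rS: "\<And>y. dist y x < r \<Longrightarrow> y \<in> S"
    and rB: "\<And>y e. dist y x < r \<Longrightarrow> e\<in>onb \<Longrightarrow> norm (frechet_derivative f (at y) e) \<le> norm (frechet_derivative f (at x) e) + 1"
    unfolding eventually_nhds_metric by blast
  have B0: "B \<ge> 0" unfolding B_def by (intro sum_nonneg) auto
  have B: "onorm (frechet_derivative f (at y)) \<le> B" if y: "dist y x < r" for y
  proof (rule onorm_bound[OF B0])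
    fix v
    have "norm (frechet_derivative f (at y) v) = norm (\<Sum>e\<in>onb. (v \<bullet> e) *\<^sub>R frechet_derivative f (at y) e)"
      by (subst linear_onb_expansion[OF linear_frechet_derivative[OF df[OF rS[OF y]]]]) simp
    also have "\<dots> \<le> (\<Sum>e\<in>onb. norm v * (norm (frechet_derivative f (at x) e) + 1))"
    proof (intro sum_norm_le)
      fix e :: 'a assume e: "e \<in> onb"
      show "norm ((v \<bullet> e) *\<^sub>R frechet_derivative f (at y) e) \<le> norm v * (norm (frechet_derivative f (at x) e) + 1)"
        using rB[OF y e] Cauchy_Schwarz_ineq2[of v e] norm_onb[OF e] by (auto intro!: mult_mono)
    qed
    also have "\<dots> = B * norm v" by (simp add: B_def sum_distrib_left[symmetric] mult.commute)
    finally show "norm (frechet_derivative f (at y) v) \<le> B * norm v" .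
  qed
  have "norm (f y - f z) \<le> B * norm (y - z)" if "y \<in> ball x r" "z \<in> ball x r" for y z
  proof (rule differentiable_bound[OF convex_ball[of x r]])
    fix w assume w: "w \<in> ball x r"
    then have "(f has_derivative frechet_derivative f (at w)) (at w)"
      using df[OF rS] frechet_derivative_works[of f "at w"] by (simp add: dist_commute)
    then show "(f has_derivative frechet_derivative f (at w)) (at w within ball x r)"
      by (rule has_derivative_at_withinI)
  qed (use that B in \<open>auto simp: dist_commute\<close>)
  then have "\<forall>\<^sub>F (y, z) in nhds (x, x). norm (f y - f z) \<le> B * dist y z powr 1"
    using eventually_nhds_pair[OF eventually_nhds_in_ball[OF r, of x]]
    by (auto elim!: eventually_mono simp: dist_norm)
  moreover note B0
  moreover have "isCont f x"
    using df[OF S(2)] by (rule differentiable_imp_continuous_within)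
  ultimately show ?thesis unfolding hoelder_at_def by blast
qed

text \<open>
  \<open>Ckh_on a n S f\<close> is the class \<open>C\<^sup>n\<^sup>+\<^sup>a\<close> on the open set \<open>S\<close>, with the recursion of \<^const>\<open>Ck_on\<close>:
  only the condition reached after \<open>n\<close> differentiations changes. The recursion over directions allows
  proofs by induction on \<open>n\<close> in which the codomain stays fixed.
\<close>

primrec Ckh_on :: "real \<Rightarrow> nat \<Rightarrow> 'a::real_normed_vector set \<Rightarrow> ('a \<Rightarrow> 'b::real_normed_vector) \<Rightarrow> bool" where
  "Ckh_on a 0 S f \<longleftrightarrow> (\<forall>x\<in>S. hoelder_at a f x)"
| "Ckh_on a (Suc n) S f \<longleftrightarrow>
     (\<forall>x\<in>S. f differentiable (at x)) \<and> (\<forall>v. Ckh_on a n S (\<lambda>x. frechet_derivative f (at x) v))"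

lemma Ckh_on_subset: "Ckh_on a n S f \<Longrightarrow> T \<subseteq> S \<Longrightarrow> Ckh_on a n T f"
  by (induction n arbitrary: f) auto

lemma Ckh_on_local:
  "(\<And>x. x \<in> S \<Longrightarrow> \<exists>T. x \<in> T \<and> Ckh_on a n T f) \<Longrightarrow> Ckh_on a n S f"
proof (induction n arbitrary: f)
  case 0
  then show ?case by auto
next
  case (Suc n)
  show ?case unfolding Ckh_on.simps
  proof (intro conjI allI ballI)
    fix x assume "x \<in> S" then show "f differentiable at x" using Suc.prems by force
  next
    fix v show "Ckh_on a n S (\<lambda>x. frechet_derivative f (at x) v)"
      using Suc.prems by (intro Suc.IH) force
  qed
qed

lemma Ckh_on_mono: "Ckh_on a n S f \<Longrightarrow> b \<le> a \<Longrightarrow> Ckh_on b n S f"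
  by (induction n arbitrary: f) (auto intro: hoelder_at_mono)

lemma Ckh_on_isCont: "Ckh_on a n S f \<Longrightarrow> x \<in> S \<Longrightarrow> isCont f x"
  by (cases n) (auto intro: hoelder_at_isCont differentiable_imp_continuous_within)

lemma Ckh_on_cong:
  "open S \<Longrightarrow> Ckh_on a n S f \<Longrightarrow> (\<And>x. x \<in> S \<Longrightarrow> f x = g x) \<Longrightarrow> Ckh_on a n S g"
proof (induction n arbitrary: f g)
  case 0
  have "eventually (\<lambda>y. f y = g y) (nhds x)" if "x \<in> S" for x
    using eventually_nhds_in_open[OF 0(1) that] by eventually_elim (rule 0)
  then show ?case using 0 by (auto intro: hoelder_at_cong)
next
  case (Suc n)
  have *: "(g has_derivative frechet_derivative f (at x)) (at x)" if "x \<in> S" for x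
    using Suc.prems that frechet_derivative_works[of f "at x"]
    by (auto intro: has_derivative_transform_within_open)
  have "Ckh_on a n S (\<lambda>x. frechet_derivative g (at x) v)" for v
    by (rule Suc.IH[OF Suc.prems(1), of "\<lambda>x. frechet_derivative f (at x) v"])
       (use Suc.prems in \<open>auto simp: frechet_derivative_eq[OF *]\<close>)
  then show ?case using * by (auto simp: differentiable_def)
qed

lemma Ckh_on_SucI:
  assumes "open S" "\<And>x. x \<in> S \<Longrightarrow> (f has_derivative f' x) (at x)" "\<And>v. Ckh_on a n S (\<lambda>x. f' x v)"
  shows "Ckh_on a (Suc n) S f"
proof -
  have "Ckh_on a n S (\<lambda>x. frechet_derivative f (at x) v)" for v
    by (rule Ckh_on_cong[OF assms(1) assms(3)[of v]]) (simp add: frechet_derivative_eq[OF assms(2)])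
  then show ?thesis using assms(2) by (auto simp: differentiable_def)
qed

lemma Ckh_on_SucD:
  assumes "Ckh_on a (Suc n) S f"
  shows "\<And>x. x \<in> S \<Longrightarrow> (f has_derivative frechet_derivative f (at x)) (at x)"
    and "\<And>v. Ckh_on a n S (\<lambda>x. frechet_derivative f (at x) v)"
  using assms by (auto simp: frechet_derivative_works[symmetric])

lemma Ckh_on_const: "Ckh_on a n S (\<lambda>_. c)"
  by (induction n arbitrary: c) (auto simp: hoelder_at_const)

lemma Ckh_on_bounded_linear:
  assumes "bounded_linear L"
  shows "open S \<Longrightarrow> Ckh_on a n S f \<Longrightarrow> Ckh_on a n S (\<lambda>x. L (f x))"
proof (induction n arbitrary: f)
  case 0
  then show ?case by (auto intro: hoelder_at_bounded_linear[OF assms])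
next
  case (Suc n)
  show ?case
    by (rule Ckh_on_SucI[OF Suc.prems(1) bounded_linear.has_derivative[OF assms Ckh_on_SucD(1)[OF Suc.prems(2)]]])
       (auto intro: Suc.IH Suc.prems(1) Ckh_on_SucD(2)[OF Suc.prems(2)])
qed

lemma Ckh_on_add:
  "open S \<Longrightarrow> Ckh_on a n S f \<Longrightarrow> Ckh_on a n S g \<Longrightarrow> Ckh_on a n S (\<lambda>x. f x + g x)"
proof (induction n arbitrary: f g)
  case 0
  then show ?case by (auto intro: hoelder_at_add)
next
  case (Suc n)
  show ?case
    by (rule Ckh_on_SucI[OF Suc.prems(1) has_derivative_add[OF Ckh_on_SucD(1)[OF Suc.prems(2)] Ckh_on_SucD(1)[OF Suc.prems(3)]]])
       (auto intro: Suc.IH Suc.prems(1) Ckh_on_SucD(2)[OF Suc.prems(2)] Ckh_on_SucD(2)[OF Suc.prems(3)])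
qed

lemma Ckh_on_sum:
  assumes "finite I" "open S" "\<And>i. i \<in> I \<Longrightarrow> Ckh_on a n S (f i)"
  shows "Ckh_on a n S (\<lambda>x. \<Sum>i\<in>I. f i x)"
  using assms(1,3) by induction (auto intro: Ckh_on_const Ckh_on_add[OF assms(2)])

text \<open>
  A derivative more is worth more than any exponent up to \<open>1\<close>, by the mean value inequality.
\<close>

lemma Ckh_on_lower:
  fixes f :: "'a::fin_dim_inner \<Rightarrow> 'b::real_normed_vector"
  assumes S: "open S" and b: "b \<le> 1"
  shows "Ckh_on a (Suc n) S f \<Longrightarrow> Ckh_on b n S f"
proof (induction n arbitrary: f)
  case 0
  show ?case unfolding Ckh_on.simps
  proof
    fix x assume x: "x \<in> S"
    have "hoelder_at 1 f x"
      using 0 x by (intro hoelder_at_1_if_C1[OF S]) (auto intro: hoelder_at_isCont)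
    then show "hoelder_at b f x" using b by (rule hoelder_at_mono)
  qed
next
  case (Suc n)
  then show ?case using Suc.IH[OF Ckh_on_SucD(2)[OF Suc.prems]] by simp
qed

lemma Ckh_on_scaleR:
  fixes g :: "'a::fin_dim_inner \<Rightarrow> 'b::real_normed_vector"
  assumes S: "open S" and a: "a \<le> 1"
  shows "Ckh_on a n S f \<Longrightarrow> Ckh_on a n S g \<Longrightarrow> Ckh_on a n S (\<lambda>x. f x *\<^sub>R g x)"
proof (induction n arbitrary: f g)
  case 0
  then show ?case by (auto intro: hoelder_at_scaleR)
next
  case (Suc n)
  show ?case
    by (rule Ckh_on_SucI[OF S has_derivative_scaleR[OF Ckh_on_SucD(1)[OF Suc.prems(1)] Ckh_on_SucD(1)[OF Suc.prems(2)]]])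
       (assumption | intro Ckh_on_add[OF S] Suc.IH Ckh_on_SucD(2)[OF Suc.prems(1)] Ckh_on_SucD(2)[OF Suc.prems(2)]
          Ckh_on_lower[OF S a Suc.prems(1)] Ckh_on_lower[OF S a Suc.prems(2)])+
qed

text \<open>
  By the chain rule, expanded over an orthonormal basis of the middle space,
  \<open>D(h \<circ> g)(x) v = \<Sum>\<^sub>e \<langle>Dg(x) v, e\<rangle> \<sqdot> Dh(g x) e\<close>. The factors are of the same kind with one derivative less, so
  induction and the product rule suffice, without higher-order chain rules.
\<close>

lemma Ckh_on_compose:
  fixes h :: "'b::fin_dim_inner \<Rightarrow> 'c::real_normed_vector" and g :: "'a::fin_dim_inner \<Rightarrow> 'b"
  assumes S: "open S" and T: "open T" and gS: "g ` S \<subseteq> T"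
    and a: "0 \<le> a" "a \<le> 1" and b: "0 \<le> b" "b \<le> 1"
  shows "Ckh_on a n T h \<Longrightarrow> Ckh_on b n S g \<Longrightarrow> Ckh_on (a * b) n S (\<lambda>x. h (g x))"
proof (induction n arbitrary: h)
  case 0
  have "hoelder_at (a * b) (\<lambda>x. h (g x)) x" if "x \<in> S" for x
    using 0 gS a that by (intro hoelder_at_compose) auto
  then show ?case by simp
next
  case (Suc n)
  have ab: "a * b \<le> b" "a * b \<le> 1" using a b by (auto intro: mult_left_le_one_le mult_le_one)
  note Dg = Ckh_on_SucD[OF Suc.prems(2)]
  note Dh = Ckh_on_SucD[OF Suc.prems(1)]
  show ?case
  proof (rule Ckh_on_SucI[OF S])
    fix x assume x: "x \<in> S"
    have hd: "(h has_derivative frechet_derivative h (at (g x))) (at (g x))"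
      using x gS by (intro Dh) auto
    have "((\<lambda>x. h (g x)) has_derivative (\<lambda>v. frechet_derivative h (at (g x)) (frechet_derivative g (at x) v))) (at x)"
      using diff_chain_at[OF Dg(1)[OF x] hd] by (simp add: o_def)
    moreover have "frechet_derivative h (at (g x)) w = (\<Sum>e\<in>onb. (w \<bullet> e) *\<^sub>R frechet_derivative h (at (g x)) e)" for w
      using hd by (intro linear_onb_expansion) (auto intro: has_derivative_linear)
    ultimately show "((\<lambda>x. h (g x)) has_derivative (\<lambda>v. \<Sum>e\<in>onb. (frechet_derivative g (at x) v \<bullet> e) *\<^sub>R
        frechet_derivative h (at (g x)) e)) (at x)"
      by (metis (no_types, lifting) ext)
  next
    fix v
    show "Ckh_on (a * b) n S (\<lambda>x. \<Sum>e\<in>onb. (frechet_derivative g (at x) v \<bullet> e) *\<^sub>R frechet_derivative h (at (g x)) e)"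
    proof (intro Ckh_on_sum finite_onb S Ckh_on_scaleR ab)
      fix e :: 'b
      show "Ckh_on (a * b) n S (\<lambda>x. frechet_derivative g (at x) v \<bullet> e)"
        by (intro Ckh_on_bounded_linear[OF bounded_linear_inner_left S] Ckh_on_mono[OF Dg(2)] ab)
      show "Ckh_on (a * b) n S (\<lambda>x. frechet_derivative h (at (g x)) e)"
        by (intro Suc.IH Dh Ckh_on_lower[OF S b(2) Suc.prems(2)])
    qed
  qed
qed

lemma Ck_on_eq_Ckh_on: "open S \<Longrightarrow> Ck_on n S f \<longleftrightarrow> Ckh_on 0 n S f"
  by (induction n arbitrary: f)
     (auto simp: continuous_on_eq_continuous_at intro: hoelder_at_0 hoelder_at_isCont)

lemma Ckh_on_imp_Ck_on: "open S \<Longrightarrow> Ckh_on a n S f \<Longrightarrow> 0 \<le> a \<Longrightarrow> Ck_on n S f"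
  by (auto simp: Ck_on_eq_Ckh_on intro: Ckh_on_mono)

lemma Ckh_on_imp_Ck_near: "open S \<Longrightarrow> K \<subseteq> S \<Longrightarrow> Ckh_on a k S f \<Longrightarrow> 0 \<le> a \<Longrightarrow> Ck_near k f K"
  unfolding Ck_near_def by (blast intro: Ckh_on_imp_Ck_on)

lemma Ck_near_Ckh_on:
  assumes "Ck_near k f K"
  obtains W where "open W" "K \<subseteq> W" "Ckh_on 0 k W f"
  using assms Ck_on_eq_Ckh_on unfolding Ck_near_def by blast

lemma smooth_on_imp_Ckh_on:
  fixes f :: "'a::fin_dim_inner \<Rightarrow> 'b::real_normed_vector"
  assumes "open S" "smooth_on S f" "a \<le> 1"
  shows "Ckh_on a n S f"
  using assms Ck_on_eq_Ckh_on[OF assms(1), of "Suc n" f] unfolding smooth_on_def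
  by (blast intro: Ckh_on_lower)

section \<open>Iterated directional derivatives\<close>

lemma Ckh_on_directional_deriv:
  "Ckh_on a (length vs + n) S f \<Longrightarrow> Ckh_on a n S (directional_deriv f vs)"
  by (induction vs arbitrary: f) auto

lemma Ckh_on_lower_le:
  fixes f :: "'a::fin_dim_inner \<Rightarrow> 'b::real_normed_vector"
  assumes "open S" "Ckh_on a n S f" "m \<le> n" "0 \<le> a"  "a \<le> 1"
  shows "Ckh_on a m S f"
  using assms(3,2) by (induction rule: inc_induct) (auto intro: Ckh_on_lower[OF assms(1,5)] simp del: Ckh_on.simps)

lemma directional_deriv_cong:
  "open S \<Longrightarrow> Ckh_on a (length vs) S f \<Longrightarrow> (\<And>y. y \<in> S \<Longrightarrow> f y = g y) \<Longrightarrow> x \<in> S \<Longrightarrow>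
    directional_deriv f vs x = directional_deriv g vs x"
proof (induction vs arbitrary: f g)
  case (Cons v vs)
  show ?case unfolding directional_deriv.simps
    by (rule Cons.IH[OF Cons.prems(1)])
       (use Cons.prems frechet_derivative_transform_within_open[of f _ S g] in auto)
qed simp

text \<open>
  Linearity of iterated derivatives in the map. It has to be proved for maps of class \<open>C\<^sup>n\<close> only, since
  the derivative of a map that is not differentiable is an arbitrary value.
\<close>

lemma directional_deriv_lincomb:
  assumes I: "finite I" and S: "open S" and x: "x \<in> S"
  shows "(\<And>i. i \<in> I \<Longrightarrow> Ckh_on a (length vs) S (f i)) \<Longrightarrow>
    directional_deriv (\<lambda>x. \<Sum>i\<in>I. c i *\<^sub>R f i x) vs x = (\<Sum>i\<in>I. c i *\<^sub>R directional_deriv (f i) vs x)"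
proof (induction vs arbitrary: f)
  case (Cons v vs)
  have Df: "\<And>i y. i \<in> I \<Longrightarrow> y \<in> S \<Longrightarrow> (f i has_derivative frechet_derivative (f i) (at y)) (at y)"
    "\<And>i v. i \<in> I \<Longrightarrow> Ckh_on a (length vs) S (\<lambda>x. frechet_derivative (f i) (at x) v)"
    using Cons.prems Ckh_on_SucD[of a "length vs" S] by (auto simp: frechet_derivative_works[symmetric])
  have "frechet_derivative (\<lambda>x. \<Sum>i\<in>I. c i *\<^sub>R f i x) (at y) =
    (\<lambda>v. \<Sum>i\<in>I. c i *\<^sub>R frechet_derivative (f i) (at y) v)" if "y \<in> S" for y
    using Df(1) that by (intro frechet_derivative_eq has_derivative_sum has_derivative_scaleR_right) auto
  then have "directional_deriv (\<lambda>x. \<Sum>i\<in>I. c i *\<^sub>R f i x) (v # vs) x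
    = directional_deriv (\<lambda>y. \<Sum>i\<in>I. c i *\<^sub>R frechet_derivative (f i) (at y) v) vs x"
    unfolding directional_deriv.simps
    by (intro directional_deriv_cong[OF S, symmetric, of a])
       (auto intro!: Ckh_on_sum I S Ckh_on_bounded_linear[OF bounded_linear_scaleR_right] Df(2) x)
  also have "\<dots> = (\<Sum>i\<in>I. c i *\<^sub>R directional_deriv (f i) (v # vs) x)"
    by (simp add: Cons.IH[OF Df(2)])
  finally show ?case .
qed simp

lemma directional_deriv_add:
  assumes "open S" "x \<in> S" "Ckh_on a (length vs) S f" "Ckh_on a (length vs) S g"
  shows "directional_deriv (\<lambda>x. f x + g x) vs x = directional_deriv f vs x + directional_deriv g vs x"
  using directional_deriv_lincomb[of "UNIV::bool set" S x a vs "\<lambda>i. if i then f else g" "\<lambda>_. 1"] assms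
  by (simp add: UNIV_bool add.commute)

lemma directional_deriv_diff:
  assumes "open S" "x \<in> S" "Ckh_on a (length vs) S f" "Ckh_on a (length vs) S g"
  shows "directional_deriv (\<lambda>x. f x - g x) vs x = directional_deriv f vs x - directional_deriv g vs x"
  using directional_deriv_lincomb[of "UNIV::bool set" S x a vs "\<lambda>i. if i then f else g" "\<lambda>i. if i then 1 else - 1"] assms
  by (simp add: UNIV_bool add.commute)

text \<open>
  The multi-indices of order \<open>n\<close>.
\<close>

definition onb_lists :: "nat \<Rightarrow> 'a::fin_dim_inner list set" where
  "onb_lists n = {es. set es \<subseteq> onb \<and> length es = n}"

lemma finite_onb_lists: "finite (onb_lists n)"
  unfolding onb_lists_def by (rule finite_lists_length_eq[OF finite_onb])

lemma onb_lists_Suc: "onb_lists (Suc n) = (\<lambda>(e, es). e # es) ` (onb \<times> onb_lists n)"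
  by (auto simp: onb_lists_def length_Suc_conv image_iff)

definition onb_coeff :: "'a::fin_dim_inner list \<Rightarrow> 'a list \<Rightarrow> real" where
  "onb_coeff vs es = prod_list (map2 (\<bullet>) vs es)"

text \<open>
  The \<open>n\<close>-linear form \<open>D\<^sup>nf(x)\<close> is determined by its values on basis vectors, with coefficients that do
  not depend on \<open>f\<close> and \<open>x\<close>. This reduces every estimate for all lists of unit vectors to finitely many
  functions of \<open>x\<close>.
\<close>

lemma directional_deriv_expansion:
  fixes f :: "'a::fin_dim_inner \<Rightarrow> 'b::real_normed_vector"
  assumes S: "open S" and x: "x \<in> S"
  shows "Ckh_on a (length vs) S f \<Longrightarrow>
    directional_deriv f vs x = (\<Sum>es\<in>onb_lists (length vs). onb_coeff vs es *\<^sub>R directional_deriv f es x)"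
proof (induction vs arbitrary: f)
  case Nil
  have "onb_lists 0 = {[] :: 'a list}" by (auto simp: onb_lists_def)
  then show ?case by (simp add: onb_coeff_def)
next
  case (Cons v vs)
  have Df: "\<And>y. y \<in> S \<Longrightarrow> (f has_derivative frechet_derivative f (at y)) (at y)"
    "\<And>v. Ckh_on a (length vs) S (\<lambda>x. frechet_derivative f (at x) v)"
    using Cons.prems by (auto simp: frechet_derivative_works[symmetric])
  have "directional_deriv f (v # vs) x = directional_deriv (\<lambda>y. \<Sum>e\<in>onb. (v \<bullet> e) *\<^sub>R frechet_derivative f (at y) e) vs x"
    unfolding directional_deriv.simps
    by (rule directional_deriv_cong[OF S Df(2)])
       (auto intro!: x linear_onb_expansion has_derivative_linear[OF Df(1)])
  also have "\<dots> = (\<Sum>e\<in>onb. (v \<bullet> e) *\<^sub>R directional_deriv (\<lambda>y. frechet_derivative f (at y) e) vs x)"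
    by (rule directional_deriv_lincomb[OF finite_onb S x Df(2)])
  also have "\<dots> = (\<Sum>e\<in>onb. \<Sum>es\<in>onb_lists (length vs). onb_coeff (v # vs) (e # es) *\<^sub>R directional_deriv f (e # es) x)"
    by (simp add: Cons.IH[OF Df(2)] scaleR_sum_right onb_coeff_def)
  also have "\<dots> = (\<Sum>(e, es)\<in>onb \<times> onb_lists (length vs). onb_coeff (v # vs) (e # es) *\<^sub>R directional_deriv f (e # es) x)"
    by (rule sum.cartesian_product)
  also have "\<dots> = (\<Sum>es\<in>onb_lists (length (v # vs)). onb_coeff (v # vs) es *\<^sub>R directional_deriv f es x)"
    by (simp add: onb_lists_Suc, subst sum.reindex) (auto simp: inj_on_def case_prod_beta)
  finally show ?case .
qed

lemma abs_onb_coeff_le_1: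
  assumes "es \<in> onb_lists (length vs)" "\<forall>v\<in>set vs. norm v \<le> 1"
  shows "\<bar>onb_coeff vs es\<bar> \<le> 1"
  using assms
proof (induction vs arbitrary: es)
  case (Cons v vs)
  then obtain e es' where es: "es = e # es'" "e \<in> onb" "es' \<in> onb_lists (length vs)"
    by (auto simp: onb_lists_Suc)
  have "\<bar>v \<bullet> e\<bar> \<le> 1" using Cauchy_Schwarz_ineq2[of v e] Cons.prems norm_onb[OF es(2)] by simp
  moreover have "\<bar>onb_coeff vs es'\<bar> \<le> 1" using Cons es by auto
  ultimately show ?case by (simp add: es onb_coeff_def abs_mult mult_le_one)
qed (simp add: onb_coeff_def)

lemma Ckh_onI_directional:
  "Ck_on n S f \<Longrightarrow> (\<And>vs x. length vs = n \<Longrightarrow> x \<in> S \<Longrightarrow> hoelder_at a (directional_deriv f vs) x) \<Longrightarrow>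
    Ckh_on a n S f"
proof (induction n arbitrary: f)
  case (Suc n)
  have "hoelder_at a (directional_deriv (\<lambda>x. frechet_derivative f (at x) v) vs) x"
    if "length vs = n" "x \<in> S" for v vs x
    using Suc.prems(2)[of "v # vs" x] that by simp
  then show ?case using Suc by auto
qed auto

section \<open>The norms\<close>

abbreviation unit_list :: "'a::real_normed_vector list \<Rightarrow> bool" where
  "unit_list vs \<equiv> \<forall>v\<in>set vs. norm v \<le> 1"

text \<open>
  A real-valued stand-in for \<open>fam_norm \<le> e\<close>, equivalent to it up to the factor \<open>4\<close> (one \<open>e\<close> for the
  supremum norm, one for the derivatives and two for the Hoelder quotients). The empty list accounts for
  \<open>f\<close> itself. The factor \<open>2\<close> makes the second condition a consequence of the first when \<open>a = 0\<close>, as the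
  norm has no Hoelder part in that case. Being a conjunction of pointwise inequalities between
  derivatives, it passes to limits.
\<close>

definition Ckh_bound ::
  "nat \<Rightarrow> real \<Rightarrow> real \<Rightarrow> ('a::real_normed_vector \<Rightarrow> 'b::real_normed_vector) \<Rightarrow> 'a set \<Rightarrow> bool" where
  "Ckh_bound k a e f K \<longleftrightarrow>
     (\<forall>x\<in>K. \<forall>vs. length vs \<le> k \<and> unit_list vs \<longrightarrow> norm (directional_deriv f vs x) \<le> e) \<and>
     (\<forall>x\<in>K. \<forall>y\<in>K. \<forall>vs. length vs = k \<and> unit_list vs \<longrightarrow>
        norm (directional_deriv f vs x - directional_deriv f vs y) \<le> 2 * e * dist x y powr a)"

lemma fam_norm_Ck_alpha:
  "fam_norm (Ck_alpha_family k a) f K = (SUP x\<in>K. ennreal (norm (f x))) +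
     (if a = 0 then Ck_seminorm k f K else Ck_seminorm k f K + deriv_hoelder_seminorm k a f K)"
  by (simp add: fam_norm_def Ck_alpha_family_def Ck_alpha_seminorm_def)

lemma norm_le_op_norm:
  "length vs = j \<Longrightarrow> unit_list vs \<Longrightarrow> ennreal (norm (A vs)) \<le> op_norm j A"
  unfolding op_norm_def by (rule SUP_upper) simp

lemma op_norm_leI:
  "(\<And>vs. length vs = j \<Longrightarrow> unit_list vs \<Longrightarrow> norm (A vs) \<le> e) \<Longrightarrow> op_norm j A \<le> ennreal e"
  unfolding op_norm_def by (rule SUP_least) (auto intro: ennreal_leI)

lemma Ckh_bound_if_fam_norm_le:
  assumes le: "fam_norm (Ck_alpha_family k a) f K \<le> ennreal e" and e: "0 \<le> e"
  shows "Ckh_bound k a e f K"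
proof -
  have 0: "(SUP x\<in>K. ennreal (norm (f x))) \<le> ennreal e"
    using le unfolding fam_norm_Ck_alpha by (rule order_trans[rotated]) simp
  have 1: "Ck_seminorm k f K \<le> ennreal e"
    using le unfolding fam_norm_Ck_alpha by (rule order_trans[rotated]) (auto intro: add_increasing add_increasing2)
  have 2: "deriv_hoelder_seminorm k a f K \<le> ennreal e" if "a \<noteq> 0"
    using le that unfolding fam_norm_Ck_alpha by (elim order_trans[rotated]) (auto intro: add_increasing add_increasing2)
  have bound: "norm (directional_deriv f vs x) \<le> e" if x: "x \<in> K" and vs: "length vs \<le> k" "unit_list vs" for x vs
  proof (cases "vs = []")
    case True
    have "ennreal (norm (f x)) \<le> ennreal e" using 0 x by (auto simp: SUP_le_iff)
    then show ?thesis using e True by simp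
  next
    case False
    have "ennreal (norm (nth_deriv f x vs)) \<le> op_norm (length vs) (nth_deriv f x)"
      by (rule norm_le_op_norm) (use vs in auto)
    also have "\<dots> \<le> ennreal e"
      using 1 x vs False unfolding Ck_seminorm_def SUP_le_iff by (cases vs) auto
    finally show ?thesis using e by (simp add: nth_deriv_def)
  qed
  moreover have "norm (directional_deriv f vs x - directional_deriv f vs y) \<le> 2 * e * dist x y powr a"
    if x: "x \<in> K" and y: "y \<in> K" and vs: "length vs = k" "unit_list vs" for x y vs
  proof (cases "x = y")
    case neq: False
    show ?thesis
    proof (cases "a = 0")
      case True
      have "norm (directional_deriv f vs x - directional_deriv f vs y) \<le> e + e"
        using bound[OF x] bound[OF y] vs by (intro order_trans[OF norm_triangle_ineq4] add_mono) auto
      then show ?thesis using neq True by simp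
    next
      case False
      have d: "dist x y powr a > 0" using neq by simp
      let ?n = "norm (directional_deriv f vs x - directional_deriv f vs y)"
      have "ennreal (?n / dist x y powr a) = ennreal ?n / ennreal (dist x y powr a)"
        using d by (simp add: divide_ennreal)
      also have "\<dots> \<le> op_norm k (\<lambda>vs. nth_deriv f x vs - nth_deriv f y vs) / ennreal (dist x y powr a)"
        using norm_le_op_norm[OF vs, of "\<lambda>vs. nth_deriv f x vs - nth_deriv f y vs"]
        by (intro divide_right_mono_ennreal) (simp add: nth_deriv_def)
      also have "\<dots> \<le> ennreal e"
        using 2[OF False] x y neq unfolding deriv_hoelder_seminorm_def SUP_le_iff by blast
      finally have "?n / dist x y powr a \<le> e" using e by simp
      then have "?n \<le> e * dist x y powr a" using d by (simp add: field_simps)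
      also have "\<dots> \<le> 2 * e * dist x y powr a" using e by (intro mult_right_mono) auto
      finally show ?thesis .
    qed
  qed simp
  ultimately show ?thesis unfolding Ckh_bound_def by blast
qed

lemma fam_norm_le_if_Ckh_bound:
  assumes b: "Ckh_bound k a e f K" and e: "0 \<le> e"
  shows "fam_norm (Ck_alpha_family k a) f K \<le> ennreal (4 * e)"
proof -
  have 0: "(SUP x\<in>K. ennreal (norm (f x))) \<le> ennreal e"
  proof (rule SUP_least)
    fix x assume "x \<in> K"
    then have "norm (directional_deriv f [] x) \<le> e"
      using b unfolding Ckh_bound_def by (metis le0 list.size(3) empty_iff list.set(1))
    then show "ennreal (norm (f x)) \<le> ennreal e" by (simp add: ennreal_leI)
  qed
  have 1: "Ck_seminorm k f K \<le> ennreal e"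
    using b unfolding Ck_seminorm_def Ckh_bound_def
    by (intro SUP_least op_norm_leI) (auto simp: nth_deriv_def)
  have 2: "deriv_hoelder_seminorm k a f K \<le> ennreal (2 * e)"
    unfolding deriv_hoelder_seminorm_def
  proof (intro SUP_least)
    fix x y assume xy: "x \<in> K" "y \<in> K - {x}"
    then have d: "dist x y powr a > 0" by auto
    have "op_norm k (\<lambda>vs. nth_deriv f x vs - nth_deriv f y vs) \<le> ennreal (2 * e * dist x y powr a)"
      by (rule op_norm_leI) (use b xy in \<open>auto simp: nth_deriv_def Ckh_bound_def\<close>)
    then have "op_norm k (\<lambda>vs. nth_deriv f x vs - nth_deriv f y vs) / ennreal (dist x y powr a)
        \<le> ennreal (2 * e * dist x y powr a) / ennreal (dist x y powr a)"
      by (rule divide_right_mono_ennreal)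
    also have "\<dots> = ennreal (2 * e)" using d e by (subst divide_ennreal) auto
    finally show "op_norm k (\<lambda>vs. nth_deriv f x vs - nth_deriv f y vs) / ennreal (dist x y powr a) \<le> ennreal (2 * e)" .
  qed
  have "fam_norm (Ck_alpha_family k a) f K \<le> ennreal e + (ennreal e + ennreal (2 * e))"
    unfolding fam_norm_Ck_alpha using 0 1 2
    by (cases "a = 0") (auto intro!: add_mono intro: add_increasing2)
  also have "\<dots> = ennreal (4 * e)" using e by (simp flip: ennreal_plus)
  finally show ?thesis .
qed

lemma fam_norm_mono:
  assumes "K \<subseteq> K'"
  shows "fam_norm (Ck_alpha_family k a) f K \<le> fam_norm (Ck_alpha_family k a) f K'"
proof -
  have "(SUP x\<in>K. ennreal (norm (f x))) \<le> (SUP x\<in>K'. ennreal (norm (f x)))"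
    by (rule SUP_subset_mono[OF assms order_refl])
  moreover have "Ck_seminorm k f K \<le> Ck_seminorm k f K'"
    unfolding Ck_seminorm_def by (intro SUP_mono' SUP_subset_mono[OF assms order_refl])
  moreover have "deriv_hoelder_seminorm k a f K \<le> deriv_hoelder_seminorm k a f K'"
    unfolding deriv_hoelder_seminorm_def using assms by (intro SUP_subset_mono) auto
  ultimately show ?thesis unfolding fam_norm_Ck_alpha by (auto intro!: add_mono)
qed

lemma directional_deriv_0: "directional_deriv (\<lambda>_. 0) vs x = 0"
  by (induction vs) auto

lemma fam_norm_0: "fam_norm (Ck_alpha_family k a) (\<lambda>_. 0) K = 0"
  using fam_norm_le_if_Ckh_bound[of k a 0 "\<lambda>_. 0" K] by (simp add: Ckh_bound_def directional_deriv_0)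

lemma op_norm_add: "op_norm j (\<lambda>vs. A vs + B vs) \<le> op_norm j A + op_norm j B"
  unfolding op_norm_def[of j "\<lambda>vs. A vs + B vs"]
proof (rule SUP_least)
  fix vs :: "'a list" assume vs: "vs \<in> {vs. length vs = j \<and> unit_list vs}"
  have "ennreal (norm (A vs + B vs)) \<le> ennreal (norm (A vs)) + ennreal (norm (B vs))"
    by (simp flip: ennreal_plus add: ennreal_leI norm_triangle_ineq)
  also have "\<dots> \<le> op_norm j A + op_norm j B"
    using vs by (intro add_mono norm_le_op_norm) auto
  finally show "ennreal (norm (A vs + B vs)) \<le> op_norm j A + op_norm j B" .
qed

lemma op_norm_cong:
  "(\<And>vs. length vs = j \<Longrightarrow> A vs = B vs) \<Longrightarrow> op_norm j A = op_norm j B"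
  unfolding op_norm_def by (rule SUP_cong) auto

text \<open>
  Subadditivity is needed without loss of a constant: it is used to recentre neighbourhoods, where an
  inequality \<open>< \<epsilon>\<close> must be reproduced. The maps must be of class \<open>C\<^sup>k\<close> near \<open>K\<close> for their derivatives
  to be additive.
\<close>

lemma fam_norm_add:
  fixes f g :: "'a::fin_dim_inner \<Rightarrow> 'b::real_normed_vector"
  assumes W: "open W" "K \<subseteq> W" and f: "Ckh_on 0 k W f" and g: "Ckh_on 0 k W g"
  shows "fam_norm (Ck_alpha_family k a) (\<lambda>x. f x + g x) K
    \<le> fam_norm (Ck_alpha_family k a) f K + fam_norm (Ck_alpha_family k a) g K"
proof -
  have dd: "nth_deriv (\<lambda>x. f x + g x) x vs = nth_deriv f x vs + nth_deriv g x vs"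
    if "x \<in> K" "length vs \<le> k" for x vs
    unfolding nth_deriv_def using that W
    by (intro directional_deriv_add[of W _ 0]) (auto intro: Ckh_on_lower_le[OF _ f] Ckh_on_lower_le[OF _ g])
  have 0: "(SUP x\<in>K. ennreal (norm (f x + g x))) \<le> (SUP x\<in>K. ennreal (norm (f x))) + (SUP x\<in>K. ennreal (norm (g x)))"
  proof (rule SUP_least)
    fix x assume x: "x \<in> K"
    have "ennreal (norm (f x + g x)) \<le> ennreal (norm (f x)) + ennreal (norm (g x))"
      by (simp flip: ennreal_plus add: ennreal_leI norm_triangle_ineq)
    also have "\<dots> \<le> (SUP x\<in>K. ennreal (norm (f x))) + (SUP x\<in>K. ennreal (norm (g x)))"
      by (intro add_mono SUP_upper x)
    finally show "ennreal (norm (f x + g x)) \<le> \<dots>" .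
  qed
  have 1: "Ck_seminorm k (\<lambda>x. f x + g x) K \<le> Ck_seminorm k f K + Ck_seminorm k g K"
    unfolding Ck_seminorm_def[of k "\<lambda>x. f x + g x"]
  proof (intro SUP_least)
    fix j x assume jx: "j \<in> {0<..k}" "x \<in> K"
    have "op_norm j (nth_deriv (\<lambda>x. f x + g x) x) = op_norm j (\<lambda>vs. nth_deriv f x vs + nth_deriv g x vs)"
      using jx by (intro op_norm_cong dd) auto
    also have "\<dots> \<le> op_norm j (nth_deriv f x) + op_norm j (nth_deriv g x)" by (rule op_norm_add)
    also have "\<dots> \<le> Ck_seminorm k f K + Ck_seminorm k g K"
      unfolding Ck_seminorm_def using jx by (intro add_mono SUP_upper2[OF jx(1)] SUP_upper)
    finally show "op_norm j (nth_deriv (\<lambda>x. f x + g x) x) \<le> \<dots>" .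
  qed
  have 2: "deriv_hoelder_seminorm k a (\<lambda>x. f x + g x) K \<le> deriv_hoelder_seminorm k a f K + deriv_hoelder_seminorm k a g K"
    unfolding deriv_hoelder_seminorm_def[of k a "\<lambda>x. f x + g x"]
  proof (intro SUP_least)
    fix x y assume xy: "x \<in> K" "y \<in> K - {x}"
    let ?D = "\<lambda>f vs. nth_deriv f x vs - nth_deriv f y vs"
    have "op_norm k (?D (\<lambda>x. f x + g x)) = op_norm k (\<lambda>vs. ?D f vs + ?D g vs)"
      using xy by (intro op_norm_cong) (simp add: dd)
    also have "\<dots> \<le> op_norm k (?D f) + op_norm k (?D g)" by (rule op_norm_add)
    finally have "op_norm k (?D (\<lambda>x. f x + g x)) / ennreal (dist x y powr a)
        \<le> op_norm k (?D f) / ennreal (dist x y powr a) + op_norm k (?D g) / ennreal (dist x y powr a)"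
      by (subst add_divide_distrib_ennreal[symmetric]) (rule divide_right_mono_ennreal)
    also have "\<dots> \<le> deriv_hoelder_seminorm k a f K + deriv_hoelder_seminorm k a g K"
      unfolding deriv_hoelder_seminorm_def by (intro add_mono SUP_upper2[OF xy(1)] SUP_upper xy)
    finally show "op_norm k (?D (\<lambda>x. f x + g x)) / ennreal (dist x y powr a) \<le> \<dots>" .
  qed
  show ?thesis
    unfolding fam_norm_Ck_alpha
    using add_mono[OF 0 1] add_mono[OF 0 add_mono[OF 1 2]] by (simp add: ac_simps)
qed

section \<open>Bounds on compact sets\<close>

text \<open>
  A finite subcover turns local constants into a global one. Applied to pairs of points it yields the
  Hoelder estimate on compact sets that are not convex.
\<close>

lemma compact_locally_dominated:
  fixes q r :: "'a::topological_space \<Rightarrow> real"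
  assumes Z: "compact Z" and r: "\<And>z. r z \<ge> 0"
    and loc: "\<And>z. z \<in> Z \<Longrightarrow> \<exists>C. eventually (\<lambda>p. q p \<le> C * r p) (nhds z)"
  shows "\<exists>C\<ge>0. \<forall>z\<in>Z. q z \<le> C * r z"
proof -
  have "\<exists>C U. open U \<and> z \<in> U \<and> (\<forall>p\<in>U. q p \<le> C * r p)" if "z \<in> Z" for z
    using loc[OF that] by (auto simp: eventually_nhds)
  then obtain C U where U: "\<And>z. z \<in> Z \<Longrightarrow> open (U z)" "\<And>z. z \<in> Z \<Longrightarrow> z \<in> U z"
    and C: "\<And>z p. z \<in> Z \<Longrightarrow> p \<in> U z \<Longrightarrow> q p \<le> C z * r p" by metis
  obtain D where D: "D \<subseteq> Z" "finite D" "Z \<subseteq> (\<Union>z\<in>D. U z)"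
    by (rule compactE_image[OF Z U(1)]) (use U(2) in blast)+
  have "q p \<le> (\<Sum>z\<in>D. \<bar>C z\<bar>) * r p" if p: "p \<in> Z" for p
  proof -
    obtain z where z: "z \<in> D" "p \<in> U z" using D p by blast
    have "q p \<le> C z * r p" using C z D by blast
    also have "\<dots> \<le> (\<Sum>z\<in>D. \<bar>C z\<bar>) * r p"
      using member_le_sum[OF z(1), of "\<lambda>z. \<bar>C z\<bar>"] D(2)
      by (intro mult_right_mono r) (auto intro: order_trans[OF abs_ge_self])
    finally show ?thesis .
  qed
  then show ?thesis by (intro exI[of _ "\<Sum>z\<in>D. \<bar>C z\<bar>"]) (auto intro: sum_nonneg)
qed

lemma compact_isCont_bounded:
  fixes g :: "'a::t2_space \<Rightarrow> 'b::real_normed_vector"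
  assumes "compact A" "\<And>x. x \<in> A \<Longrightarrow> isCont g x"
  shows "\<exists>C\<ge>0. \<forall>x\<in>A. norm (g x) \<le> C"
  using compact_locally_dominated[OF assms(1), of "\<lambda>_. 1" "\<lambda>x. norm (g x)"]
    isCont_eventually_norm_le[OF assms(2)] by fastforce

text \<open>
  Near a point \<open>(x, x)\<close> of the diagonal of \<open>A \<times> A\<close> the local Hoelder estimate applies. Near a point \<open>(x, y)\<close>
  with \<open>x \<noteq> y\<close> the distance is bounded below and the difference of values is bounded.
\<close>

lemma compact_hoelder:
  assumes A: "compact A" and g: "\<And>x. x \<in> A \<Longrightarrow> hoelder_at a g x" and a: "0 \<le> a"
  shows "\<exists>C\<ge>0. \<forall>x\<in>A. \<forall>y\<in>A. norm (g x - g y) \<le> C * dist x y powr a"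
proof -
  have "\<exists>C\<ge>0. \<forall>p\<in>A \<times> A. norm (g (fst p) - g (snd p)) \<le> C * dist (fst p) (snd p) powr a"
  proof (rule compact_locally_dominated[OF compact_Times[OF A A]])
    fix p assume "p \<in> A \<times> A"
    then obtain x y where p: "p = (x, y)" "x \<in> A" "y \<in> A" by auto
    show "\<exists>C. \<forall>\<^sub>F p in nhds p. norm (g (fst p) - g (snd p)) \<le> C * dist (fst p) (snd p) powr a"
    proof (cases "x = y")
      case True
      then show ?thesis using g[OF p(2)] unfolding hoelder_at_def p by (auto simp: case_prod_unfold)
    next
      case False
      define \<delta> where "\<delta> = dist x y / 2"
      define C where "C = norm (g x) + 1 + (norm (g y) + 1)"
      have \<delta>: "\<delta> > 0" using False by (simp add: \<delta>_def)
      have C: "C > 0" unfolding C_def by (intro add_pos_pos add_nonneg_pos) auto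
      have f: "(fst \<longlongrightarrow> x) (nhds p)" "(snd \<longlongrightarrow> y) (nhds p)"
        using tendsto_fst[OF filterlim_ident[of "nhds p"]] tendsto_snd[OF filterlim_ident[of "nhds p"]]
        by (simp_all add: p)
      have "((\<lambda>p. dist (fst p) (snd p)) \<longlongrightarrow> dist x y) (nhds p)" by (intro tendsto_dist f)
      then have "\<forall>\<^sub>F p in nhds p. dist (fst p) (snd p) > \<delta>"
        by (rule order_tendstoD) (use False in \<open>simp add: \<delta>_def\<close>)
      moreover have "\<forall>\<^sub>F p in nhds p. norm (g (fst p)) \<le> norm (g x) + 1"
        by (rule eventually_compose_filterlim[OF isCont_eventually_norm_le f(1)]) (use g p hoelder_at_isCont in blast)
      moreover have "\<forall>\<^sub>F p in nhds p. norm (g (snd p)) \<le> norm (g y) + 1"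
        by (rule eventually_compose_filterlim[OF isCont_eventually_norm_le f(2)]) (use g p hoelder_at_isCont in blast)
      ultimately have "\<forall>\<^sub>F p in nhds p. norm (g (fst p) - g (snd p)) \<le> C / \<delta> powr a * dist (fst p) (snd p) powr a"
      proof eventually_elim
        case (elim p)
        have "norm (g (fst p) - g (snd p)) \<le> norm (g (fst p)) + norm (g (snd p))" by (rule norm_triangle_ineq4)
        also have "\<dots> \<le> C" using elim by (simp add: C_def)
        also have "C = C / \<delta> powr a * \<delta> powr a" using \<delta> by simp
        also have "\<dots> \<le> C / \<delta> powr a * dist (fst p) (snd p) powr a"
          using elim \<delta> C a by (intro mult_left_mono powr_mono2) auto
        finally show ?case .
      qed
      then show ?thesis by blast
    qed
  qed auto
  then show ?thesis by force
qed

lemma directional_deriv_isCont: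
  fixes f :: "'a::fin_dim_inner \<Rightarrow> 'b::real_normed_vector"
  assumes "open S" "Ckh_on a k S f" "length vs \<le> k" "x \<in> S"
  shows "isCont (directional_deriv f vs) x"
proof -
  have "Ckh_on a (length vs + (k - length vs)) S f" using assms by simp
  then show ?thesis using Ckh_on_directional_deriv Ckh_on_isCont assms(4) by blast
qed

lemma Ckh_on_compact_bound:
  fixes f :: "'a::fin_dim_inner \<Rightarrow> 'b::real_normed_vector"
  assumes S: "open S" and A: "compact A" "A \<subseteq> S" and f: "Ckh_on a k S f" and a: "0 \<le> a" "a \<le> 1"
  shows "\<exists>e\<ge>0. Ckh_bound k a e f A"
proof -
  define L where "L = (\<Union>j\<le>k. onb_lists j :: 'a list set)"
  have L: "finite L" unfolding L_def by (intro finite_UN_I finite_onb_lists) simp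
  have lenL: "length es \<le> k" if "es \<in> L" for es using that by (auto simp: L_def onb_lists_def)
  have "\<exists>C\<ge>0. \<forall>x\<in>A. norm (directional_deriv f es x) \<le> C" if "es \<in> L" for es
    using A by (intro compact_isCont_bounded directional_deriv_isCont[OF S f] lenL that) auto
  then obtain M where M0: "\<And>es. es \<in> L \<Longrightarrow> M es \<ge> 0"
    and M: "\<And>es x. es \<in> L \<Longrightarrow> x \<in> A \<Longrightarrow> norm (directional_deriv f es x) \<le> M es" by metis
  have "\<exists>C\<ge>0. \<forall>x\<in>A. \<forall>y\<in>A. norm (directional_deriv f es x - directional_deriv f es y) \<le> C * dist x y powr a"
    if es: "es \<in> onb_lists k" for es
  proof (rule compact_hoelder[OF A(1) _ a(1)])
    fix x assume x: "x \<in> A"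
    have "Ckh_on a 0 S (directional_deriv f es)"
      by (rule Ckh_on_directional_deriv) (use es f in \<open>simp add: onb_lists_def\<close>)
    then show "hoelder_at a (directional_deriv f es) x" using x A by auto
  qed
  then obtain H where H0: "\<And>es. es \<in> onb_lists k \<Longrightarrow> H es \<ge> 0"
    and H: "\<And>es x y. es \<in> onb_lists k \<Longrightarrow> x \<in> A \<Longrightarrow> y \<in> A \<Longrightarrow>
      norm (directional_deriv f es x - directional_deriv f es y) \<le> H es * dist x y powr a" by metis
  define e where "e = (\<Sum>es\<in>L. M es) + (\<Sum>es\<in>onb_lists k. H es)"
  have e: "(\<Sum>es\<in>L. M es) \<le> e" "(\<Sum>es\<in>onb_lists k. H es) \<le> 2 * e" "e \<ge> 0"
    using sum_nonneg[of L M] sum_nonneg[of "onb_lists k" H] M0 H0 unfolding e_def by auto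
  have exp: "directional_deriv f vs x = (\<Sum>es\<in>onb_lists (length vs). onb_coeff vs es *\<^sub>R directional_deriv f es x)"
    if "length vs \<le> k" "x \<in> A" for vs x
    using that A by (intro directional_deriv_expansion[where a = a, OF S] Ckh_on_lower_le[OF S f _ a]) auto
  have "norm (directional_deriv f vs x) \<le> e" if x: "x \<in> A" and vs: "length vs \<le> k" "unit_list vs" for x vs
  proof -
    have "norm (directional_deriv f vs x) \<le> (\<Sum>es\<in>onb_lists (length vs). 1 * M es)"
      unfolding exp[OF vs(1) x]
    proof (rule sum_norm_le)
      fix es :: "'a list" assume es: "es \<in> onb_lists (length vs)"
      then show "norm (onb_coeff vs es *\<^sub>R directional_deriv f es x) \<le> 1 * M es"
        unfolding norm_scaleR using M[of es x] x vs abs_onb_coeff_le_1[OF es vs(2)]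
        by (intro mult_mono) (auto simp: L_def)
    qed
    also have "\<dots> \<le> (\<Sum>es\<in>L. M es)"
      unfolding mult_1 using vs by (intro sum_mono2 L M0) (auto simp: L_def)
    finally show ?thesis using e by simp
  qed
  moreover have "norm (directional_deriv f vs x - directional_deriv f vs y) \<le> 2 * e * dist x y powr a"
    if x: "x \<in> A" and y: "y \<in> A" and vs: "length vs = k" "unit_list vs" for x y vs
  proof -
    have vs': "length vs \<le> k" using vs by simp
    have "norm (directional_deriv f vs x - directional_deriv f vs y) \<le> (\<Sum>es\<in>onb_lists k. 1 * (H es * dist x y powr a))"
      unfolding exp[OF vs' x] exp[OF vs' y] sum_subtractf[symmetric] scaleR_diff_right[symmetric] vs(1)
    proof (rule sum_norm_le)
      fix es :: "'a list" assume es: "es \<in> onb_lists k"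
      then show "norm (onb_coeff vs es *\<^sub>R (directional_deriv f es x - directional_deriv f es y)) \<le> 1 * (H es * dist x y powr a)"
        unfolding norm_scaleR using H[of es x y] x y vs abs_onb_coeff_le_1[of es vs]
        by (intro mult_mono) auto
    qed
    also have "\<dots> = (\<Sum>es\<in>onb_lists k. H es) * dist x y powr a" by (simp add: sum_distrib_right)
    also have "\<dots> \<le> 2 * e * dist x y powr a" by (intro mult_right_mono e) simp
    finally show ?thesis .
  qed
  ultimately show ?thesis unfolding Ckh_bound_def using e(3) by blast
qed

text \<open>
  The converse of the preceding lemma, on open sets: a bound on the norm gives back the regularity of
  the highest derivative.
\<close>

lemma Ckh_on_if_bound:
  fixes f :: "'a::fin_dim_inner \<Rightarrow> 'b::real_normed_vector"
  assumes S: "open S" and f: "Ckh_on 0 k S f" and b: "Ckh_bound k a e f S" and e: "0 \<le> e"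
  shows "Ckh_on a k S f"
proof (rule Ckh_onI_directional)
  show "Ck_on k S f" using f by (simp add: Ck_on_eq_Ckh_on[OF S])
  fix vs :: "'a list" and x assume vs: "length vs = k" and x: "x \<in> S"
  have "hoelder_at a (directional_deriv f es) x" if es: "es \<in> onb_lists k" for es
  proof -
    have "\<forall>\<^sub>F (y, z) in nhds (x, x). norm (directional_deriv f es y - directional_deriv f es z) \<le> 2 * e * dist y z powr a"
      using eventually_nhds_pair[OF eventually_nhds_in_open[OF S x]]
    proof eventually_elim
      case (elim p)
      then show ?case using b es unfolding Ckh_bound_def onb_lists_def
        by (auto simp: norm_onb subset_iff)
    qed
    moreover have "isCont (directional_deriv f es) x"
      using es by (intro directional_deriv_isCont[OF S f _ x]) (simp add: onb_lists_def)
    ultimately show ?thesis using e unfolding hoelder_at_def by (intro conjI exI[of _ "2 * e"]) auto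
  qed
  then have "hoelder_at a (\<lambda>y. \<Sum>es\<in>onb_lists k. onb_coeff vs es *\<^sub>R directional_deriv f es y) x"
    by (intro hoelder_at_sum finite_onb_lists hoelder_at_bounded_linear[OF bounded_linear_scaleR_right]) auto
  moreover have "\<forall>\<^sub>F y in nhds x. (\<Sum>es\<in>onb_lists k. onb_coeff vs es *\<^sub>R directional_deriv f es y) = directional_deriv f vs y"
    using eventually_nhds_in_open[OF S x] directional_deriv_expansion[OF S, of _ 0 vs f] f
    by (auto elim!: eventually_mono simp: vs)
  ultimately show "hoelder_at a (directional_deriv f vs) x" by (rule hoelder_at_cong)
qed

section \<open>Limits\<close>

text \<open>
  The classical theorem on differentiating a limit of maps, iterated. The derivatives in the basis
  directions converge uniformly, so the derivatives converge uniformly as linear maps; the limit \<open>v'\<close>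
  of \<open>Du\<^sub>n\<close> is then the derivative of \<open>v\<close>, and the induction hypothesis applies to \<open>x \<mapsto> Du\<^sub>n(x) h\<close>.
\<close>

lemma Ckh_on_uniform_limit:
  fixes u :: "nat \<Rightarrow> 'a::fin_dim_inner \<Rightarrow> 'b::banach"
  assumes S: "open S"
  shows "(\<And>n. Ckh_on 0 k S (u n)) \<Longrightarrow>
    (\<And>vs. length vs \<le> k \<Longrightarrow> uniformly_Cauchy_on S (\<lambda>n. directional_deriv (u n) vs)) \<Longrightarrow>
    (\<And>x. x \<in> S \<Longrightarrow> (\<lambda>n. u n x) \<longlonglongrightarrow> v x) \<Longrightarrow>
    Ckh_on 0 k S v \<and> (\<forall>vs x. length vs \<le> k \<longrightarrow> x \<in> S \<longrightarrow>
      (\<lambda>n. directional_deriv (u n) vs x) \<longlonglongrightarrow> directional_deriv v vs x)"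
proof (induction k arbitrary: u v)
  case 0
  have "uniformly_Cauchy_on S u" using 0(2)[of "[]"] by simp
  then obtain w where w: "uniform_limit S u w sequentially"
    using Cauchy_uniformly_convergent unfolding uniformly_convergent_on_def by blast
  have "w x = v x" if "x \<in> S" for x
    using tendsto_uniform_limitI[OF w that] 0(3)[OF that] LIMSEQ_unique by blast
  then have lim: "uniform_limit S u v sequentially"
    using w by (simp cong: uniform_limit_cong')
  have "continuous_on S v"
    by (rule uniform_limit_theorem[OF _ lim])
       (use 0(1) S in \<open>auto simp: continuous_on_eq_continuous_at intro!: always_eventually hoelder_at_isCont\<close>)
  then show ?case using S 0(3) by (auto simp: continuous_on_eq_continuous_at intro: hoelder_at_0)
next
  case (Suc k)
  define w where "w e x = lim (\<lambda>n. frechet_derivative (u n) (at x) e)" for e x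
  define v' where "v' x h = (\<Sum>e\<in>onb. (h \<bullet> e) *\<^sub>R w e x)" for x h
  have Du: "(u n has_derivative frechet_derivative (u n) (at x)) (at x)" if "x \<in> S" for n x
    using Ckh_on_SucD(1)[OF Suc.prems(1)] that by blast
  have ul: "uniform_limit S (\<lambda>n x. frechet_derivative (u n) (at x) e) (w e) sequentially" for e
  proof -
    have "uniformly_Cauchy_on S (\<lambda>n x. frechet_derivative (u n) (at x) e)"
      using Suc.prems(2)[of "[e]"] by simp
    then obtain l where l: "uniform_limit S (\<lambda>n x. frechet_derivative (u n) (at x) e) l sequentially"
      using Cauchy_uniformly_convergent unfolding uniformly_convergent_on_def by blast
    have "l x = w e x" if "x \<in> S" for x
      using tendsto_uniform_limitI[OF l that] unfolding w_def by (rule limI[symmetric])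
    then show ?thesis using l by (simp cong: uniform_limit_cong')
  qed
  \<comment> \<open>uniform convergence of the derivatives as linear maps\<close>
  have nle: "\<forall>\<^sub>F n in sequentially. \<forall>x\<in>S. \<forall>h. norm (frechet_derivative (u n) (at x) h - v' x h) \<le> \<epsilon> * norm h"
    if \<epsilon>: "\<epsilon> > 0" for \<epsilon>
  proof -
    define \<delta> where "\<delta> = \<epsilon> / (card (onb :: 'a set) + 1)"
    have \<delta>: "\<delta> > 0" using \<epsilon> by (auto simp: \<delta>_def intro!: divide_pos_pos add_nonneg_pos)
    have "\<forall>\<^sub>F n in sequentially. \<forall>e\<in>onb. \<forall>x\<in>S. dist (frechet_derivative (u n) (at x) e) (w e x) < \<delta>"
      using ul \<delta> by (intro eventually_ball_finite finite_onb) (auto simp: uniform_limit_iff)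
    then show ?thesis
    proof eventually_elim
      case (elim n)
      show ?case
      proof (intro ballI allI)
        fix x h assume x: "x \<in> S"
        have "frechet_derivative (u n) (at x) h - v' x h
            = (\<Sum>e\<in>onb. (h \<bullet> e) *\<^sub>R (frechet_derivative (u n) (at x) e - w e x))"
          unfolding v'_def by (subst linear_onb_expansion[OF has_derivative_linear[OF Du[OF x]]])
             (simp add: sum_subtractf scaleR_diff_right)
        also have "norm \<dots> \<le> (\<Sum>e\<in>(onb::'a set). norm h * \<delta>)"
        proof (rule sum_norm_le)
          fix e :: 'a assume e: "e \<in> onb"
          have "norm (frechet_derivative (u n) (at x) e - w e x) \<le> \<delta>"
            using elim e x by (auto simp: dist_norm less_imp_le)
          then show "norm ((h \<bullet> e) *\<^sub>R (frechet_derivative (u n) (at x) e - w e x)) \<le> norm h * \<delta>"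
            unfolding norm_scaleR using Cauchy_Schwarz_ineq2[of h e] norm_onb[OF e] \<delta> by (intro mult_mono) auto
        qed
        also have "\<dots> = (card (onb::'a set) * \<delta>) * norm h" by simp
        also have "\<dots> \<le> \<epsilon> * norm h"
        proof (intro mult_right_mono)
          have "card (onb::'a set) * \<delta> \<le> (card (onb::'a set) + 1) * \<delta>" using \<delta> by simp
          also have "\<dots> = \<epsilon>" unfolding \<delta>_def by (simp add: add_nonneg_pos less_imp_neq[symmetric])
          finally show "card (onb::'a set) * \<delta> \<le> \<epsilon>" .
        qed simp
        finally show "norm (frechet_derivative (u n) (at x) h - v' x h) \<le> \<epsilon> * norm h" .
      qed
    qed
  qed
  have v': "(v has_derivative v' x) (at x)" if x: "x \<in> S" for x
  proof -
    obtain r where r: "r > 0" "ball x r \<subseteq> S" using S x by (auto simp: open_contains_ball)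
    have "\<exists>g. \<forall>y\<in>ball x r. (\<lambda>n. u n y) \<longlonglongrightarrow> g y \<and> (g has_derivative v' y) (at y within ball x r)"
    proof (rule has_derivative_sequence[OF convex_ball])
      show "(u n has_derivative frechet_derivative (u n) (at y)) (at y within ball x r)" if "y \<in> ball x r" for n y
        by (rule has_derivative_at_withinI, rule Du) (use r that in blast)
      show "\<forall>\<^sub>F n in sequentially. \<forall>y\<in>ball x r. \<forall>h. norm (frechet_derivative (u n) (at y) h - v' y h) \<le> \<epsilon> * norm h"
        if "\<epsilon> > 0" for \<epsilon>
        using nle[OF that] by eventually_elim (use r in blast)
      show "x \<in> ball x r" using r by simp
      show "(\<lambda>n. u n x) \<longlonglongrightarrow> v x" using Suc.prems(3) x by blast
    qed
    then obtain g where g: "\<And>y. y \<in> ball x r \<Longrightarrow> (\<lambda>n. u n y) \<longlonglongrightarrow> g y"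
      "\<And>y. y \<in> ball x r \<Longrightarrow> (g has_derivative v' y) (at y within ball x r)" by blast
    have "(g has_derivative v' x) (at x)"
      using g(2)[of x] r at_within_open[of x "ball x r"] by simp
    moreover have "g y = v y" if "y \<in> ball x r" for y
      using g(1)[OF that] Suc.prems(3)[of y] r that LIMSEQ_unique by blast
    ultimately show ?thesis
      using r by (intro has_derivative_transform_within_open[of g _ _ _ "ball x r" v]) auto
  qed
  have IH: "Ckh_on 0 k S (\<lambda>x. v' x h) \<and> (\<forall>vs x. length vs \<le> k \<longrightarrow> x \<in> S \<longrightarrow>
      (\<lambda>n. directional_deriv (\<lambda>x. frechet_derivative (u n) (at x) h) vs x) \<longlonglongrightarrow> directional_deriv (\<lambda>x. v' x h) vs x)" for h
  proof (rule Suc.IH)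
    show "Ckh_on 0 k S (\<lambda>x. frechet_derivative (u n) (at x) h)" for n
      by (rule Ckh_on_SucD(2)[OF Suc.prems(1)])
    show "uniformly_Cauchy_on S (\<lambda>n. directional_deriv (\<lambda>x. frechet_derivative (u n) (at x) h) vs)"
      if "length vs \<le> k" for vs using Suc.prems(2)[of "h # vs"] that by simp
    show "(\<lambda>n. frechet_derivative (u n) (at x) h) \<longlonglongrightarrow> v' x h" if x: "x \<in> S" for x
    proof -
      have "(\<lambda>n. \<Sum>e\<in>onb. (h \<bullet> e) *\<^sub>R frechet_derivative (u n) (at x) e) \<longlonglongrightarrow> v' x h"
        unfolding v'_def by (intro tendsto_intros tendsto_uniform_limitI[OF ul x])
      then show ?thesis
        by (subst linear_onb_expansion[OF has_derivative_linear[OF Du[OF x]]])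
    qed
  qed
  have v: "Ckh_on 0 (Suc k) S v" by (rule Ckh_on_SucI[OF S v']) (use IH in auto)
  moreover have "(\<lambda>n. directional_deriv (u n) vs x) \<longlonglongrightarrow> directional_deriv v vs x"
    if vs: "length vs \<le> Suc k" and x: "x \<in> S" for vs x
  proof (cases vs)
    case Nil
    then show ?thesis using Suc.prems(3) x by simp
  next
    case (Cons h hs)
    have "directional_deriv (\<lambda>x. v' x h) hs x = directional_deriv (\<lambda>x. frechet_derivative v (at x) h) hs x"
    proof (rule directional_deriv_cong[OF S _ _ x])
      show "Ckh_on 0 (length hs) S (\<lambda>x. v' x h)"
        using vs IH[of h] by (auto simp: Cons intro: Ckh_on_lower_le[OF S])
    qed (simp add: frechet_derivative_eq[OF v'])
    then show ?thesis using conjunct2[OF IH[of h], rule_format, of hs x] vs x by (simp add: Cons)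
  qed
  ultimately show ?case by blast
qed

text \<open>
  The sequence converges to \<open>v\<close> with all derivatives up to order \<open>k\<close>, but only on open subsets \<open>S\<close> of \<open>A\<close>.
  Passing to the limit \<open>l \<rightarrow> \<infinity>\<close> in each of the inequalities that bound the norm of \<open>u\<^sub>m - u\<^sub>l\<close> bounds the
  norm of \<open>u\<^sub>m - v\<close>; for \<open>m = 0\<close> this bounds the norm of \<open>v\<close> itself.
\<close>

lemma Ckh_limit:
  fixes u :: "nat \<Rightarrow> 'a::fin_dim_inner \<Rightarrow> 'b::banach"
  assumes a: "0 \<le> a" and S: "open S" "S \<subseteq> A"
    and u: "\<And>n. Ck_near k (u n) A"
    and fin: "fam_norm (Ck_alpha_family k a) (u 0) A < \<infinity>"
    and e: "\<And>m. 0 \<le> e m" "e \<longlonglongrightarrow> 0"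
    and cauchy: "\<And>m l. m \<le> l \<Longrightarrow> fam_norm (Ck_alpha_family k a) (\<lambda>x. u m x - u l x) A \<le> ennreal (e m)"
    and lim: "\<And>x. x \<in> S \<Longrightarrow> (\<lambda>n. u n x) \<longlonglongrightarrow> v x"
  shows "Ckh_on a k S v"
    and "\<And>m. fam_norm (Ck_alpha_family k a) (\<lambda>x. u m x - v x) S \<le> ennreal (4 * e m)"
proof -
  have uS: "Ckh_on 0 k S (u n)" for n
    using u[of n] S by (auto elim!: Ck_near_Ckh_on intro: Ckh_on_subset)
  have dd: "directional_deriv (\<lambda>x. f x - g x) vs x = directional_deriv f vs x - directional_deriv g vs x"
    if "Ckh_on 0 k S f" "Ckh_on 0 k S g" "x \<in> S" "length vs \<le> k" for f g and vs x
    using that by (intro directional_deriv_diff[OF S(1), of _ 0]) (auto intro: Ckh_on_lower_le[OF S(1)])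
  have "Ckh_bound k a (e m) (\<lambda>x. u m x - u l x) S" if "m \<le> l" for m l
    by (rule Ckh_bound_if_fam_norm_le[OF order_trans[OF fam_norm_mono[OF S(2)] cauchy[OF that]] e(1)])
  then have b1: "norm (directional_deriv (u m) vs x - directional_deriv (u l) vs x) \<le> e m"
    and b2: "length vs = k \<Longrightarrow> y \<in> S \<Longrightarrow> norm ((directional_deriv (u m) vs x - directional_deriv (u l) vs x)
        - (directional_deriv (u m) vs y - directional_deriv (u l) vs y)) \<le> 2 * e m * dist x y powr a"
    if "m \<le> l" "x \<in> S" "length vs \<le> k" "unit_list vs" for m l x y vs
    using that unfolding Ckh_bound_def dd[OF uS uS that(2,3), symmetric] by (auto simp: dd[OF uS uS])
  have "uniformly_Cauchy_on S (\<lambda>n. directional_deriv (u n) vs)" if vs: "length vs \<le> k" for vs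
  proof (rule uniformly_Cauchy_onI')
    fix \<epsilon> :: real assume \<epsilon>: "\<epsilon> > 0"
    define B where "B = (\<Sum>es\<in>onb_lists (length vs). \<bar>onb_coeff vs es\<bar>)"
    have "(\<lambda>m. B * e m) \<longlonglongrightarrow> B * 0" by (intro tendsto_mult_left e)
    then have "\<forall>\<^sub>F m in sequentially. B * e m < \<epsilon>" using \<epsilon> by (auto dest: order_tendstoD)
    then obtain M where M: "\<And>m. m \<ge> M \<Longrightarrow> B * e m < \<epsilon>" by (auto simp: eventually_sequentially)
    have "dist (directional_deriv (u m) vs x) (directional_deriv (u l) vs x) < \<epsilon>"
      if x: "x \<in> S" and "m \<ge> M" "l > m" for x m l
    proof -
      have exp: "directional_deriv (u n) vs x = (\<Sum>es\<in>onb_lists (length vs). onb_coeff vs es *\<^sub>R directional_deriv (u n) es x)" for n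
        by (rule directional_deriv_expansion[OF S(1) x, of 0]) (rule Ckh_on_lower_le[OF S(1) uS vs], auto)
      have "norm (directional_deriv (u m) vs x - directional_deriv (u l) vs x)
         \<le> (\<Sum>es\<in>onb_lists (length vs). \<bar>onb_coeff vs es\<bar> * e m)"
        unfolding exp sum_subtractf[symmetric] scaleR_diff_right[symmetric]
      proof (rule sum_norm_le)
        fix es :: "'a list" assume "es \<in> onb_lists (length vs)"
        then have "length es \<le> k" "unit_list es" using vs by (auto simp: onb_lists_def norm_onb subset_iff)
        then show "norm (onb_coeff vs es *\<^sub>R (directional_deriv (u m) es x - directional_deriv (u l) es x)) \<le> \<bar>onb_coeff vs es\<bar> * e m"
          using b1[of m l x es] x \<open>l > m\<close> by (auto intro: mult_left_mono)
      qed
      also have "\<dots> = B * e m" by (simp add: B_def sum_distrib_right)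
      finally show ?thesis using M[OF \<open>m \<ge> M\<close>] by (simp add: dist_norm)
    qed
    then show "\<exists>M. \<forall>x\<in>S. \<forall>m\<ge>M. \<forall>n>m. dist (directional_deriv (u m) vs x) (directional_deriv (u n) vs x) < \<epsilon>" by blast
  qed
  from Ckh_on_uniform_limit[OF S(1) uS this lim]
  have v: "Ckh_on 0 k S v"
    and ddlim: "\<And>vs x. length vs \<le> k \<Longrightarrow> x \<in> S \<Longrightarrow> (\<lambda>n. directional_deriv (u n) vs x) \<longlonglongrightarrow> directional_deriv v vs x"
    by auto
  have bound: "Ckh_bound k a (e m) (\<lambda>x. u m x - v x) S" for m
  proof -
    have "norm (directional_deriv (u m) vs x - directional_deriv v vs x) \<le> e m"
      if "x \<in> S" "length vs \<le> k" "unit_list vs" for x vs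
      by (rule tendsto_upperbound[OF tendsto_norm[OF tendsto_diff[OF tendsto_const ddlim]]])
         (use that b1[of m _ x vs] in \<open>auto simp: eventually_sequentially\<close>)
    moreover have "norm ((directional_deriv (u m) vs x - directional_deriv v vs x)
        - (directional_deriv (u m) vs y - directional_deriv v vs y)) \<le> 2 * e m * dist x y powr a"
      if "x \<in> S" "y \<in> S" "length vs = k" "unit_list vs" for x y vs
      by (rule tendsto_upperbound[OF tendsto_norm[OF tendsto_diff[OF tendsto_diff[OF tendsto_const ddlim] tendsto_diff[OF tendsto_const ddlim]]]])
         (use that b2[of m _ x vs y] in \<open>auto simp: eventually_sequentially\<close>)
    ultimately show ?thesis unfolding Ckh_bound_def by (auto simp: dd[OF uS v])
  qed
  then show "fam_norm (Ck_alpha_family k a) (\<lambda>x. u m x - v x) S \<le> ennreal (4 * e m)" for m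
    by (rule fam_norm_le_if_Ckh_bound[OF _ e(1)])
  obtain c where c: "0 \<le> c" "fam_norm (Ck_alpha_family k a) (u 0) A = ennreal c"
    using fin by (metis ennreal_cases infinity_ennreal_def order_less_irrefl)
  have b0: "Ckh_bound k a c (u 0) S"
    by (rule Ckh_bound_if_fam_norm_le) (use c fam_norm_mono[OF S(2), of k a "u 0"] in auto)
  have "Ckh_bound k a (c + e 0) v S"
  proof -
    have "norm (directional_deriv v vs x) \<le> c + e 0" if "x \<in> S" "length vs \<le> k" "unit_list vs" for x vs
    proof -
      have "norm (directional_deriv (u 0) vs x) \<le> c" using b0 that by (auto simp: Ckh_bound_def)
      moreover have "norm (directional_deriv (u 0) vs x - directional_deriv v vs x) \<le> e 0"
        using bound[of 0] that by (auto simp: Ckh_bound_def dd[OF uS v])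
      ultimately show ?thesis
        using norm_triangle_sub[of "directional_deriv v vs x" "directional_deriv (u 0) vs x"]
        by (simp add: norm_minus_commute)
    qed
    moreover have "norm (directional_deriv v vs x - directional_deriv v vs y) \<le> 2 * (c + e 0) * dist x y powr a"
      if "x \<in> S" "y \<in> S" "length vs = k" "unit_list vs" for x y vs
    proof -
      have 1: "norm (directional_deriv (u 0) vs x - directional_deriv (u 0) vs y) \<le> 2 * c * dist x y powr a"
        using b0 that by (auto simp: Ckh_bound_def)
      have 2: "norm ((directional_deriv (u 0) vs x - directional_deriv v vs x) - (directional_deriv (u 0) vs y - directional_deriv v vs y)) \<le> 2 * e 0 * dist x y powr a"
        using bound[of 0] that by (auto simp: Ckh_bound_def dd[OF uS v])
      have "directional_deriv v vs x - directional_deriv v vs y =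
        (directional_deriv (u 0) vs x - directional_deriv (u 0) vs y) -
        ((directional_deriv (u 0) vs x - directional_deriv v vs x) - (directional_deriv (u 0) vs y - directional_deriv v vs y))"
        by simp
      also have "norm \<dots> \<le> 2 * c * dist x y powr a + 2 * e 0 * dist x y powr a"
        by (rule order_trans[OF norm_triangle_ineq4 add_mono[OF 1 2]])
      finally show ?thesis by (simp add: algebra_simps)
    qed
    ultimately show ?thesis unfolding Ckh_bound_def by blast
  qed
  then show "Ckh_on a k S v" by (rule Ckh_on_if_bound[OF S(1) v]) (use c e(1)[of 0] in simp)
qed

section \<open>Charts and coordinates\<close>

lemma is_chartD:
  assumes "is_chart X c"
  shows is_chart_openin: "openin X (fst c)"
    and is_chart_inj: "inj_on (snd c) (fst c)"
    and is_chart_open_iff: "\<And>W. W \<subseteq> fst c \<Longrightarrow> open (snd c ` W) \<longleftrightarrow> openin X W"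
    and is_chart_compact_iff: "\<And>K. K \<subseteq> fst c \<Longrightarrow> compact (snd c ` K) \<longleftrightarrow> compactin X K"
proof -
  obtain U \<phi> where c: "c = (U, \<phi>)" by force
  have U: "openin X U" and V: "open (\<phi> ` U)"
    and hom: "homeomorphic_map (subtopology X U) (top_of_set (\<phi> ` U)) \<phi>"
    using assms by (auto simp: is_chart_def c)
  have ts: "topspace (subtopology X U) = U" using openin_subset[OF U] by auto
  show "openin X (fst c)" using U by (simp add: c)
  show "inj_on (snd c) (fst c)" using homeomorphic_imp_injective_map[OF hom] ts by (simp add: c)
  show "open (snd c ` W) \<longleftrightarrow> openin X W" if "W \<subseteq> fst c" for W
  proof -
    have "openin (top_of_set (\<phi> ` U)) (\<phi> ` W) \<longleftrightarrow> openin (subtopology X U) W"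
      using that openin_subset[OF U] by (intro homeomorphic_map_openness[OF hom]) (auto simp: c)
    moreover have "openin (top_of_set (\<phi> ` U)) (\<phi> ` W) \<longleftrightarrow> open (\<phi> ` W)"
      using that V by (simp add: openin_open_eq c image_mono)
    moreover have "openin (subtopology X U) W \<longleftrightarrow> openin X W"
      using that U by (simp add: openin_open_subtopology c)
    ultimately show ?thesis by (simp add: c)
  qed
  show "compact (snd c ` K) \<longleftrightarrow> compactin X K" if "K \<subseteq> fst c" for K
    using homeomorphic_map_compactness[OF hom, of K] that openin_subset[OF U]
    by (auto simp: c compactin_subtopology image_mono)
qed

lemma is_chart_inv [simp]:
  "is_chart X c \<Longrightarrow> x \<in> fst c \<Longrightarrow> inv_into (fst c) (snd c) (snd c x) = x"
  by (simp add: is_chart_inj)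

lemma is_chart_preimage_open:
  assumes c: "is_chart X c" and T: "open T"
  shows "openin X {x \<in> fst c. snd c x \<in> T}"
proof -
  have "snd c ` {x \<in> fst c. snd c x \<in> T} = snd c ` fst c \<inter> T" by auto
  moreover have "open (snd c ` fst c)" using is_chart_openin[OF c] by (simp add: is_chart_open_iff[OF c])
  ultimately show ?thesis
    using T by (subst is_chart_open_iff[OF c, symmetric]) auto
qed

lemma is_chart_interior_preimage:
  assumes c: "is_chart X c" and K: "K \<subseteq> fst c"
  shows "{x \<in> fst c. snd c x \<in> interior (snd c ` K)} \<subseteq> K"
proof clarify
  fix x assume x: "x \<in> fst c" "snd c x \<in> interior (snd c ` K)"
  then obtain z where z: "z \<in> K" "snd c x = snd c z" using interior_subset by blast
  then have "x = z" using x K by (intro inj_onD[OF is_chart_inj[OF c]]) auto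
  then show "x \<in> K" using z by simp
qed

text \<open>
  Convergence in coordinates towards a point of the coordinate domain is convergence in the manifold.
\<close>

lemma is_chart_limitin:
  assumes c: "is_chart X c" and p: "p \<in> fst c"
    and x: "\<forall>\<^sub>F n in F. x n \<in> fst c" and lim: "((\<lambda>n. snd c (x n)) \<longlongrightarrow> snd c p) F"
  shows "limitin X x p F"
  unfolding limitin_def
proof (intro conjI allI impI)
  show "p \<in> topspace X" using p is_chart_openin[OF c] openin_subset by blast
  fix W assume W: "openin X W \<and> p \<in> W"
  have "open (snd c ` (W \<inter> fst c))"
    using W is_chart_openin[OF c] by (subst is_chart_open_iff[OF c]) auto
  then have "\<forall>\<^sub>F n in F. snd c (x n) \<in> snd c ` (W \<inter> fst c)"
    using lim W p by (auto elim!: topological_tendstoD)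
  then show "\<forall>\<^sub>F n in F. x n \<in> W" using x
  proof eventually_elim
    case (elim n)
    then show ?case using is_chart_inj[OF c] by (auto simp: inj_on_def)
  qed
qed

lemma compact_fattening:
  fixes A :: "'a::heine_borel set"
  assumes A: "compact A" "A \<subseteq> S" and S: "open S"
  obtains B where "compact B" "A \<subseteq> interior B" "B \<subseteq> S"
proof -
  have "\<exists>r>0. cball x r \<subseteq> S" if "x \<in> A" for x
    using A S that by (auto simp: open_contains_cball)
  then obtain r where r: "\<And>x. x \<in> A \<Longrightarrow> r x > 0" "\<And>x. x \<in> A \<Longrightarrow> cball x (r x) \<subseteq> S" by metis
  obtain D where D: "D \<subseteq> A" "finite D" "A \<subseteq> (\<Union>x\<in>D. ball x (r x))"
    by (rule compactE_image[OF A(1), of A "\<lambda>x. ball x (r x)"]) (use r in force)+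
  show ?thesis
  proof
    show "compact (\<Union>x\<in>D. cball x (r x))" using D by (intro compact_UN) auto
    have "(\<Union>x\<in>D. ball x (r x)) \<subseteq> interior (\<Union>x\<in>D. cball x (r x))"
      by (rule interior_maximal) (force, blast)
    then show "A \<subseteq> interior (\<Union>x\<in>D. cball x (r x))" using D by blast
    show "(\<Union>x\<in>D. cball x (r x)) \<subseteq> S" using D r by blast
  qed
qed

lemma is_chart_compact_fattening:
  fixes c :: "('a, 'm::heine_borel) chart"
  assumes c: "is_chart X c" and K: "compactin X K" "K \<subseteq> W" and W: "openin X W" "W \<subseteq> fst c"
  obtains K' where "compactin X K'" "K \<subseteq> K'" "K' \<subseteq> W" "snd c ` K \<subseteq> interior (snd c ` K')"
proof -
  have "compact (snd c ` K)" using K W by (subst is_chart_compact_iff[OF c]) auto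
  moreover have "open (snd c ` W)" using W by (subst is_chart_open_iff[OF c]) auto
  ultimately obtain B where B: "compact B" "snd c ` K \<subseteq> interior B" "B \<subseteq> snd c ` W"
    using compact_fattening K by (metis image_mono)
  define K' where "K' = {x \<in> W. snd c x \<in> B}"
  have B_eq: "snd c ` K' = B" using B(3) by (auto simp: K'_def)
  show ?thesis
  proof
    show "compactin X K'" using B(1) W unfolding B_eq[symmetric]
      by (subst (asm) is_chart_compact_iff[OF c]) (auto simp: K'_def)
    show "K \<subseteq> K'" using K B(2) interior_subset unfolding K'_def by blast
    show "K' \<subseteq> W" by (auto simp: K'_def)
    show "snd c ` K \<subseteq> interior (snd c ` K')" using B by (simp add: B_eq)
  qed
qed

lemma smooth_manifoldD:
  assumes "smooth_manifold m M"
  shows smooth_manifold_Hausdorff: "Hausdorff_space (mtop M)"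
    and smooth_manifold_second_countable: "second_countable (mtop M)"
    and smooth_manifold_chart: "\<And>c. c \<in> charts M \<Longrightarrow> is_chart (mtop M) c"
    and smooth_manifold_cover: "\<And>x. x \<in> topspace (mtop M) \<Longrightarrow> \<exists>c\<in>charts M. x \<in> fst c"
    and smooth_manifold_transition: "\<And>c c'. c \<in> charts M \<Longrightarrow> c' \<in> charts M \<Longrightarrow>
      smooth_on (snd c ` (fst c \<inter> fst c')) (snd c' \<circ> inv_into (fst c) (snd c))"
proof -
  note * = assms[unfolded smooth_manifold_def]
  show "Hausdorff_space (mtop M)" "second_countable (mtop M)" using * by blast+
  show "is_chart (mtop M) c" if "c \<in> charts M" for c using * that by blast
  show "\<exists>c\<in>charts M. x \<in> fst c" if "x \<in> topspace (mtop M)" for x using * that by blast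
  show "smooth_on (snd c ` (fst c \<inter> fst c')) (snd c' \<circ> inv_into (fst c) (snd c))"
    if "c \<in> charts M" "c' \<in> charts M" for c c'
  proof -
    have "smoothly_compatible c c'" using * that by blast
    then show ?thesis by (simp add: smoothly_compatible_def case_prod_unfold)
  qed
qed

lemma smooth_on_empty: "smooth_on {} f"
proof -
  have "Ck_on n {} f" for n by (induction n arbitrary: f) auto
  then show ?thesis by (simp add: smooth_on_def)
qed

text \<open>
  A maximal atlas contains the chart with empty domain, also if the manifold is empty. It is needed to
  see that the weak topology lives on the whole function space.
\<close>

lemma smooth_manifold_charts_nonempty:
  assumes "smooth_manifold m M"
  shows "charts M \<noteq> {}"
proof -
  let ?c = "({}, undefined)"
  have "homeomorphic_map (subtopology (mtop M) {}) (top_of_set {}) undefined"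
    by (rule bijective_open_imp_homeomorphic_map) (auto simp: open_map_def)
  then have "is_chart (mtop M) ?c" by (simp add: is_chart_def)
  moreover have "smoothly_compatible ?c c'" for c' :: "('a, 'b) chart"
    by (simp add: smooth_on_empty smoothly_compatible_def case_prod_unfold)
  ultimately have "?c \<in> charts M" using assms unfolding smooth_manifold_def by blast
  then show ?thesis by blast
qed

lemma local_rep_apply [simp]:
  "is_chart X c \<Longrightarrow> x \<in> fst c \<Longrightarrow> local_rep c c' f (snd c x) = snd c' (f x)"
  by (simp add: local_rep_def)

section \<open>Independence of the charts\<close>

lemma Ckh_on_transition:
  assumes M: "smooth_manifold m M" and c: "c \<in> charts M" "c' \<in> charts M"
  shows "Ckh_on 1 k (snd c ` (fst c \<inter> fst c')) (snd c' \<circ> inv_into (fst c) (snd c))"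
proof (rule smooth_on_imp_Ckh_on[OF _ smooth_manifold_transition[OF M c]])
  have "openin (mtop M) (fst c \<inter> fst c')"
    using is_chart_openin[OF smooth_manifold_chart[OF M]] c by blast
  then show "open (snd c ` (fst c \<inter> fst c'))"
    by (subst is_chart_open_iff[OF smooth_manifold_chart[OF M c(1)]]) auto
qed simp

text \<open>
  In the new charts the map is the old local representation between two transition maps, which are
  smooth, hence of class \<open>C\<^sup>k\<^sup>+\<^sup>1\<close> with Lipschitz \<open>k\<close>-th derivative, so that the exponent \<open>a\<close> is kept.
\<close>

lemma Ckh_on_local_rep_change:
  fixes M :: "('a, 'm::fin_dim_inner) manifold" and N :: "('b, 'd::fin_dim_inner) manifold"
  assumes M: "smooth_manifold m M" and N: "smooth_manifold d N"
    and c: "c \<in> charts M" "c' \<in> charts M" and e: "e \<in> charts N" "e' \<in> charts N"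
    and W: "openin (mtop M) W" "W \<subseteq> fst c \<inter> fst c'" "f ` W \<subseteq> fst e \<inter> fst e'"
    and a: "0 \<le> a" "a \<le> 1"
    and f: "Ckh_on a k (snd c ` W) (local_rep c e f)"
  shows "Ckh_on a k (snd c' ` W) (local_rep c' e' f)"
proof -
  note cM = smooth_manifold_chart[OF M c(1)] smooth_manifold_chart[OF M c(2)]
  note eN = smooth_manifold_chart[OF N e(1)] smooth_manifold_chart[OF N e(2)]
  have o: "open (snd c ` W)" "open (snd c' ` W)"
    using W by (simp_all add: is_chart_open_iff[OF cM(1)] is_chart_open_iff[OF cM(2)])
  have oe: "open (snd e ` (fst e \<inter> fst e'))"
    using is_chart_openin[OF eN(1)] is_chart_openin[OF eN(2)] by (subst is_chart_open_iff[OF eN(1)]) auto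
  have tM: "Ckh_on 1 k (snd c' ` W) (snd c \<circ> inv_into (fst c') (snd c'))"
    by (rule Ckh_on_subset[OF Ckh_on_transition[OF M c(2,1)]]) (use W in auto)
  have tN: "Ckh_on 1 k (snd e ` (fst e \<inter> fst e')) (snd e' \<circ> inv_into (fst e) (snd e))"
    by (rule Ckh_on_transition[OF N e])
  have "Ckh_on (a * 1) k (snd c' ` W) (\<lambda>y. local_rep c e f ((snd c \<circ> inv_into (fst c') (snd c')) y))"
    by (rule Ckh_on_compose[OF o(2,1) _ a _ _ f tM]) (use W in \<open>auto simp: is_chart_inv[OF cM(2)] subset_iff\<close>)
  then have "Ckh_on (1 * (a * 1)) k (snd c' ` W) (\<lambda>y. (snd e' \<circ> inv_into (fst e) (snd e))
      (local_rep c e f ((snd c \<circ> inv_into (fst c') (snd c')) y)))"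
    by (rule Ckh_on_compose[OF o(2) oe _ _ _ _ _ tN, rotated -1])
       (use W a in \<open>auto simp: is_chart_inv[OF cM(2)] local_rep_apply[OF cM(1)] subset_iff\<close>)
  then have "Ckh_on a k (snd c' ` W) (\<lambda>y. (snd e' \<circ> inv_into (fst e) (snd e))
      (local_rep c e f ((snd c \<circ> inv_into (fst c') (snd c')) y)))" by simp
  then show ?thesis
    by (rule Ckh_on_cong[OF o(2)])
       (use W in \<open>auto simp: is_chart_inv[OF cM(2)] is_chart_inv[OF eN(1)] local_rep_apply[OF cM(1)]
          local_rep_apply[OF cM(2)] subset_iff\<close>)
qed

lemma C_famD:
  assumes "f \<in> C_fam (Ck_alpha_family k a) M N"
  shows "f \<in> extensional (topspace (mtop M))" "continuous_map (mtop M) (mtop N) f"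
    "\<And>c c' K. c \<in> charts M \<Longrightarrow> c' \<in> charts N \<Longrightarrow> compactin (mtop M) K \<Longrightarrow> K \<subseteq> fst c \<Longrightarrow> f ` K \<subseteq> fst c' \<Longrightarrow>
       Ck_near k (local_rep c c' f) (snd c ` K) \<and>
       fam_norm (Ck_alpha_family k a) (local_rep c c' f) (snd c ` K) < \<infinity>"
  using assms unfolding C_fam_def by (auto simp: Ck_alpha_family_def)

text \<open>
  The definition of the function space quantifies over all charts and all compact sets. One pair of
  charts around each point is enough: a change of charts gives regularity in the given charts near each
  point of the open set where the local representation is meaningful, and compactness gives the bound.
\<close>

lemma C_famI:
  fixes M :: "('a, 'm::fin_dim_inner) manifold" and N :: "('b, 'd::fin_dim_inner) manifold"
  assumes M: "smooth_manifold m M" and N: "smooth_manifold d N" and a: "0 \<le> a" "a \<le> 1"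
    and ext: "f \<in> extensional (topspace (mtop M))" and cont: "continuous_map (mtop M) (mtop N) f"
    and loc: "\<And>x. x \<in> topspace (mtop M) \<Longrightarrow> \<exists>c\<in>charts M. \<exists>e\<in>charts N. \<exists>W. openin (mtop M) W \<and> x \<in> W \<and>
       W \<subseteq> fst c \<and> f ` W \<subseteq> fst e \<and> Ckh_on a k (snd c ` W) (local_rep c e f)"
  shows "f \<in> C_fam (Ck_alpha_family k a) M N"
proof -
  have "Ck_near k (local_rep c' e' f) (snd c' ` K) \<and>
      fam_norm (Ck_alpha_family k a) (local_rep c' e' f) (snd c' ` K) < \<infinity>"
    if c': "c' \<in> charts M" and e': "e' \<in> charts N"
      and K: "compactin (mtop M) K" "K \<subseteq> fst c'" "f ` K \<subseteq> fst e'" for c' e' K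
  proof -
    note cM = smooth_manifold_chart[OF M c'] and eN = smooth_manifold_chart[OF N e']
    define O' where "O' = {x \<in> fst c'. f x \<in> fst e'}"
    have oO: "openin (mtop M) O'"
      unfolding O'_def using is_chart_openin[OF cM] is_chart_openin[OF eN]
      by (rule openin_continuous_map_preimage_gen[OF cont])
    have o: "open (snd c' ` O')"
      using oO by (subst is_chart_open_iff[OF cM]) (auto simp: O'_def)
    have reg: "Ckh_on a k (snd c' ` O') (local_rep c' e' f)"
    proof (rule Ckh_on_local)
      fix y assume "y \<in> snd c' ` O'"
      then obtain x where x: "x \<in> O'" "y = snd c' x" by blast
      then have "x \<in> topspace (mtop M)" using openin_subset[OF oO] by blast
      then obtain c e W where W: "c \<in> charts M" "e \<in> charts N" "openin (mtop M) W" "x \<in> W"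
        "W \<subseteq> fst c" "f ` W \<subseteq> fst e" "Ckh_on a k (snd c ` W) (local_rep c e f)"
        using loc[of x] by blast
      have "Ckh_on a k (snd c' ` (W \<inter> O')) (local_rep c' e' f)"
      proof (rule Ckh_on_local_rep_change[OF M N W(1) c' W(2) e' _ _ _ a])
        show "openin (mtop M) (W \<inter> O')" using W oO by blast
        show "W \<inter> O' \<subseteq> fst c \<inter> fst c'" "f ` (W \<inter> O') \<subseteq> fst e \<inter> fst e'"
          using W by (auto simp: O'_def)
        show "Ckh_on a k (snd c ` (W \<inter> O')) (local_rep c e f)"
          by (rule Ckh_on_subset[OF W(7)]) auto
      qed
      moreover have "y \<in> snd c' ` (W \<inter> O')" using x W(4) by simp
      ultimately show "\<exists>T. y \<in> T \<and> Ckh_on a k T (local_rep c' e' f)" by (intro exI conjI)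
    qed
    have KO: "snd c' ` K \<subseteq> snd c' ` O'" using K by (auto simp: O'_def)
    have "compact (snd c' ` K)" using K by (subst is_chart_compact_iff[OF cM]) auto
    then obtain b where b: "b \<ge> 0" "Ckh_bound k a b (local_rep c' e' f) (snd c' ` K)"
      using Ckh_on_compact_bound[OF o _ KO reg a] by blast
    have "fam_norm (Ck_alpha_family k a) (local_rep c' e' f) (snd c' ` K) \<le> ennreal (4 * b)"
      by (rule fam_norm_le_if_Ckh_bound[OF b(2,1)])
    then show ?thesis using Ckh_on_imp_Ck_near[OF o KO reg a(1)] by (auto intro: le_less_trans)
  qed
  then show ?thesis unfolding C_fam_def using ext cont by (auto simp: Ck_alpha_family_def)
qed

section \<open>Neighbourhoods given by families of conditions\<close>

text \<open>
  A family of conditions is encoded as a set instead of an indexed family, so that joining two families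
  is the union of sets.
\<close>

type_synonym ('a, 'm, 'b, 'd) condition = "('a, 'm) chart \<times> ('b, 'd) chart \<times> 'a set \<times> ennreal"

definition cond_nbhd ::
  "('m::real_normed_vector, 'd::real_normed_vector) seminorm_family \<Rightarrow> ('a, 'm) manifold \<Rightarrow> ('b, 'd) manifold \<Rightarrow>
    ('a \<Rightarrow> 'b) \<Rightarrow> ('a, 'm, 'b, 'd) condition set \<Rightarrow> ('a \<Rightarrow> 'b) set" where
  "cond_nbhd F M N f Q = {g \<in> C_fam F M N. \<forall>c c' K \<epsilon>. (c, c', K, \<epsilon>) \<in> Q \<longrightarrow> chart_close F c c' K \<epsilon> f g}"

definition valid_conds ::
  "('a, 'm) manifold \<Rightarrow> ('b, 'd) manifold \<Rightarrow> ('a \<Rightarrow> 'b) \<Rightarrow> ('a, 'm, 'b, 'd) condition set \<Rightarrow> bool" where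
  "valid_conds M N f Q \<longleftrightarrow> (\<forall>c c' K \<epsilon>. (c, c', K, \<epsilon>) \<in> Q \<longrightarrow> c \<in> charts M \<and> c' \<in> charts N \<and>
     compactin (mtop M) K \<and> K \<subseteq> fst c \<and> f ` K \<subseteq> fst c' \<and> 0 < \<epsilon>)"

lemma valid_condsD:
  assumes "valid_conds M N f Q" "(c, c', K, \<epsilon>) \<in> Q"
  shows "c \<in> charts M" "c' \<in> charts N" "compactin (mtop M) K" "K \<subseteq> fst c" "f ` K \<subseteq> fst c'" "0 < \<epsilon>"
  using assms(1)[unfolded valid_conds_def, rule_format, OF assms(2)] by blast+

lemma valid_conds_Un: "valid_conds M N f (P \<union> Q) \<longleftrightarrow> valid_conds M N f P \<and> valid_conds M N f Q"
  unfolding valid_conds_def Un_iff by meson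

lemma cond_nbhd_Un: "cond_nbhd F M N f (P \<union> Q) = cond_nbhd F M N f P \<inter> cond_nbhd F M N f Q"
  by (rule set_eqI) (simp add: cond_nbhd_def, meson)

lemma cond_nbhdD:
  assumes "g \<in> cond_nbhd F M N f Q"
  shows "g \<in> C_fam F M N" "\<And>c c' K \<epsilon>. (c, c', K, \<epsilon>) \<in> Q \<Longrightarrow> chart_close F c c' K \<epsilon> f g"
proof -
  note * = CollectD[OF assms[unfolded cond_nbhd_def]]
  show "g \<in> C_fam F M N" by (rule conjunct1[OF *])
  show "\<And>c c' K \<epsilon>. (c, c', K, \<epsilon>) \<in> Q \<Longrightarrow> chart_close F c c' K \<epsilon> f g"
    by (rule conjunct2[OF *, rule_format])
qed

lemma cond_nbhd_self:
  assumes "f \<in> C_fam (Ck_alpha_family k a) M N" "valid_conds M N f Q"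
  shows "f \<in> cond_nbhd (Ck_alpha_family k a) M N f Q"
  using assms unfolding cond_nbhd_def valid_conds_def chart_close_def by (auto simp: fam_norm_0)

lemma local_rep_triangle:
  fixes M :: "('a, 'm::fin_dim_inner) manifold" and N :: "('b, 'd::fin_dim_inner) manifold"
  assumes c: "c \<in> charts M" "c' \<in> charts N" and K: "compactin (mtop M) K" "K \<subseteq> fst c"
    and f: "\<And>f. f \<in> {f1, f2, f3} \<Longrightarrow> f \<in> C_fam (Ck_alpha_family k a) M N \<and> f ` K \<subseteq> fst c'"
  shows "fam_norm (Ck_alpha_family k a) (\<lambda>x. local_rep c c' f1 x - local_rep c c' f3 x) (snd c ` K) \<le>
    fam_norm (Ck_alpha_family k a) (\<lambda>x. local_rep c c' f1 x - local_rep c c' f2 x) (snd c ` K) +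
    fam_norm (Ck_alpha_family k a) (\<lambda>x. local_rep c c' f2 x - local_rep c c' f3 x) (snd c ` K)"
proof -
  have near: "\<exists>W. open W \<and> snd c ` K \<subseteq> W \<and> Ckh_on 0 k W (local_rep c c' g)" if "g \<in> {f1, f2, f3}" for g
    using C_famD(3)[of g k a M N c c' K] f[OF that] c K by (auto elim!: Ck_near_Ckh_on)
  obtain W1 W2 W3 where W: "open W1" "open W2" "open W3" "snd c ` K \<subseteq> W1" "snd c ` K \<subseteq> W2" "snd c ` K \<subseteq> W3"
    "Ckh_on 0 k W1 (local_rep c c' f1)" "Ckh_on 0 k W2 (local_rep c c' f2)" "Ckh_on 0 k W3 (local_rep c c' f3)"
    using near[of f1] near[of f2] near[of f3] by auto
  define W where "W = W1 \<inter> W2 \<inter> W3"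
  have oW: "open W" and KW: "snd c ` K \<subseteq> W" using W by (auto simp: W_def)
  have reg: "Ckh_on 0 k W (local_rep c c' f1)" "Ckh_on 0 k W (local_rep c c' f2)" "Ckh_on 0 k W (local_rep c c' f3)"
    using W by (auto intro: Ckh_on_subset simp: W_def)
  have diff: "Ckh_on 0 k W (\<lambda>x. g x - h x)" if "Ckh_on 0 k W g" "Ckh_on 0 k W h" for g h :: "'m \<Rightarrow> 'd"
    using Ckh_on_add[OF oW that(1) Ckh_on_bounded_linear[OF bounded_linear_minus[OF bounded_linear_ident] oW that(2)]] by simp
  show ?thesis
    using fam_norm_add[OF oW KW diff[OF reg(1,2)] diff[OF reg(2,3)], of a] by simp
qed

text \<open>
  Moving the centre from \<open>f\<close> to \<open>g\<close> costs the distance from \<open>f\<close> to \<open>g\<close>.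
\<close>

definition recentre where
  "recentre F f g = (\<lambda>(c, c', K, \<epsilon>). (c, c', K,
     \<epsilon> - fam_norm F (\<lambda>x. local_rep c c' f x - local_rep c c' g x) (snd c ` K)))"

lemma fst_recentre: "fst (recentre F f g q) = fst q"
  by (simp add: recentre_def case_prod_unfold)

lemma cond_nbhd_recentre:
  fixes M :: "('a, 'm::fin_dim_inner) manifold" and N :: "('b, 'd::fin_dim_inner) manifold"
  assumes f: "f \<in> C_fam (Ck_alpha_family k a) M N" and Q: "valid_conds M N f Q"
    and g: "g \<in> cond_nbhd (Ck_alpha_family k a) M N f Q"
  shows "valid_conds M N g (recentre (Ck_alpha_family k a) f g ` Q)"
    and "cond_nbhd (Ck_alpha_family k a) M N g (recentre (Ck_alpha_family k a) f g ` Q)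
      \<subseteq> cond_nbhd (Ck_alpha_family k a) M N f Q"
proof -
  let ?F = "Ck_alpha_family k a :: ('m, 'd) seminorm_family"
  show "valid_conds M N g (recentre ?F f g ` Q)"
    unfolding valid_conds_def
  proof (intro allI impI)
    fix c c' K \<epsilon>' assume "(c, c', K, \<epsilon>') \<in> recentre ?F f g ` Q"
    then obtain \<epsilon> where q: "(c, c', K, \<epsilon>) \<in> Q"
      and \<epsilon>': "\<epsilon>' = \<epsilon> - fam_norm ?F (\<lambda>x. local_rep c c' f x - local_rep c c' g x) (snd c ` K)"
      by (auto simp: recentre_def)
    show "c \<in> charts M \<and> c' \<in> charts N \<and> compactin (mtop M) K \<and> K \<subseteq> fst c \<and> g ` K \<subseteq> fst c' \<and> 0 < \<epsilon>'"
      using valid_condsD[OF Q q] cond_nbhdD(2)[OF g q]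
      by (simp add: chart_close_def \<epsilon>' diff_gt_0_iff_gt_ennreal)
  qed
  show "cond_nbhd ?F M N g (recentre ?F f g ` Q) \<subseteq> cond_nbhd ?F M N f Q"
  proof
    fix h assume h: "h \<in> cond_nbhd ?F M N g (recentre ?F f g ` Q)"
    have "chart_close ?F c c' K \<epsilon> f h" if q: "(c, c', K, \<epsilon>) \<in> Q" for c c' K \<epsilon>
    proof -
      let ?n = "\<lambda>f g. fam_norm ?F (\<lambda>x. local_rep c c' f x - local_rep c c' g x) (snd c ` K)"
      note v = valid_condsD[OF Q q]
      have gK: "g ` K \<subseteq> fst c'" and fg: "?n f g < \<epsilon>"
        using cond_nbhdD(2)[OF g q] by (auto simp: chart_close_def)
      have "(c, c', K, \<epsilon> - ?n f g) \<in> recentre ?F f g ` Q"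
        using q by (force simp: recentre_def)
      from cond_nbhdD(2)[OF h this] have hK: "h ` K \<subseteq> fst c'" and gh: "?n g h < \<epsilon> - ?n f g"
        by (auto simp: chart_close_def)
      have "?n f h \<le> ?n f g + ?n g h"
        using v f cond_nbhdD(1)[OF g] cond_nbhdD(1)[OF h] gK hK by (intro local_rep_triangle[of c M c' N]) auto
      also have "\<dots> < ?n f g + (\<epsilon> - ?n f g)"
        using gh fg by (intro ennreal_add_left_cancel_less[THEN iffD2]) (auto simp: less_top[symmetric])
      also have "\<dots> = \<epsilon>" using fg by (simp add: less_imp_le)
      finally show ?thesis using hK by (simp add: chart_close_def)
    qed
    then show "h \<in> cond_nbhd ?F M N f Q" using cond_nbhdD(1)[OF h] unfolding cond_nbhd_def by auto
  qed
qed

text \<open>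
  The common features of the weak and the strong topology; \<open>\<A>\<close> is the set of admissible families of
  conditions. Closure under maps that fix the charts of \<open>M\<close> allows compact sets to be enlarged and radii
  to be changed.
\<close>

locale whitney_space =
  fixes M :: "('a, 'm::fin_dim_inner) manifold" and N :: "('b, 'd::fin_dim_inner) manifold"
    and m d k :: nat and a :: real
    and \<A> :: "('a, 'm, 'b, 'd) condition set set" and X :: "('a \<Rightarrow> 'b) topology"
  assumes M: "smooth_manifold m M" and N: "smooth_manifold d N" and a: "0 \<le> a" "a \<le> 1"
    and family_finite: "\<And>Q. finite Q \<Longrightarrow> Q \<in> \<A>"
    and family_Un: "\<And>P Q. P \<in> \<A> \<Longrightarrow> Q \<in> \<A> \<Longrightarrow> P \<union> Q \<in> \<A>"
    and family_image: "\<And>Q h. Q \<in> \<A> \<Longrightarrow> (\<And>q. q \<in> Q \<Longrightarrow> fst (h q) = fst q) \<Longrightarrow> h ` Q \<in> \<A>"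
    and topspace_X: "topspace X = C_fam (Ck_alpha_family k a) M N"
    and openin_nbhd: "\<And>f Q. f \<in> C_fam (Ck_alpha_family k a) M N \<Longrightarrow> Q \<in> \<A> \<Longrightarrow> valid_conds M N f Q \<Longrightarrow>
      openin X (cond_nbhd (Ck_alpha_family k a) M N f Q)"
    and openin_base: "\<And>G f. openin X G \<Longrightarrow> f \<in> G \<Longrightarrow>
      \<exists>Q\<in>\<A>. valid_conds M N f Q \<and> cond_nbhd (Ck_alpha_family k a) M N f Q \<subseteq> G"
begin

abbreviation "\<F> \<equiv> Ck_alpha_family k a :: ('m, 'd) seminorm_family"
abbreviation "\<C> \<equiv> C_fam \<F> M N"
abbreviation "nbhd \<equiv> cond_nbhd \<F> M N"
abbreviation "valid \<equiv> valid_conds M N"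

lemmas chart_M = smooth_manifold_chart[OF M] and chart_N = smooth_manifold_chart[OF N]

text \<open>
  Four requirements on the family that replaces the current one at a stage of the construction.
  \<open>robust\<close> keeps the limit in the charts of \<open>N\<close> and makes the sequence Cauchy, \<open>tighter\<close> provides the
  room that is lost when only the interior of a compact set is controlled, \<open>persists\<close> keeps old
  compact sets in play, and \<open>covers\<close> enforces regularity of the limit everywhere. The factor \<open>4\<close> is the
  constant of \<open>Ckh_limit\<close>.
\<close>

definition robust :: "('a \<Rightarrow> 'b) \<Rightarrow> real \<Rightarrow> ('a, 'm, 'b, 'd) condition set \<Rightarrow> bool" where
  "robust f \<delta> Q \<longleftrightarrow> (\<forall>c c' K \<epsilon>. (c, c', K, \<epsilon>) \<in> Q \<longrightarrow> (\<exists>e. \<epsilon> = ennreal e \<and> 0 < e \<and> e \<le> \<delta> \<and>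
     (\<forall>x\<in>K. cball (snd c' (f x)) e \<subseteq> snd c' ` fst c')))"

definition tighter :: "('a, 'm, 'b, 'd) condition set \<Rightarrow> ('a, 'm, 'b, 'd) condition set \<Rightarrow> bool" where
  "tighter P Q \<longleftrightarrow> (\<forall>c c' K \<epsilon>. (c, c', K, \<epsilon>) \<in> P \<longrightarrow> (\<exists>K' e. (c, c', K', ennreal e) \<in> Q \<and> K \<subseteq> K' \<and>
     snd c ` K \<subseteq> interior (snd c ` K') \<and> 0 < e \<and> ennreal (4 * e) < \<epsilon>))"

definition persists :: "('a, 'm, 'b, 'd) condition set \<Rightarrow> ('a, 'm, 'b, 'd) condition set \<Rightarrow> bool" where
  "persists P Q \<longleftrightarrow> (\<forall>c c' K \<epsilon>. (c, c', K, \<epsilon>) \<in> P \<longrightarrow> (\<exists>\<epsilon>'. (c, c', K, \<epsilon>') \<in> Q))"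

definition covers :: "('a, 'm, 'b, 'd) condition set \<Rightarrow> 'a set \<Rightarrow> bool" where
  "covers Q L \<longleftrightarrow> (\<forall>x\<in>L. \<exists>c c' K \<epsilon>. (c, c', K, \<epsilon>) \<in> Q \<and> x \<in> K \<and> snd c x \<in> interior (snd c ` K))"

lemma ex_robust_radius:
  assumes f: "continuous_map (mtop M) (mtop N) f" and c': "c' \<in> charts N"
    and K: "compactin (mtop M) K" "f ` K \<subseteq> fst c'" and \<epsilon>: "0 < (\<epsilon>::ennreal)" and \<delta>: "0 < \<delta>"
  shows "\<exists>e. 0 < e \<and> e \<le> \<delta> \<and> ennreal (4 * e) < \<epsilon> \<and> (\<forall>x\<in>K. cball (snd c' (f x)) e \<subseteq> snd c' ` fst c')"
proof -
  have "compact (snd c' ` f ` K)"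
    using image_compactin[OF K(1) f] K(2) by (subst is_chart_compact_iff[OF chart_N[OF c']]) auto
  moreover have "open (snd c' ` fst c')"
    using is_chart_openin[OF chart_N[OF c']] by (subst is_chart_open_iff[OF chart_N[OF c']]) auto
  moreover have "snd c' ` f ` K \<subseteq> snd c' ` fst c'" using K by auto
  ultimately obtain r where r: "r > 0" "(\<Union>y\<in>snd c' ` f ` K. cball y r) \<subseteq> snd c' ` fst c'"
    by (rule compact_subset_open_imp_cball_epsilon_subset)
  obtain s where s: "s > 0" "ennreal (4 * s) < \<epsilon>"
  proof (cases \<epsilon>)
    case (real t)
    then have "t > 0" using \<epsilon> by (cases "t = 0") auto
    then show ?thesis using that[of "t / 8"] real by (simp add: ennreal_less_iff)
  next
    case top
    then show ?thesis using that[of 1] by simp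
  qed
  define e where "e = min \<delta> (min r s)"
  have "ennreal (4 * e) \<le> ennreal (4 * s)" by (rule ennreal_leI) (simp add: e_def)
  then have "ennreal (4 * e) < \<epsilon>" using s(2) by (rule le_less_trans)
  moreover have "cball (snd c' (f x)) e \<subseteq> snd c' ` fst c'" if "x \<in> K" for x
  proof -
    have "cball (snd c' (f x)) e \<subseteq> cball (snd c' (f x)) r" by (rule subset_cball) (simp add: e_def)
    also have "\<dots> \<subseteq> snd c' ` fst c'" using r(2) that by blast
    finally show ?thesis .
  qed
  ultimately show ?thesis
    using r s \<delta> by (intro exI[of _ e]) (simp add: e_def)
qed

text \<open>
  Enlarge the compact sets of \<open>P\<close>, add those of \<open>Q\<close> and finitely many that cover \<open>L\<close>, and finally choose
  all radii small enough; none of this changes the charts that occur in \<open>P\<close> and \<open>Q\<close>. Since \<open>f\<close> has to map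
  each of the sets covering \<open>L\<close> into a chart of \<open>N\<close>, these sets depend on \<open>f\<close> and cannot be fixed once
  and for all.
\<close>

lemma refine_conds:
  assumes f: "f \<in> \<C>" and P: "P \<in> \<A>" "valid f P" and Q: "Q \<in> \<A>" "valid f Q"
    and L: "compactin (mtop M) L" and \<delta>: "\<delta> > 0"
  shows "\<exists>R\<in>\<A>. valid f R \<and> tighter P R \<and> persists Q R \<and> covers R L \<and> robust f \<delta> R"
proof -
  note fcont = C_famD(2)[OF f]
  have oW: "openin (mtop M) {x \<in> fst c. f x \<in> fst c'}" if "c \<in> charts M" "c' \<in> charts N" for c c'
    using is_chart_openin[OF chart_M[OF that(1)]] is_chart_openin[OF chart_N[OF that(2)]]
    by (rule openin_continuous_map_preimage_gen[OF fcont])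
  define fat where "fat c c' K K' \<longleftrightarrow> compactin (mtop M) K' \<and> K \<subseteq> K' \<and> K' \<subseteq> fst c \<and> f ` K' \<subseteq> fst c' \<and>
      snd c ` K \<subseteq> interior (snd c ` K')" for c :: "('a, 'm) chart" and c' :: "('b, 'd) chart" and K K'
  have ex_fat: "\<exists>K'. fat c c' K K'"
    if c: "c \<in> charts M" "c' \<in> charts N" and K: "compactin (mtop M) K" "K \<subseteq> fst c" "f ` K \<subseteq> fst c'" for c c' K
  proof -
    have "K \<subseteq> {x \<in> fst c. f x \<in> fst c'}" using K by auto
    then obtain K' where "compactin (mtop M) K'" "K \<subseteq> K'" "K' \<subseteq> {x \<in> fst c. f x \<in> fst c'}"
      "snd c ` K \<subseteq> interior (snd c ` K')"
      by (rule is_chart_compact_fattening[OF chart_M[OF c(1)] K(1) _ oW[OF c]]) auto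
    then show ?thesis unfolding fat_def by (intro exI[of _ K']) auto
  qed
  define fatten where "fatten c c' K = (SOME K'. fat c c' K K')" for c c' K
  have fatten: "fat c c' K (fatten c c' K)" if "(c, c', K, \<epsilon>) \<in> P" for c c' K \<epsilon>
    unfolding fatten_def by (rule someI_ex[OF ex_fat]) (use valid_condsD[OF P(2) that] in auto)

  \<comment> \<open>finitely many conditions whose compact sets have interiors covering \<open>L\<close>\<close>
  have "\<exists>c c' K W. c \<in> charts M \<and> c' \<in> charts N \<and> fat c c' {x} K \<and> openin (mtop M) W \<and> x \<in> W \<and> W \<subseteq> K \<and>
      (\<forall>y\<in>W. snd c y \<in> interior (snd c ` K))" if x: "x \<in> L" for x
  proof -
    have xM: "x \<in> topspace (mtop M)" using x compactin_subset_topspace[OF L] by blast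
    then have "f x \<in> topspace (mtop N)" using fcont unfolding continuous_map_def by blast
    then obtain c' where c': "c' \<in> charts N" "f x \<in> fst c'" using smooth_manifold_cover[OF N] by blast
    obtain c where c: "c \<in> charts M" "x \<in> fst c" using smooth_manifold_cover[OF M xM] by blast
    obtain K where K: "fat c c' {x} K" using ex_fat[of c c' "{x}"] c c' xM by auto
    let ?W = "{y \<in> fst c. snd c y \<in> interior (snd c ` K)}"
    have "?W \<subseteq> K"
      by (rule is_chart_interior_preimage[OF chart_M[OF c(1)]]) (use K in \<open>simp add: fat_def\<close>)
    moreover have "openin (mtop M) ?W" by (rule is_chart_preimage_open[OF chart_M[OF c(1)]]) simp
    ultimately show ?thesis using c c' K
      by (intro exI[of _ c] exI[of _ c'] exI[of _ K] exI[of _ ?W]) (auto simp: fat_def)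
  qed
  then obtain cx cx' Kx Wx where cov: "\<And>x. x \<in> L \<Longrightarrow> cx x \<in> charts M \<and> cx' x \<in> charts N \<and> fat (cx x) (cx' x) {x} (Kx x) \<and>
      openin (mtop M) (Wx x) \<and> x \<in> Wx x \<and> Wx x \<subseteq> Kx x \<and> (\<forall>y\<in>Wx x. snd (cx x) y \<in> interior (snd (cx x) ` Kx x))"
    by metis
  have "\<exists>\<F>. finite \<F> \<and> \<F> \<subseteq> Wx ` L \<and> L \<subseteq> \<Union>\<F>"
    using L cov unfolding compactin_def by (metis (no_types, lifting) UN_iff imageE subsetI)
  then obtain D where D: "finite D" "D \<subseteq> L" "L \<subseteq> (\<Union>x\<in>D. Wx x)"
    by (metis finite_subset_image)

  define R' where "R' = (\<lambda>(c, c', K, \<epsilon>). (c, c', fatten c c' K, \<epsilon>)) ` P \<union> Q \<union> (\<lambda>x. (cx x, cx' x, Kx x, 1)) ` D"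
  have R'A: "R' \<in> \<A>" unfolding R'_def
    by (intro family_Un Q family_image[OF P(1)] family_finite finite_imageI D) auto
  have R'v: "valid f R'"
    unfolding R'_def valid_conds_Un
  proof (intro conjI Q)
    show "valid f ((\<lambda>(c, c', K, \<epsilon>). (c, c', fatten c c' K, \<epsilon>)) ` P)"
      unfolding valid_conds_def
    proof (intro allI impI)
      fix c c' K' \<epsilon> assume "(c, c', K', \<epsilon>) \<in> (\<lambda>(c, c', K, \<epsilon>). (c, c', fatten c c' K, \<epsilon>)) ` P"
      then obtain K where q: "(c, c', K, \<epsilon>) \<in> P" and K': "K' = fatten c c' K" by auto
      show "c \<in> charts M \<and> c' \<in> charts N \<and> compactin (mtop M) K' \<and> K' \<subseteq> fst c \<and> f ` K' \<subseteq> fst c' \<and> 0 < \<epsilon>"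
        using fatten[OF q] valid_condsD[OF P(2) q] by (simp add: K' fat_def)
    qed
    show "valid f ((\<lambda>x. (cx x, cx' x, Kx x, 1)) ` D)"
      unfolding valid_conds_def
    proof (intro allI impI)
      fix c c' K \<epsilon> assume "(c, c', K, \<epsilon>) \<in> (\<lambda>x. (cx x, cx' x, Kx x, 1 :: ennreal)) ` D"
      then obtain x where x: "x \<in> D" "c = cx x" "c' = cx' x" "K = Kx x" "\<epsilon> = 1" by auto
      have xL: "x \<in> L" using x D(2) by blast
      have "0 < \<epsilon>" using x(5) by simp
      then show "c \<in> charts M \<and> c' \<in> charts N \<and> compactin (mtop M) K \<and> K \<subseteq> fst c \<and> f ` K \<subseteq> fst c' \<and> 0 < \<epsilon>"
        using cov[OF xL] unfolding fat_def x(2-4) by blast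
    qed
  qed
  define good where "good c' K \<epsilon> e \<longleftrightarrow> 0 < e \<and> e \<le> \<delta> \<and> ennreal (4 * e) < \<epsilon> \<and> (\<forall>x\<in>K. cball (snd c' (f x)) e \<subseteq> snd c' ` fst c')"
    for c' :: "('b, 'd) chart" and K \<epsilon> e
  define rad where "rad c' K \<epsilon> = (SOME e. good c' K \<epsilon> e)" for c' K \<epsilon>
  have rad: "good c' K \<epsilon> (rad c' K \<epsilon>)" if "(c, c', K, \<epsilon>) \<in> R'" for c c' K \<epsilon>
  proof -
    note v = valid_condsD[OF R'v that]
    have "\<exists>e. good c' K \<epsilon> e"
      unfolding good_def by (rule ex_robust_radius[OF fcont v(2,3,5,6) \<delta>])
    then show ?thesis unfolding rad_def by (rule someI_ex)
  qed
  define R where "R = (\<lambda>(c, c', K, \<epsilon>). (c, c', K, ennreal (rad c' K \<epsilon>))) ` R'"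
  have R_mem: "(c, c', K, ennreal (rad c' K \<epsilon>)) \<in> R" if "(c, c', K, \<epsilon>) \<in> R'" for c c' K \<epsilon>
    using that unfolding R_def by force
  have RE: "\<exists>\<epsilon>'. (c, c', K, \<epsilon>') \<in> R' \<and> \<epsilon> = ennreal (rad c' K \<epsilon>')" if "(c, c', K, \<epsilon>) \<in> R" for c c' K \<epsilon>
    using that unfolding R_def by auto
  have "R \<in> \<A>" unfolding R_def by (rule family_image[OF R'A]) auto
  moreover have "valid f R"
    unfolding valid_conds_def
  proof (intro allI impI)
    fix c c' K \<epsilon> assume "(c, c', K, \<epsilon>) \<in> R"
    from RE[OF this] obtain \<epsilon>' where q: "(c, c', K, \<epsilon>') \<in> R'" and \<epsilon>: "\<epsilon> = ennreal (rad c' K \<epsilon>')" by blast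
    show "c \<in> charts M \<and> c' \<in> charts N \<and> compactin (mtop M) K \<and> K \<subseteq> fst c \<and> f ` K \<subseteq> fst c' \<and> 0 < \<epsilon>"
      using valid_condsD[OF R'v q] rad[OF q] by (simp add: \<epsilon> good_def)
  qed
  moreover have "tighter P R"
    unfolding tighter_def
  proof (intro allI impI)
    fix c c' K \<epsilon> assume q: "(c, c', K, \<epsilon>) \<in> P"
    have q': "(c, c', fatten c c' K, \<epsilon>) \<in> R'" using q unfolding R'_def by force
    show "\<exists>K' e. (c, c', K', ennreal e) \<in> R \<and> K \<subseteq> K' \<and> snd c ` K \<subseteq> interior (snd c ` K') \<and> 0 < e \<and> ennreal (4 * e) < \<epsilon>"
      using R_mem[OF q'] fatten[OF q] rad[OF q'] unfolding good_def fat_def by blast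
  qed
  moreover have "persists Q R" using R_mem unfolding persists_def R'_def by blast
  moreover have "covers R L"
    unfolding covers_def
  proof
    fix x assume "x \<in> L"
    then obtain z where z: "z \<in> D" "x \<in> Wx z" using D by blast
    have "(cx z, cx' z, Kx z, 1) \<in> R'" using z unfolding R'_def by blast
    moreover have "x \<in> Kx z" "snd (cx z) x \<in> interior (snd (cx z) ` Kx z)" using cov[of z] z D by blast+
    ultimately show "\<exists>c c' K \<epsilon>. (c, c', K, \<epsilon>) \<in> R \<and> x \<in> K \<and> snd c x \<in> interior (snd c ` K)"
      using R_mem by blast
  qed
  moreover have "robust f \<delta> R"
    unfolding robust_def using RE rad unfolding good_def by blast
  ultimately show ?thesis by blast
qed

lemma tighter_nbhd:
  assumes "tighter P Q" shows "nbhd f Q \<subseteq> nbhd f P"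
proof
  fix g assume g: "g \<in> nbhd f Q"
  have "chart_close \<F> c c' K \<epsilon> f g" if q: "(c, c', K, \<epsilon>) \<in> P" for c c' K \<epsilon>
  proof -
    obtain K' e where K': "(c, c', K', ennreal e) \<in> Q" "K \<subseteq> K'" "0 < e" "ennreal (4 * e) < \<epsilon>"
      using assms q unfolding tighter_def by blast
    have "fam_norm \<F> (\<lambda>x. local_rep c c' f x - local_rep c c' g x) (snd c ` K)
        \<le> fam_norm \<F> (\<lambda>x. local_rep c c' f x - local_rep c c' g x) (snd c ` K')"
      using K' by (intro fam_norm_mono) auto
    also have "\<dots> \<le> ennreal e" using cond_nbhdD(2)[OF g K'(1)] by (simp add: chart_close_def less_imp_le)
    also have "\<dots> \<le> ennreal (4 * e)" using K' by (intro ennreal_leI) simp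
    finally show ?thesis using K' cond_nbhdD(2)[OF g K'(1)] by (auto simp: chart_close_def)
  qed
  then show "g \<in> nbhd f P" using cond_nbhdD(1)[OF g] unfolding cond_nbhd_def by blast
qed

section \<open>The Baire property\<close>

text \<open>
  The completeness part of the argument. Charts and compact set of every condition ever imposed
  recur at each later stage \<open>i\<close> with radius at most \<open>2\<^sup>-\<^sup>i\<close>, and all later \<open>f\<^sub>l\<close> satisfy the condition, so \<open>f\<^sub>i\<close> and \<open>f\<^sub>l\<close> are \<open>2\<^sup>-\<^sup>i\<close>-close there. The limit
  is formed pointwise in \<open>N\<close>; since \<open>N\<close> is Hausdorff it does not depend on the charts in which the
  convergence is observed.
\<close>

lemma limit_of_nested:
  assumes f: "\<And>n. f n \<in> \<C>" and valid: "\<And>n. valid (f n) (Q n)"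
    and nested: "\<And>n. nbhd (f (Suc n)) (Q (Suc n)) \<subseteq> nbhd (f n) (Q n)"
    and persist: "\<And>n. persists (Q n) (Q (Suc n))"
    and cover: "\<And>n. covers (Q n) (L n)" "topspace (mtop M) \<subseteq> (\<Union>n. L n)"
    and robust: "\<And>n. robust (f n) ((1/2) ^ n) (Q n)"
  shows "\<exists>g\<in>\<C>. \<forall>n c c' K e. (c, c', K, ennreal e) \<in> Q n \<longrightarrow> 0 < e \<longrightarrow> g ` K \<subseteq> fst c' \<and>
    fam_norm \<F> (\<lambda>x. local_rep c c' (f n) x - local_rep c c' g x) (interior (snd c ` K)) \<le> ennreal (4 * e)"
proof -
  have mem: "f l \<in> nbhd (f n) (Q n)" if "n \<le> l" for n l
    using that cond_nbhd_self[OF f valid, of l] lift_Suc_antimono_le[of "\<lambda>n. nbhd (f n) (Q n)", OF nested] by blast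
  have persist': "\<exists>\<epsilon>'. (c, c', K, \<epsilon>') \<in> Q l" if "n \<le> l" "(c, c', K, \<epsilon>) \<in> Q n" for n l c c' K \<epsilon>
    using that
  proof (induction l rule: dec_induct)
    case (step l)
    then show ?case using persist[of l] unfolding persists_def by blast
  qed blast
  have radius: "\<exists>e. \<epsilon> = ennreal e \<and> 0 < e \<and> e \<le> (1/2) ^ n \<and> (\<forall>x\<in>K. cball (snd c' (f n x)) e \<subseteq> snd c' ` fst c')"
    if "(c, c', K, \<epsilon>) \<in> Q n" for c c' K \<epsilon> n
    using robust[of n] that unfolding robust_def by blast
  have close: "f l ` K \<subseteq> fst c' \<and>
      fam_norm \<F> (\<lambda>x. local_rep c c' (f n) x - local_rep c c' (f l) x) (snd c ` K) \<le> \<epsilon>"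
    if "(c, c', K, \<epsilon>) \<in> Q n" "n \<le> l" for c c' K \<epsilon> n l
    using cond_nbhdD(2)[OF mem[OF that(2)] that(1)] by (simp add: chart_close_def less_imp_le)
  have cauchy: "fam_norm \<F> (\<lambda>x. local_rep c c' (f i) x - local_rep c c' (f l) x) (snd c ` K) \<le> ennreal ((1/2) ^ i)"
    if q: "(c, c', K, \<epsilon>) \<in> Q n" and il: "n \<le> i" "i \<le> l" for c c' K \<epsilon> n i l
  proof -
    obtain \<epsilon>' where q': "(c, c', K, \<epsilon>') \<in> Q i" using persist'[OF il(1) q] by blast
    then have "\<epsilon>' \<le> ennreal ((1/2) ^ i)" using radius[OF q'] by (auto intro: ennreal_leI)
    then show ?thesis using close[OF q' il(2)] by (auto intro: order_trans)
  qed
  have pointwise: "norm (local_rep c c' (f i) y - local_rep c c' (f l) y) \<le> r"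
    if "fam_norm \<F> (\<lambda>x. local_rep c c' (f i) x - local_rep c c' (f l) x) A \<le> ennreal r" "y \<in> A" "0 \<le> r"
    for c :: "('a, 'm) chart" and c' :: "('b, 'd) chart" and A i l y r
    using Ckh_bound_if_fam_norm_le[OF that(1,3)] that(2)
    unfolding Ckh_bound_def by (auto dest!: bspec spec[of _ "[]"])

  have lim: "\<exists>p\<in>fst c'. limitin (mtop N) (\<lambda>i. f i x) p sequentially \<and> (\<lambda>i. snd c' (f i x)) \<longlonglongrightarrow> snd c' p"
    if q: "(c, c', K, \<epsilon>) \<in> Q n" and x: "x \<in> K" for c c' K \<epsilon> n x
  proof -
    note v = valid_condsD[OF valid q]
    have xU: "x \<in> fst c" using v x by blast
    have rep: "local_rep c c' (f i) (snd c x) = snd c' (f i x)" for i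
      by (rule local_rep_apply[OF chart_M[OF v(1)] xU])
    obtain e where e: "\<epsilon> = ennreal e" "0 < e" "cball (snd c' (f n x)) e \<subseteq> snd c' ` fst c'"
      using radius[OF q] x by blast
    have "Cauchy (\<lambda>i. snd c' (f i x))"
    proof (rule metric_CauchyI)
      fix r :: real assume "r > 0"
      then obtain i0 where i0: "(1/2) ^ i0 < r" using real_arch_pow_inv[of r "1/2"] by auto
      define j where "j = max n i0"
      have j: "2 * (1/2) ^ (Suc j) < r"
      proof -
        have "(1/2) ^ j \<le> (1/2 :: real) ^ i0" by (rule power_decreasing) (auto simp: j_def)
        from le_less_trans[OF this i0] show ?thesis by simp
      qed
      have "dist (snd c' (f i x)) (snd c' (f (Suc j) x)) \<le> (1/2) ^ (Suc j)" if "i \<ge> Suc j" for i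
        using pointwise[OF cauchy[OF q _ that], of "snd c x"] x
        by (simp add: rep dist_norm norm_minus_commute j_def)
      then have "dist (snd c' (f i x)) (snd c' (f l x)) < r" if "i \<ge> Suc j" "l \<ge> Suc j" for i l
        using that j dist_triangle2[of "snd c' (f i x)" "snd c' (f l x)" "snd c' (f (Suc j) x)"]
        by (smt (verit, best))
      then show "\<exists>j. \<forall>i\<ge>j. \<forall>l\<ge>j. dist (snd c' (f i x)) (snd c' (f l x)) < r" by blast
    qed
    then obtain y where y: "(\<lambda>i. snd c' (f i x)) \<longlonglongrightarrow> y" by (auto simp: Cauchy_convergent_iff convergent_def)
    have "\<forall>\<^sub>F i in sequentially. snd c' (f i x) \<in> cball (snd c' (f n x)) e"
      using eventually_ge_at_top[of n]
    proof eventually_elim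
      case (elim i)
      show ?case
        using pointwise[of c c' n i "snd c ` K" e "snd c x"] close[OF q elim] x e by (simp add: rep dist_norm)
    qed
    \<comment> \<open>the closed ball lies in the chart, so the limit in coordinates is a point of \<open>N\<close>\<close>
    then have "y \<in> cball (snd c' (f n x)) e"
      by (rule Lim_in_closed_set[OF closed_cball _ _ y]) simp
    then obtain p where p: "p \<in> fst c'" "y = snd c' p" using e by blast
    have "\<forall>\<^sub>F i in sequentially. f i x \<in> fst c'"
      using eventually_ge_at_top[of n]
    proof eventually_elim
      case (elim i)
      show ?case using close[OF q elim] x by blast
    qed
    then have "limitin (mtop N) (\<lambda>i. f i x) p sequentially"
      by (rule is_chart_limitin[OF chart_N[OF v(2)] p(1)]) (use y p in simp)
    then show ?thesis using p y by blast
  qed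

  define g where "g = restrict (\<lambda>x. THE p. limitin (mtop N) (\<lambda>i. f i x) p sequentially) (topspace (mtop M))"
  have g: "g x \<in> fst c' \<and> (\<lambda>i. local_rep c c' (f i) (snd c x)) \<longlonglongrightarrow> local_rep c c' g (snd c x)"
    if q: "(c, c', K, \<epsilon>) \<in> Q n" and x: "x \<in> K" for c c' K \<epsilon> n x
  proof -
    note v = valid_condsD[OF valid q]
    obtain p where p: "p \<in> fst c'" "limitin (mtop N) (\<lambda>i. f i x) p sequentially" "(\<lambda>i. snd c' (f i x)) \<longlonglongrightarrow> snd c' p"
      using lim[OF q x] by blast
    have "(THE p. limitin (mtop N) (\<lambda>i. f i x) p sequentially) = p"
    proof (rule the_equality)
      show "limitin (mtop N) (\<lambda>i. f i x) p sequentially" by (rule p(2))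
      show "p' = p" if "limitin (mtop N) (\<lambda>i. f i x) p' sequentially" for p'
        by (rule limitin_Hausdorff_unique[OF that p(2) _ smooth_manifold_Hausdorff[OF N]]) simp
    qed
    then have "g x = p" using x compactin_subset_topspace[OF v(3)] by (auto simp: g_def)
    moreover have "x \<in> fst c" using v x by blast
    ultimately show ?thesis using p by (simp add: local_rep_apply[OF chart_M[OF v(1)]])
  qed

  have limit: "Ckh_on a k (interior (snd c ` K)) (local_rep c c' g) \<and>
      fam_norm \<F> (\<lambda>x. local_rep c c' (f n) x - local_rep c c' g x) (interior (snd c ` K)) \<le> ennreal (4 * e)"
    if q: "(c, c', K, ennreal e) \<in> Q n" and e: "0 < e" for c c' K e n
  proof -
    note v = valid_condsD[OF valid q]
    \<comment> \<open>the first radius is that of the condition itself; it bounds the distance from \<open>f\<^sub>n\<close> to the limit\<close>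
    let ?u = "\<lambda>i. local_rep c c' (f (n + i))"
    let ?e = "\<lambda>i. if i = 0 then e else (1/2) ^ (n + i) :: real"
    have fK: "f (n + i) ` K \<subseteq> fst c'" for i using close[OF q, of "n + i"] by simp
    have reg: "Ck_near k (?u i) (snd c ` K)" "fam_norm \<F> (?u i) (snd c ` K) < \<infinity>" for i
      using C_famD(3)[OF f v(1-4) fK] by auto
    have e0: "0 \<le> ?e i" for i using e by simp
    have "(\<lambda>i. (1/2) ^ (n + i) :: real) \<longlonglongrightarrow> 0"
      using LIMSEQ_ignore_initial_segment[OF LIMSEQ_power_zero[of "1/2::real"], of n] by (simp add: add.commute)
    then have elim0: "?e \<longlonglongrightarrow> 0"
      by (rule Lim_transform_eventually) (use eventually_gt_at_top[of 0] in eventually_elim, simp)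
    have cl: "fam_norm \<F> (\<lambda>x. ?u i x - ?u l x) (snd c ` K) \<le> ennreal (?e i)" if "i \<le> l" for i l
    proof (cases "i = 0")
      case True
      then show ?thesis using close[OF q, of "n + l"] by simp
    next
      case False
      then show ?thesis using cauchy[OF q, of "n + i" "n + l"] that by simp
    qed
    have pl: "(\<lambda>i. ?u i y) \<longlonglongrightarrow> local_rep c c' g y" if y: "y \<in> interior (snd c ` K)" for y
    proof -
      obtain x where "x \<in> K" "y = snd c x" using y interior_subset by blast
      then show ?thesis using LIMSEQ_ignore_initial_segment[of "\<lambda>i. local_rep c c' (f i) y" _ n] g[OF q, of x]
        by (simp add: add.commute)
    qed
    note * = Ckh_limit[OF a(1) open_interior interior_subset reg(1) reg(2)[of 0] e0 elim0 cl pl]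
    show ?thesis using *(1) *(2)[of 0] by simp
  qed

  have W: "\<exists>c\<in>charts M. \<exists>c'\<in>charts N. \<exists>W. openin (mtop M) W \<and> x \<in> W \<and> W \<subseteq> fst c \<and> g ` W \<subseteq> fst c' \<and>
      Ckh_on a k (snd c ` W) (local_rep c c' g)" if x: "x \<in> topspace (mtop M)" for x
  proof -
    obtain n where "x \<in> L n" using cover(2) x by blast
    then obtain c c' K \<epsilon> where q: "(c, c', K, \<epsilon>) \<in> Q n" and xK: "x \<in> K" "snd c x \<in> interior (snd c ` K)"
      using cover(1)[of n] unfolding covers_def by blast
    note v = valid_condsD[OF valid q]
    obtain e where e: "\<epsilon> = ennreal e" "0 < e" using radius[OF q] by blast
    define W where "W = {y \<in> fst c. snd c y \<in> interior (snd c ` K)}"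
    have oW: "openin (mtop M) W" unfolding W_def by (rule is_chart_preimage_open[OF chart_M[OF v(1)]]) simp
    have "W \<subseteq> K" unfolding W_def by (rule is_chart_interior_preimage[OF chart_M[OF v(1)] v(4)])
    then have gW: "g ` W \<subseteq> fst c'" using g[OF q] by blast
    have "Ckh_on a k (snd c ` W) (local_rep c c' g)"
      using limit[OF q[unfolded e(1)] e(2)] by (auto intro: Ckh_on_subset simp: W_def)
    moreover have "x \<in> W" "W \<subseteq> fst c" using xK v(4) by (auto simp: W_def)
    ultimately show ?thesis using v oW gW by blast
  qed

  have "continuous_map (mtop M) (mtop N) g"
    unfolding continuous_map_eq_topcontinuous_at topcontinuous_at_def
  proof (intro ballI conjI allI impI)
    show "g \<in> topspace (mtop M) \<rightarrow> topspace (mtop N)"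
    proof
      fix x assume "x \<in> topspace (mtop M)"
      then obtain c' where "c' \<in> charts N" "g x \<in> fst c'" using W[of x] by blast
      then show "g x \<in> topspace (mtop N)" using openin_subset[OF is_chart_openin[OF chart_N]] by blast
    qed
    fix x V assume x: "x \<in> topspace (mtop M)" and V: "openin (mtop N) V \<and> g x \<in> V"
    obtain c c' W where c: "c \<in> charts M" "c' \<in> charts N" and W: "openin (mtop M) W" "x \<in> W" "W \<subseteq> fst c" "g ` W \<subseteq> fst c'"
      "Ckh_on a k (snd c ` W) (local_rep c c' g)"
      using W[OF x] by blast
    note cM = chart_M[OF c(1)] and cN = chart_N[OF c(2)]
    have cont: "isCont (local_rep c c' g) (snd c x)" using W by (intro Ckh_on_isCont) auto
    have opn: "open (snd c' ` (V \<inter> fst c'))"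
      using V is_chart_openin[OF cN] by (subst is_chart_open_iff[OF cN]) auto
    have val: "local_rep c c' g (snd c x) \<in> snd c' ` (V \<inter> fst c')"
    proof -
      have "x \<in> fst c" using W by blast
      then have "local_rep c c' g (snd c x) = snd c' (g x)" by (rule local_rep_apply[OF cM])
      then show ?thesis using W V by blast
    qed
    have "\<exists>T. open T \<and> snd c x \<in> T \<and> (\<forall>y\<in>T. local_rep c c' g y \<in> snd c' ` (V \<inter> fst c'))"
      by (rule continuous_at_open[THEN iffD1, rule_format, OF cont conjI[OF opn val]])
    then obtain T where T: "open T" "snd c x \<in> T" "\<And>y. y \<in> T \<Longrightarrow> local_rep c c' g y \<in> snd c' ` (V \<inter> fst c')"
      by (elim exE conjE) (rule that, assumption+, erule bspec)
    let ?O = "W \<inter> {y \<in> fst c. snd c y \<in> T}"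
    have "g y \<in> V" if y: "y \<in> ?O" for y
    proof -
      have "y \<in> fst c" using y W by blast
      then have "snd c' (g y) \<in> snd c' ` (V \<inter> fst c')" using T(3)[of "snd c y"] y by (simp add: local_rep_apply[OF cM])
      then obtain z where z: "z \<in> V" "z \<in> fst c'" "snd c' (g y) = snd c' z" by auto
      then have "g y = z" using y W by (intro inj_onD[OF is_chart_inj[OF cN]]) auto
      then show ?thesis using z by simp
    qed
    moreover have "openin (mtop M) ?O" using W is_chart_preimage_open[OF cM T(1)] by blast
    ultimately show "\<exists>U. openin (mtop M) U \<and> x \<in> U \<and> (\<forall>y\<in>U. g y \<in> V)"
      using W T by (intro exI[of _ ?O]) auto
  qed
  then have "g \<in> \<C>"
    by (intro C_famI[OF M N a] W) (simp add: g_def)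
  moreover have "g ` K \<subseteq> fst c'" if "(c, c', K, \<epsilon>) \<in> Q n" for c c' K \<epsilon> n
    using g[OF that] by blast
  ultimately show ?thesis using limit by blast
qed

text \<open>
  Second countability enters here. Countably many compact sets are needed because only finitely many
  conditions can be added at each of countably many stages.
\<close>

lemma compact_exhaustion:
  "\<exists>L :: nat \<Rightarrow> 'a set. (\<forall>n. compactin (mtop M) (L n)) \<and> topspace (mtop M) \<subseteq> (\<Union>n. L n)"
proof -
  have "\<exists>W K. openin (mtop M) W \<and> x \<in> W \<and> W \<subseteq> K \<and> compactin (mtop M) K" if x: "x \<in> topspace (mtop M)" for x
  proof -
    obtain c where c: "c \<in> charts M" "x \<in> fst c" using smooth_manifold_cover[OF M x] by blast
    note cM = chart_M[OF c(1)]
    obtain K where K: "compactin (mtop M) K" "K \<subseteq> fst c" "snd c ` {x} \<subseteq> interior (snd c ` K)"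
      by (rule is_chart_compact_fattening[OF cM, of "{x}" "fst c"]) (use c x is_chart_openin[OF cM] in auto)
    let ?W = "{y \<in> fst c. snd c y \<in> interior (snd c ` K)}"
    have "?W \<subseteq> K" by (rule is_chart_interior_preimage[OF cM K(2)])
    moreover have "openin (mtop M) ?W" by (rule is_chart_preimage_open[OF cM]) simp
    ultimately show ?thesis using K c by (intro exI[of _ ?W] exI[of _ K]) auto
  qed
  then obtain W K where W: "\<And>x. x \<in> topspace (mtop M) \<Longrightarrow>
      openin (mtop M) (W x) \<and> x \<in> W x \<and> W x \<subseteq> K x \<and> compactin (mtop M) (K x)" by metis
  have cover: "\<Union>(W ` topspace (mtop M)) = topspace (mtop M)"
    using W openin_subset by blast
  have openW: "openin (mtop M) V" if "V \<in> W ` topspace (mtop M)" for V using W that by blast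
  have "Lindelof_space (mtop M)"
    by (rule second_countable_imp_Lindelof_space[OF smooth_manifold_second_countable[OF M]])
  then have "\<exists>\<V>. countable \<V> \<and> \<V> \<subseteq> W ` topspace (mtop M) \<and> \<Union>\<V> = topspace (mtop M)"
    using openW cover by (rule Lindelof_spaceD)
  then
  obtain \<V> where \<V>: "countable \<V>" "\<V> \<subseteq> W ` topspace (mtop M)" "\<Union>\<V> = topspace (mtop M)"
    by (elim exE conjE)
  have "\<exists>K. compactin (mtop M) K \<and> V \<subseteq> K" if V: "V \<in> insert {} \<V>" for V
  proof (cases "V = {}")
    case True
    then show ?thesis by (intro exI[of _ "{}"]) simp
  next
    case False
    then obtain x where "x \<in> topspace (mtop M)" "V = W x" using V \<V>(2) by blast
    then show ?thesis using W[of x] by (intro exI[of _ "K x"]) simp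
  qed
  then obtain K' where K': "\<And>V. V \<in> insert {} \<V> \<Longrightarrow> compactin (mtop M) (K' V) \<and> V \<subseteq> K' V" by metis
  have r: "range (from_nat_into (insert {} \<V>)) = insert {} \<V>"
    using \<V>(1) by (intro range_from_nat_into) auto
  show ?thesis
  proof (intro exI[of _ "\<lambda>n. K' (from_nat_into (insert {} \<V>) n)"] conjI allI)
    show "compactin (mtop M) (K' (from_nat_into (insert {} \<V>) n))" for n
      using K' from_nat_into[of "insert {} \<V>" n] by blast
    show "topspace (mtop M) \<subseteq> (\<Union>n. K' (from_nat_into (insert {} \<V>) n))"
    proof
      fix x assume "x \<in> topspace (mtop M)"
      then obtain V where V: "V \<in> insert {} \<V>" "x \<in> V" using \<V> by blast
      then obtain n where "V = from_nat_into (insert {} \<V>) n" using r by blast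
      then show "x \<in> (\<Union>n. K' (from_nat_into (insert {} \<V>) n))" using V K'[OF V(1)] by blast
    qed
  qed
qed

text \<open>
  The states of the construction are triples \<open>(f, P, Q)\<close>. The family \<open>P\<close> describes a neighbourhood of \<open>f\<close>
  inside the previous neighbourhood and the previous open set, and \<open>Q\<close> is the refinement of \<open>P\<close> from
  which the next map is chosen. The limit satisfies the conditions of \<open>Q\<close> up to constants and on
  interiors, hence those of \<open>P\<close> exactly.
\<close>

lemma dense_openin_sequence_meets:
  fixes G :: "nat \<Rightarrow> ('a \<Rightarrow> 'b) set"
  assumes G: "\<And>n. openin X (G n)" "\<And>n. X closure_of (G n) = topspace X"
    and U: "openin X U" "U \<noteq> {}"
  shows "\<exists>g. g \<in> U \<and> (\<forall>n. g \<in> G n)"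
proof -
  obtain L :: "nat \<Rightarrow> 'a set" where L: "\<And>n. compactin (mtop M) (L n)" "topspace (mtop M) \<subseteq> (\<Union>n. L n)"
    using compact_exhaustion by blast
  define inv where "inv n s \<longleftrightarrow> (case s of (f, P, Q) \<Rightarrow> f \<in> \<C> \<and> P \<in> \<A> \<and> valid f P \<and> Q \<in> \<A> \<and> valid f Q \<and>
      tighter P Q \<and> covers Q (L n) \<and> robust f ((1/2) ^ n) Q)"
    for n and s :: "('a \<Rightarrow> 'b) \<times> ('a, 'm, 'b, 'd) condition set \<times> ('a, 'm, 'b, 'd) condition set"
  define step where "step n s s' \<longleftrightarrow> (case (s, s') of ((f, P, Q), (f', P', Q')) \<Rightarrow>
      nbhd f' P' \<subseteq> nbhd f Q \<inter> G n \<and> persists Q Q')"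
    for n and s s' :: "('a \<Rightarrow> 'b) \<times> ('a, 'm, 'b, 'd) condition set \<times> ('a, 'm, 'b, 'd) condition set"
  obtain f0 where f0: "f0 \<in> U" using U by blast
  obtain P0 where P0: "P0 \<in> \<A>" "valid f0 P0" "nbhd f0 P0 \<subseteq> U" using openin_base[OF U(1) f0] by blast
  have f0C: "f0 \<in> \<C>" using f0 openin_subset[OF U(1)] topspace_X by blast
  have "{} \<in> \<A>" "valid f0 {}" by (auto simp: family_finite valid_conds_def)
  then obtain Q0 where "Q0 \<in> \<A>" "valid f0 Q0" "tighter P0 Q0" "covers Q0 (L 0)" "robust f0 ((1/2) ^ 0) Q0"
    using refine_conds[OF f0C P0(1,2) _ _ L(1)[of 0], of "{}" "(1/2) ^ 0"] by (auto simp del: power_0)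
  then have start: "inv 0 (f0, P0, Q0)" using P0 f0C by (simp add: inv_def)
  have next_step: "\<exists>s'. inv (Suc n) s' \<and> step n s s'" if "inv n s" for n s
  proof -
    obtain f P Q where s: "s = (f, P, Q)" by (cases s) auto
    have f: "f \<in> \<C>" "Q \<in> \<A>" "valid f Q" using that by (auto simp: inv_def s)
    have o: "openin X (nbhd f Q)" by (rule openin_nbhd[OF f])
    have "f \<in> nbhd f Q" by (rule cond_nbhd_self[OF f(1,3)])
    moreover have "f \<in> X closure_of (G n)" using G(2) f(1) topspace_X by simp
    ultimately obtain f' where f': "f' \<in> nbhd f Q" "f' \<in> G n" using o unfolding in_closure_of by blast
    have "openin X (nbhd f Q \<inter> G n)" using o G by blast
    then obtain P' where P': "P' \<in> \<A>" "valid f' P'" "nbhd f' P' \<subseteq> nbhd f Q \<inter> G n"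
      using openin_base[of "nbhd f Q \<inter> G n" f'] f' by blast
    have f'C: "f' \<in> \<C>" by (rule cond_nbhdD(1)[OF f'(1)])
    have "valid f' Q"
      unfolding valid_conds_def
    proof (intro allI impI)
      fix c c' K \<epsilon> assume q: "(c, c', K, \<epsilon>) \<in> Q"
      show "c \<in> charts M \<and> c' \<in> charts N \<and> compactin (mtop M) K \<and> K \<subseteq> fst c \<and> f' ` K \<subseteq> fst c' \<and> 0 < \<epsilon>"
        using valid_condsD[OF f(3) q] cond_nbhdD(2)[OF f'(1) q] by (simp add: chart_close_def)
    qed
    then obtain Q' where "Q' \<in> \<A>" "valid f' Q'" "tighter P' Q'" "persists Q Q'" "covers Q' (L (Suc n))" "robust f' ((1/2) ^ Suc n) Q'"
      using refine_conds[OF f'C P'(1,2) f(2) _ L(1)[of "Suc n"], of "(1/2) ^ Suc n"] by (auto simp del: power_Suc)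
    then show ?thesis using P' f'C by (intro exI[of _ "(f', P', Q')"]) (simp add: inv_def step_def s del: power_Suc)
  qed
  \<comment> \<open>the invariant alone would allow the sequence to start outside \<open>U\<close>\<close>
  define inv_from_U where "inv_from_U n s \<longleftrightarrow> inv n s \<and> (n = 0 \<longrightarrow> s = (f0, P0, Q0))" for n s
  have "\<exists>s. \<forall>n. inv_from_U n (s n) \<and> step n (s n) (s (Suc n))"
    by (rule dependent_nat_choice) (use start next_step in \<open>auto simp: inv_from_U_def\<close>)
  then obtain s where s: "\<And>n. inv_from_U n (s n)" "\<And>n. step n (s n) (s (Suc n))" by blast
  define f P Q where "f n = fst (s n)" and "P n = fst (snd (s n))" and "Q n = snd (snd (s n))" for n
  have s_eq: "s n = (f n, P n, Q n)" for n by (simp add: f_def P_def Q_def)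
  have inv: "f n \<in> \<C>" "valid (f n) (P n)" "valid (f n) (Q n)" "tighter (P n) (Q n)" "covers (Q n) (L n)"
    "robust (f n) ((1/2) ^ n) (Q n)" for n
    using s(1)[of n] by (auto simp: inv_from_U_def inv_def s_eq)
  have step: "nbhd (f (Suc n)) (P (Suc n)) \<subseteq> nbhd (f n) (Q n) \<inter> G n" "persists (Q n) (Q (Suc n))" for n
    using s(2)[of n] by (auto simp: step_def s_eq)
  have zero: "f 0 = f0" "P 0 = P0" using s(1)[of 0] by (auto simp: inv_from_U_def s_eq)
  have nested: "nbhd (f (Suc n)) (Q (Suc n)) \<subseteq> nbhd (f n) (Q n)" for n
    using tighter_nbhd[OF inv(4)[of "Suc n"], of "f (Suc n)"] step(1)[of n] by blast
  obtain g where g: "g \<in> \<C>" and glim: "\<And>n c c' K e. (c, c', K, ennreal e) \<in> Q n \<Longrightarrow> 0 < e \<Longrightarrow> g ` K \<subseteq> fst c' \<and>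
      fam_norm \<F> (\<lambda>x. local_rep c c' (f n) x - local_rep c c' g x) (interior (snd c ` K)) \<le> ennreal (4 * e)"
    using limit_of_nested[OF inv(1,3) nested step(2) inv(5) L(2) inv(6)] by blast
  have gP: "g \<in> nbhd (f n) (P n)" for n
  proof -
    have "chart_close \<F> c c' K \<epsilon> (f n) g" if q: "(c, c', K, \<epsilon>) \<in> P n" for c c' K \<epsilon>
    proof -
      obtain K' e where K': "(c, c', K', ennreal e) \<in> Q n" "K \<subseteq> K'" "snd c ` K \<subseteq> interior (snd c ` K')"
        "0 < e" "ennreal (4 * e) < \<epsilon>"
        using inv(4)[of n] q unfolding tighter_def by blast
      note gl = glim[OF K'(1,4)]
      have "fam_norm \<F> (\<lambda>x. local_rep c c' (f n) x - local_rep c c' g x) (snd c ` K) < \<epsilon>"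
        using order_trans[OF fam_norm_mono[OF K'(3)] conjunct2[OF gl]] K'(5) by (rule le_less_trans)
      then show ?thesis using gl K'(2) by (auto simp: chart_close_def)
    qed
    then show ?thesis using g unfolding cond_nbhd_def by blast
  qed
  have "g \<in> U" using gP[of 0] P0(3) by (auto simp: zero)
  moreover have "g \<in> G n" for n using gP[of "Suc n"] step(1)[of n] by blast
  ultimately show ?thesis by blast
qed

theorem Baire_space_X: "Baire_space X"
  unfolding Baire_space_def
proof (intro allI impI)
  fix \<G> assume \<G>: "countable \<G> \<and> (\<forall>G\<in>\<G>. openin X G \<and> X closure_of G = topspace X)"
  \<comment> \<open>adding the whole space makes the family nonempty, so that a sequence can enumerate it\<close>
  let ?\<G> = "insert (topspace X) \<G>"
  define G where "G = from_nat_into ?\<G>"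
  have range_G: "range G = ?\<G>" unfolding G_def using \<G> by (intro range_from_nat_into) auto
  have G: "openin X (G n)" "X closure_of (G n) = topspace X" for n
  proof -
    have "G n \<in> ?\<G>" using range_G by blast
    then show "openin X (G n)" "X closure_of (G n) = topspace X" using \<G> closure_of_topspace[of X] by auto
  qed
  show "X closure_of (topspace X \<inter> \<Inter>\<G>) = topspace X"
  proof (rule subset_antisym[OF closure_of_subset_topspace], rule subsetI)
    fix f assume f: "f \<in> topspace X"
    show "f \<in> X closure_of (topspace X \<inter> \<Inter>\<G>)"
      unfolding in_closure_of
    proof (intro conjI allI impI f)
      fix T assume T: "f \<in> T \<and> openin X T"
      then obtain g where g: "g \<in> T" "\<And>n. g \<in> G n"
        using dense_openin_sequence_meets[of G T] G by blast
      have "g \<in> A" if "A \<in> \<G>" for A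
      proof -
        have "A \<in> range G" using range_G that by blast
        then show ?thesis using g(2) by blast
      qed
      then show "\<exists>y. y \<in> topspace X \<inter> \<Inter>\<G> \<and> y \<in> T" using g T openin_subset by blast
    qed
  qed
qed

end

section \<open>The weak and the strong topology\<close>

lemma weak_nbhd_eq: "weak_nbhd F M N f c c' K \<epsilon> = cond_nbhd F M N f {(c, c', K, \<epsilon>)}"
  by (rule set_eqI) (simp add: weak_nbhd_def cond_nbhd_def)

lemma strong_nbhd_eq:
  "strong_nbhd F M N f T \<Phi> \<Psi> K \<epsilon> = cond_nbhd F M N f ((\<lambda>t. (\<Phi> t, \<Psi> t, K t, \<epsilon> t)) ` T)"
proof (intro set_eqI iffI)
  fix g assume "g \<in> strong_nbhd F M N f T \<Phi> \<Psi> K \<epsilon>"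
  then show "g \<in> cond_nbhd F M N f ((\<lambda>t. (\<Phi> t, \<Psi> t, K t, \<epsilon> t)) ` T)"
    unfolding strong_nbhd_def cond_nbhd_def by blast
next
  fix g assume g: "g \<in> cond_nbhd F M N f ((\<lambda>t. (\<Phi> t, \<Psi> t, K t, \<epsilon> t)) ` T)"
  have "chart_close F (\<Phi> t) (\<Psi> t) (K t) (\<epsilon> t) f g" if "t \<in> T" for t
    by (rule cond_nbhdD(2)[OF g imageI[OF that]])
  then show "g \<in> strong_nbhd F M N f T \<Phi> \<Psi> K \<epsilon>"
    using cond_nbhdD(1)[OF g] by (simp add: strong_nbhd_def)
qed

text \<open>
  The neighbourhoods generating the topology may be centred anywhere. After recentring, finite
  intersections of them become unions of families, so that neighbourhoods centred at \<open>f\<close> form a base at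
  \<open>f\<close>.
\<close>

lemma generated_topology_base:
  fixes M :: "('a, 'm::fin_dim_inner) manifold" and N :: "('b, 'd::fin_dim_inner) manifold"
    and k :: nat and a :: real
  defines "F \<equiv> Ck_alpha_family k a"
  assumes finite: "\<And>Q. finite Q \<Longrightarrow> Q \<in> \<A>"
    and Un: "\<And>P Q. P \<in> \<A> \<Longrightarrow> Q \<in> \<A> \<Longrightarrow> P \<union> Q \<in> \<A>"
    and image: "\<And>Q h. Q \<in> \<A> \<Longrightarrow> (\<And>q. q \<in> Q \<Longrightarrow> fst (h q) = fst q) \<Longrightarrow> h ` Q \<in> \<A>"
    and S: "\<And>s. s \<in> \<S> \<Longrightarrow> \<exists>f Q. s = cond_nbhd F M N f Q \<and> f \<in> C_fam F M N \<and> Q \<in> \<A> \<and> valid_conds M N f Q"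
    and G: "generate_topology_on \<S> G" and f: "f \<in> G"
  shows "\<exists>Q\<in>\<A>. valid_conds M N f Q \<and> cond_nbhd F M N f Q \<subseteq> G"
  using G f
proof induction
  case (Int A B)
  then obtain P Q where P: "P \<in> \<A>" "valid_conds M N f P" "cond_nbhd F M N f P \<subseteq> A"
    and Q: "Q \<in> \<A>" "valid_conds M N f Q" "cond_nbhd F M N f Q \<subseteq> B" by blast
  have "P \<union> Q \<in> \<A>" by (rule Un[OF P(1) Q(1)])
  moreover have "valid_conds M N f (P \<union> Q)" using P Q by (simp add: valid_conds_Un)
  moreover have "cond_nbhd F M N f (P \<union> Q) \<subseteq> A \<inter> B" using P Q unfolding cond_nbhd_Un by blast
  ultimately show ?case by blast
next
  case (UN \<K>)
  then obtain A where A: "A \<in> \<K>" "f \<in> A" by blast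
  from UN.IH[OF this] obtain Q where "Q \<in> \<A>" "valid_conds M N f Q" "cond_nbhd F M N f Q \<subseteq> A" by blast
  moreover have "A \<subseteq> \<Union>\<K>" using A by blast
  ultimately show ?case by (meson order_trans)
next
  case (Basis s)
  then obtain h Q where s: "s = cond_nbhd F M N h Q" and h: "h \<in> C_fam F M N" "Q \<in> \<A>" "valid_conds M N h Q"
    using S by blast
  have "recentre F h f ` Q \<in> \<A>" by (rule image[OF h(2) fst_recentre])
  then show ?case
    using cond_nbhd_recentre[OF h(1)[unfolded F_def] h(3) Basis.prems[unfolded s F_def]] unfolding s F_def by blast
qed simp

lemma whitney_space_weak:
  fixes M :: "('a, 'm::fin_dim_inner) manifold" and N :: "('b, 'd::fin_dim_inner) manifold"
  assumes M: "smooth_manifold m M" and N: "smooth_manifold d N" and a: "0 \<le> a" "a \<le> 1"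
  shows "whitney_space M N m d k a {Q. finite Q} (weak_whitney (Ck_alpha_family k a) M N)"
proof -
  let ?F = "Ck_alpha_family k a :: ('m, 'd) seminorm_family"
  let ?S = "{weak_nbhd ?F M N f c c' K \<epsilon> | f c c' K \<epsilon>.
        f \<in> C_fam ?F M N \<and> c \<in> charts M \<and> c' \<in> charts N \<and>
        compactin (mtop M) K \<and> K \<subseteq> fst c \<and> f ` K \<subseteq> fst c' \<and> 0 < \<epsilon>}"
  have X: "weak_whitney ?F M N = topology_generated_by ?S" by (simp only: weak_whitney_def)
  obtain c c' where c: "c \<in> charts M" "c' \<in> charts N"
    using smooth_manifold_charts_nonempty[OF M] smooth_manifold_charts_nonempty[OF N] by blast
  have "\<Union>?S = C_fam ?F M N"
  proof (rule subset_antisym; rule subsetI)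
    fix f assume "f \<in> \<Union>?S" then show "f \<in> C_fam ?F M N" by (auto simp: weak_nbhd_def)
  next
    fix f assume f: "f \<in> C_fam ?F M N"
    have "weak_nbhd ?F M N f c c' {} 1 \<in> ?S"
      by (rule CollectI, (rule exI)+, rule conjI, rule refl) (use c f in simp)
    moreover have "f \<in> weak_nbhd ?F M N f c c' {} 1"
      unfolding weak_nbhd_eq using c by (intro cond_nbhd_self f) (simp add: valid_conds_def)
    ultimately show "f \<in> \<Union>?S" by (rule UnionI)
  qed
  then have top: "topspace (weak_whitney ?F M N) = C_fam ?F M N"
    unfolding X topology_generated_by_topspace .
  show ?thesis
  proof (unfold_locales, goal_cases)
    case 1 show ?case by (rule M)
  next
    case 2 show ?case by (rule N)
  next
    case (8) show ?case by (rule top)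
  next
    case (9 f Q)
    have Q: "finite Q" "valid_conds M N f Q" using 9 by auto
    from this show ?case
    proof (induction Q rule: finite_induct)
      case empty
      have "cond_nbhd ?F M N f {} = topspace (weak_whitney ?F M N)"
        unfolding top by (simp add: cond_nbhd_def)
      then show ?case by (simp only: openin_topspace)
    next
      case (insert q Q)
      obtain e e' K \<epsilon> where q: "q = (e, e', K, \<epsilon>)" by (cases q)
      have v: "valid_conds M N f {q}" "valid_conds M N f Q"
        using insert.prems valid_conds_Un[of M N f "{q}" Q] by simp_all
      have "weak_nbhd ?F M N f e e' K \<epsilon> \<in> ?S"
        using valid_condsD[OF v(1), of e e' K \<epsilon>] 9(1) by (intro CollectI exI conjI refl) (simp_all add: q)
      then have "openin (weak_whitney ?F M N) (cond_nbhd ?F M N f {q})"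
        unfolding X q weak_nbhd_eq[symmetric] by (rule topology_generated_by_Basis)
      then have "openin (weak_whitney ?F M N) (cond_nbhd ?F M N f {q} \<inter> cond_nbhd ?F M N f Q)"
        using insert.IH[OF v(2)] by blast
      then show ?case by (simp add: cond_nbhd_Un[symmetric])
    qed
  next
    case (10 G f)
    show ?case
    proof (rule generated_topology_base[where \<S> = ?S])
      fix s assume "s \<in> ?S"
      then obtain f c c' K \<epsilon> where s: "s = weak_nbhd ?F M N f c c' K \<epsilon>" and f: "f \<in> C_fam ?F M N"
        "c \<in> charts M" "c' \<in> charts N" "compactin (mtop M) K" "K \<subseteq> fst c" "f ` K \<subseteq> fst c'" "0 < \<epsilon>" by blast
      have "valid_conds M N f {(c, c', K, \<epsilon>)}" using f by (simp add: valid_conds_def)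
      then show "\<exists>f Q. s = cond_nbhd ?F M N f Q \<and> f \<in> C_fam ?F M N \<and> Q \<in> {Q. finite Q} \<and> valid_conds M N f Q"
        using f(1) unfolding s weak_nbhd_eq by (intro exI conjI refl) simp_all
    next
      show "generate_topology_on ?S G" using 10(1) unfolding X by (rule openin_topology_generated_by)
    qed (use 10 in auto)
  qed (use a in auto)
qed

text \<open>
  Countability is what allows the family to be indexed by natural numbers.
\<close>

definition locally_finite_conds :: "'a topology \<Rightarrow> ('a, 'm, 'b, 'd) condition set \<Rightarrow> bool" where
  "locally_finite_conds X Q \<longleftrightarrow> countable Q \<and> locally_finite_family X Q (\<lambda>q. fst (fst q))"

lemma locally_finite_family_image:
  assumes "locally_finite_family X T U" "\<And>t. t \<in> T \<Longrightarrow> V (h t) = U t"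
  shows "locally_finite_family X (h ` T) V"
  unfolding locally_finite_family_def
proof
  fix x assume "x \<in> topspace X"
  then obtain W where W: "openin X W" "x \<in> W" "finite {t \<in> T. U t \<inter> W \<noteq> {}}"
    using assms(1) unfolding locally_finite_family_def by blast
  have "{s \<in> h ` T. V s \<inter> W \<noteq> {}} \<subseteq> h ` {t \<in> T. U t \<inter> W \<noteq> {}}" using assms(2) by auto
  then have "finite {s \<in> h ` T. V s \<inter> W \<noteq> {}}" using W(3) finite_surj by blast
  then show "\<exists>W. openin X W \<and> x \<in> W \<and> finite {s \<in> h ` T. V s \<inter> W \<noteq> {}}" using W by blast
qed

lemma locally_finite_family_Un:
  assumes "locally_finite_family X S U" "locally_finite_family X T U"
  shows "locally_finite_family X (S \<union> T) U"
  unfolding locally_finite_family_def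
proof
  fix x assume x: "x \<in> topspace X"
  obtain W W' where W: "openin X W" "x \<in> W" "finite {t \<in> S. U t \<inter> W \<noteq> {}}"
    "openin X W'" "x \<in> W'" "finite {t \<in> T. U t \<inter> W' \<noteq> {}}"
    using assms x unfolding locally_finite_family_def by meson
  have "{t \<in> S \<union> T. U t \<inter> (W \<inter> W') \<noteq> {}} \<subseteq> {t \<in> S. U t \<inter> W \<noteq> {}} \<union> {t \<in> T. U t \<inter> W' \<noteq> {}}" by blast
  then have "finite {t \<in> S \<union> T. U t \<inter> (W \<inter> W') \<noteq> {}}" using W finite_subset by blast
  then show "\<exists>W. openin X W \<and> x \<in> W \<and> finite {t \<in> S \<union> T. U t \<inter> W \<noteq> {}}"
    using W by (intro exI[of _ "W \<inter> W'"]) auto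
qed

lemma locally_finite_family_finite: "finite T \<Longrightarrow> locally_finite_family X T U"
  unfolding locally_finite_family_def by (intro ballI exI[of _ "topspace X"]) auto

lemma whitney_space_strong:
  fixes M :: "('a, 'm::fin_dim_inner) manifold" and N :: "('b, 'd::fin_dim_inner) manifold"
  assumes M: "smooth_manifold m M" and N: "smooth_manifold d N" and a: "0 \<le> a" "a \<le> 1"
  shows "whitney_space M N m d k a {Q. locally_finite_conds (mtop M) Q} (strong_whitney (Ck_alpha_family k a) M N)"
proof -
  let ?F = "Ck_alpha_family k a :: ('m, 'd) seminorm_family"
  let ?A = "{Q. locally_finite_conds (mtop M) Q} :: ('a, 'm, 'b, 'd) condition set set"
  let ?S = "{strong_nbhd ?F M N f T \<Phi> \<Psi> K \<epsilon> | f (T :: nat set) \<Phi> \<Psi> K \<epsilon>.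
        f \<in> C_fam ?F M N \<and>
        locally_finite_family (mtop M) T (\<lambda>t. fst (\<Phi> t)) \<and>
        (\<forall>t\<in>T. \<Phi> t \<in> charts M \<and> \<Psi> t \<in> charts N \<and>
           compactin (mtop M) (K t) \<and> K t \<subseteq> fst (\<Phi> t) \<and> f ` K t \<subseteq> fst (\<Psi> t) \<and> 0 < \<epsilon> t)}"
  have X: "strong_whitney ?F M N = topology_generated_by ?S" by (simp only: strong_whitney_def)
  have basic: "cond_nbhd ?F M N f Q \<in> ?S" if f: "f \<in> C_fam ?F M N" and Q: "Q \<in> ?A" "valid_conds M N f Q" for f Q
  proof -
    have cQ: "countable Q" and lQ: "locally_finite_family (mtop M) Q (\<lambda>q. fst (fst q))"
      using Q by (auto simp: locally_finite_conds_def)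
    define r where "r = from_nat_into Q"
    define T where "T = to_nat_on Q ` Q"
    have r: "r (to_nat_on Q q) = q" if "q \<in> Q" for q using cQ that by (simp add: r_def)
    have "strong_nbhd ?F M N f T (\<lambda>t. fst (r t)) (\<lambda>t. fst (snd (r t))) (\<lambda>t. fst (snd (snd (r t)))) (\<lambda>t. snd (snd (snd (r t))))
        = cond_nbhd ?F M N f (r ` T)"
      unfolding strong_nbhd_eq by simp
    also have "r ` T = Q" unfolding T_def using r by (simp add: image_image)
    finally have eq: "cond_nbhd ?F M N f Q = strong_nbhd ?F M N f T (\<lambda>t. fst (r t)) (\<lambda>t. fst (snd (r t)))
        (\<lambda>t. fst (snd (snd (r t)))) (\<lambda>t. snd (snd (snd (r t))))" ..
    have lf: "locally_finite_family (mtop M) T (\<lambda>t. fst (fst (r t)))"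
      unfolding T_def by (rule locally_finite_family_image[OF lQ]) (simp add: r)
    have v: "\<forall>t\<in>T. fst (r t) \<in> charts M \<and> fst (snd (r t)) \<in> charts N \<and>
           compactin (mtop M) (fst (snd (snd (r t)))) \<and> fst (snd (snd (r t))) \<subseteq> fst (fst (r t)) \<and>
           f ` fst (snd (snd (r t))) \<subseteq> fst (fst (snd (r t))) \<and> 0 < snd (snd (snd (r t)))"
    proof
      fix t assume "t \<in> T"
      then have "(fst (r t), fst (snd (r t)), fst (snd (snd (r t))), snd (snd (snd (r t)))) \<in> Q"
        unfolding T_def by (auto simp: r simp del: split_paired_All)
      from valid_condsD[OF Q(2) this] show "fst (r t) \<in> charts M \<and> fst (snd (r t)) \<in> charts N \<and>
           compactin (mtop M) (fst (snd (snd (r t)))) \<and> fst (snd (snd (r t))) \<subseteq> fst (fst (r t)) \<and>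
           f ` fst (snd (snd (r t))) \<subseteq> fst (fst (snd (r t))) \<and> 0 < snd (snd (snd (r t)))"
        by (intro conjI)
    qed
    show ?thesis unfolding eq
      by (rule CollectI, (rule exI)+, rule conjI, rule refl) (intro conjI f lf v)
  qed
  have empty: "{} \<in> ?A" "valid_conds M N f {}" for f
    by (simp_all add: locally_finite_conds_def locally_finite_family_finite valid_conds_def)
  have "\<Union>?S = C_fam ?F M N"
  proof (rule subset_antisym; rule subsetI)
    fix f assume "f \<in> \<Union>?S" then show "f \<in> C_fam ?F M N" by (auto simp: strong_nbhd_def)
  next
    fix f assume f: "f \<in> C_fam ?F M N"
    have "cond_nbhd ?F M N f {} \<in> ?S" by (rule basic[OF f empty])
    moreover have "f \<in> cond_nbhd ?F M N f {}" by (rule cond_nbhd_self[OF f empty(2)])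
    ultimately show "f \<in> \<Union>?S" by (rule UnionI)
  qed
  then have top: "topspace (strong_whitney ?F M N) = C_fam ?F M N"
    unfolding X topology_generated_by_topspace .
  have fin: "Q \<in> ?A" if "finite Q" for Q
    using that by (simp add: locally_finite_conds_def locally_finite_family_finite countable_finite)
  have Un: "P \<union> Q \<in> ?A" if "P \<in> ?A" "Q \<in> ?A" for P Q
    using that by (simp add: locally_finite_conds_def locally_finite_family_Un)
  have image: "h ` Q \<in> ?A" if "Q \<in> ?A" "\<And>q. q \<in> Q \<Longrightarrow> fst (h q) = fst q" for h Q
    using that locally_finite_family_image[of "mtop M" Q "\<lambda>q. fst (fst q)" "\<lambda>q. fst (fst q)" h]
    by (simp add: locally_finite_conds_def)
  show ?thesis
  proof (rule whitney_space.intro[OF M N a fin Un image top])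
    fix f Q assume f: "f \<in> C_fam ?F M N" "Q \<in> ?A" "valid_conds M N f Q"
    show "openin (strong_whitney ?F M N) (cond_nbhd ?F M N f Q)"
      unfolding X by (rule topology_generated_by_Basis[OF basic[OF f]])
  next
    fix G f assume G: "openin (strong_whitney ?F M N) G" and f: "f \<in> G"
    show "\<exists>Q\<in>?A. valid_conds M N f Q \<and> cond_nbhd ?F M N f Q \<subseteq> G"
    proof (rule generated_topology_base[OF fin Un image _ openin_topology_generated_by[OF G[unfolded X]] f])
      fix s assume "s \<in> ?S"
      then obtain f and T :: "nat set" and \<Phi> \<Psi> K \<epsilon> where s: "s = strong_nbhd ?F M N f T \<Phi> \<Psi> K \<epsilon>"
        and f: "f \<in> C_fam ?F M N" and lf: "locally_finite_family (mtop M) T (\<lambda>t. fst (\<Phi> t))"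
        and v: "\<forall>t\<in>T. \<Phi> t \<in> charts M \<and> \<Psi> t \<in> charts N \<and>
           compactin (mtop M) (K t) \<and> K t \<subseteq> fst (\<Phi> t) \<and> f ` K t \<subseteq> fst (\<Psi> t) \<and> 0 < \<epsilon> t"
        by (elim CollectE exE conjE) (rule that)
      let ?Q = "(\<lambda>t. (\<Phi> t, \<Psi> t, K t, \<epsilon> t)) ` T"
      have "?Q \<in> ?A"
        using locally_finite_family_image[OF lf, of "\<lambda>q. fst (fst q)" "\<lambda>t. (\<Phi> t, \<Psi> t, K t, \<epsilon> t)"]
        by (simp add: locally_finite_conds_def)
      moreover have "valid_conds M N f ?Q"
        unfolding valid_conds_def
      proof (intro allI impI)
        fix c c' K' \<epsilon>' assume "(c, c', K', \<epsilon>') \<in> ?Q"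
        then obtain t where t: "t \<in> T" and q: "c = \<Phi> t" "c' = \<Psi> t" "K' = K t" "\<epsilon>' = \<epsilon> t" by auto
        show "c \<in> charts M \<and> c' \<in> charts N \<and> compactin (mtop M) K' \<and> K' \<subseteq> fst c \<and> f ` K' \<subseteq> fst c' \<and> 0 < \<epsilon>'"
          unfolding q by (rule bspec[OF v t])
      qed
      ultimately show "\<exists>f Q. s = cond_nbhd ?F M N f Q \<and> f \<in> C_fam ?F M N \<and> Q \<in> ?A \<and> valid_conds M N f Q"
        using f unfolding s strong_nbhd_eq by (intro exI conjI) (rule refl)
    qed
  qed
qed

lemma Ck_Lip_family_eq: "Ck_Lip_family k = Ck_alpha_family k 1"
  by (simp add: Ck_Lip_family_def Ck_alpha_family_def Ck_Lip_seminorm_def[abs_def] Ck_alpha_seminorm_def[abs_def])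

theorem theorem2:
  fixes M :: "('a, 'm::fin_dim_inner) manifold"
    and N :: "('b, 'd::fin_dim_inner) manifold"
    and m d :: nat
  assumes "smooth_manifold m M"
    and "smooth_manifold d N"
  shows "(\<forall>(k::nat) (\<alpha>::real). 0 \<le> \<alpha> \<and> \<alpha> < 1 \<longrightarrow>
            Baire_space (weak_whitney (Ck_alpha_family k \<alpha>) M N) \<and>
            Baire_space (strong_whitney (Ck_alpha_family k \<alpha>) M N)) \<and>
         (\<forall>k::nat.
            Baire_space (weak_whitney (Ck_Lip_family k) M N) \<and>
            Baire_space (strong_whitney (Ck_Lip_family k) M N))"
proof -
  have "Baire_space (weak_whitney (Ck_alpha_family k \<alpha>) M N) \<and>
      Baire_space (strong_whitney (Ck_alpha_family k \<alpha>) M N)" if "0 \<le> \<alpha>" "\<alpha> \<le> 1" for k \<alpha>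
    using whitney_space.Baire_space_X[OF whitney_space_weak[OF assms that]]
      whitney_space.Baire_space_X[OF whitney_space_strong[OF assms that]] by blast
  then show ?thesis unfolding Ck_Lip_family_eq by auto
qed

end
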